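(* Let $j>0$ be a real number and $K\ge 1$ an integer, both fixed. For each $N$ let $\mu_N$ be the unique invariant probability measure of the Markov process on $\{0,1\}^{\Lambda_N}$, $\Lambda_N=[-N,N]\cap\mathbb Z$, with generator $L_N=N^2\big(L_0+\tfrac1N L_b\big)$ (symmetric simple exclusion with births in $I_+$ and deaths in $I_-$, as defined in the context). Then the macroscopic equation (defined in the context) has a unique stationary solution $\rho^*:[-1,1]\to[0,1]$; it is given by $$\rho^*(r)=J\,r+\tfrac12,\qquad r\in[-1,1],\qquad J=j(1-\alpha^K),$$ where $\alpha\in(0,\infty)$ is the unique positive solution of $$\alpha\,(1+j\alpha^{K-1})=j+\tfrac12 .$$ Moreover, for every integer $k\ge1$, $$\lim_{N\to\infty}\ \max_{(x_1,\dots,x_k)\in\Lambda_N^{k,\neq}}\Big|\mu_N\big(\eta(x_1)\cdots\eta(x_k)\big)-\rho^*(x_1/N)\cdots\rho^*(x_k/N)\Big|=0 .$$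
   Context: **Particle process.** $N$ is a positive integer (large enough that the intervals below lie in $\Lambda_N$), $I_+=[N-K+1,N]\cap\mathbb Z$, $I_-=[-N,-N+K-1]\cap\mathbb Z$. Configurations are $\eta\in\{0,1\}^{\Lambda_N}$. Write $\eta^{(x)}$ for $\eta$ with the occupation number at $x$ flipped, and $\eta^{(x,x+1)}$ for $\eta$ with the occupation numbers at $x$ and $x+1$ exchanged. Put $L_b=L_{b,+}+L_{b,-}$ and $$L_0f(\eta)=\frac12\sum_{x=-N}^{N-1}[f(\eta^{(x,x+1)})-f(\eta)],\qquad L_{b,\pm}f(\eta)=\frac j2\sum_{x\in I_\pm}D_\pm\eta(x)\,[f(\eta^{(x)})-f(\eta)],$$ where $$D_+\eta(x)=[1-\eta(x)]\,\eta(x+1)\eta(x+2)\cdots\eta(N)\quad (x\in I_+),$$ $$D_-\eta(x)=\eta(x)\,[1-\eta(x-1)][1-\eta(x-2)]\cdots[1-\eta(-N)]\quad (x\in I_-)$$ (empty products equal $1$). The continuous-time Markov process with generator $L_N=N^2(L_0+\frac1NL_b)$ has a unique invariant probability measure $\mu_N$; $\mu_N(f)$ denotes the expectation of $f$ under $\mu_N$. $\Lambda_N^{k,\neq}$ is the set of $(x_1,\dots,x_k)\in\Lambda_N^k$ with $x_i\ne x_j$ whenever $i\neq j$. **Macroscopic equation.** Let $P_t(r,r')$, $t>0$, $r,r'\in[-1,1]$, be the transition density of the semigroup with generator $\frac12\Delta$ on $[-1,1]$ with reflecting (Neumann) boundary conditions (taken continuous up to the boundary). The macroscopic equation for $\rho(r,t)$,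 $r\in[-1,1]$, $t\ge0$, is $$\rho(r,t)=\int_{[-1,1]}P_t(r,r')\rho(r',0)\,dr'+\frac j2\int_0^t\Big\{P_s(r,1)\big(1-\rho(1,t-s)^K\big)-P_s(r,-1)\big(1-(1-\rho(-1,t-s))^K\big)\Big\}ds,$$ required for all $r\in[-1,1]$ and $t>0$, for $\rho$ with values in $[0,1]$. It is the integral form of $\partial_t\rho=\frac12\partial_r^2\rho$ on $(-1,1)$ with $\partial_r\rho(1,t)=j(1-\rho(1,t)^K)$ and $\partial_r\rho(-1,t)=j(1-(1-\rho(-1,t))^K)$. A stationary solution is a measurable function $\rho^*:[-1,1]\to[0,1]$ such that $\rho(r,t):=\rho^*(r)$ (independent of $t$) satisfies this equation. *)

theory Defs
  imports "HOL-Probability.Probability"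
begin

section \<open>The particle process\<close>

type_synonym config = "int \<Rightarrow> real"

definition Lam :: "nat \<Rightarrow> int set" where
  "Lam N = {- int N..int N}"

definition configs :: "nat \<Rightarrow> config set" where
  "configs N = Lam N \<rightarrow>\<^sub>E {0, 1}"

definition I_plus :: "nat \<Rightarrow> nat \<Rightarrow> int set" where
  "I_plus K N = {int N - int K + 1..int N}"

definition I_minus :: "nat \<Rightarrow> nat \<Rightarrow> int set" where
  "I_minus K N = {- int N..- int N + int K - 1}"

definition flip :: "int \<Rightarrow> config \<Rightarrow> config" where
  "flip x \<eta> = \<eta>(x := 1 - \<eta> x)"

definition exchange :: "int \<Rightarrow> config \<Rightarrow> config" where
  "exchange x \<eta> = \<eta>(x := \<eta> (x + 1), x + 1 := \<eta> x)"

definition D_plus :: "nat \<Rightarrow> config \<Rightarrow> int \<Rightarrow> real" where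
  "D_plus N \<eta> x = (1 - \<eta> x) * (\<Prod>y\<in>{x + 1..int N}. \<eta> y)"

definition D_minus :: "nat \<Rightarrow> config \<Rightarrow> int \<Rightarrow> real" where
  "D_minus N \<eta> x = \<eta> x * (\<Prod>y\<in>{- int N..x - 1}. 1 - \<eta> y)"

definition L_0 :: "nat \<Rightarrow> (config \<Rightarrow> real) \<Rightarrow> config \<Rightarrow> real" where
  "L_0 N f \<eta> = 1 / 2 * (\<Sum>x\<in>{- int N..int N - 1}. f (exchange x \<eta>) - f \<eta>)"

definition L_b_plus :: "real \<Rightarrow> nat \<Rightarrow> nat \<Rightarrow> (config \<Rightarrow> real) \<Rightarrow> config \<Rightarrow> real" where
  "L_b_plus j K N f \<eta> = j / 2 * (\<Sum>x\<in>I_plus K N. D_plus N \<eta> x * (f (flip x \<eta>) - f \<eta>))"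

definition L_b_minus :: "real \<Rightarrow> nat \<Rightarrow> nat \<Rightarrow> (config \<Rightarrow> real) \<Rightarrow> config \<Rightarrow> real" where
  "L_b_minus j K N f \<eta> = j / 2 * (\<Sum>x\<in>I_minus K N. D_minus N \<eta> x * (f (flip x \<eta>) - f \<eta>))"

definition L_b :: "real \<Rightarrow> nat \<Rightarrow> nat \<Rightarrow> (config \<Rightarrow> real) \<Rightarrow> config \<Rightarrow> real" where
  "L_b j K N f \<eta> = L_b_plus j K N f \<eta> + L_b_minus j K N f \<eta>"

definition generator :: "real \<Rightarrow> nat \<Rightarrow> nat \<Rightarrow> (config \<Rightarrow> real) \<Rightarrow> config \<Rightarrow> real" where
  "generator j K N f \<eta> = (real N)\<^sup>2 * (L_0 N f \<eta> + 1 / real N * L_b j K N f \<eta>)"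

text \<open>
  The transition semigroup is the exponential of the generator. The exponential series converges
  at every \<open>\<eta> \<in> configs N\<close>, because the state space \<open>configs N\<close> is finite and the
  values of \<open>generator j K N f\<close> on it depend only on those of \<open>f\<close> on it
  (when \<open>I_plus K N\<close> and \<open>I_minus K N\<close> lie in \<open>Lam N\<close>).
\<close>
definition markov_semigroup ::
  "real \<Rightarrow> nat \<Rightarrow> nat \<Rightarrow> real \<Rightarrow> (config \<Rightarrow> real) \<Rightarrow> config \<Rightarrow> real" where
  "markov_semigroup j K N t f \<eta> = (\<Sum>n. t ^ n / fact n * (generator j K N ^^ n) f \<eta>)"

definition invariant_measure :: "real \<Rightarrow> nat \<Rightarrow> nat \<Rightarrow> config pmf \<Rightarrow> bool" where
  "invariant_measure j K N \<mu> \<longleftrightarrow>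
     set_pmf \<mu> \<subseteq> configs N \<and>
     (\<forall>t\<ge>0. \<forall>f. measure_pmf.expectation \<mu> (markov_semigroup j K N t f)
                  = measure_pmf.expectation \<mu> f)"

definition distinct_tuples :: "nat \<Rightarrow> nat \<Rightarrow> (nat \<Rightarrow> int) set" where
  "distinct_tuples N k = {x \<in> {1..k} \<rightarrow>\<^sub>E Lam N. inj_on x {1..k}}"

section \<open>The macroscopic equation\<close>

definition kernel_op :: "(real \<Rightarrow> real \<Rightarrow> real \<Rightarrow> real) \<Rightarrow> real \<Rightarrow> (real \<Rightarrow> real) \<Rightarrow> real \<Rightarrow> real" where
  "kernel_op P t f r = (\<integral>q. P t r q * f q \<partial>lebesgue_on {-1..1})"

text \<open>
  The graph of half the Neumann Laplacian on \<open>C[-1,1]\<close>: \<open>f\<close> is of class \<open>C\<^sup>2\<close> on \<open>[-1,1]\<close>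
  (one-sided derivatives at the end points) with vanishing derivative at both end points,
  and \<open>g\<close> is half its second derivative.
\<close>
definition half_neumann_laplacian :: "(real \<Rightarrow> real) \<Rightarrow> (real \<Rightarrow> real) \<Rightarrow> bool" where
  "half_neumann_laplacian f g \<longleftrightarrow>
     (\<exists>f' f''.
        (\<forall>r\<in>{-1..1}. (f has_real_derivative f' r) (at r within {-1..1})
                     \<and> (f' has_real_derivative f'' r) (at r within {-1..1}))
        \<and> continuous_on {-1..1} f''
        \<and> f' (-1) = 0 \<and> f' 1 = 0
        \<and> (\<forall>r\<in>{-1..1}. g r = 1 / 2 * f'' r))"

text \<open>
  \<open>P t r q\<close> (for \<open>t > 0\<close> and \<open>r, q \<in> [-1,1]\<close>) is a transition density, continuous up to the
  boundary, of the strongly continuous Markov semigroup on \<open>C[-1,1]\<close> (with the sup norm) whose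
  infinitesimal generator is half the Neumann Laplacian. This determines \<open>P t r q\<close> for all such
  arguments; the values elsewhere are left unspecified.
\<close>
definition neumann_transition_density :: "(real \<Rightarrow> real \<Rightarrow> real \<Rightarrow> real) \<Rightarrow> bool" where
  "neumann_transition_density P \<longleftrightarrow>
     (\<forall>t>0. continuous_on ({-1..1} \<times> {-1..1}) (\<lambda>(r, q). P t r q)) \<and>
     (\<forall>t>0. \<forall>r\<in>{-1..1}. \<forall>q\<in>{-1..1}. 0 \<le> P t r q) \<and>
     (\<forall>t>0. \<forall>r\<in>{-1..1}. kernel_op P t (\<lambda>_. 1) r = 1) \<and>
     (\<forall>f. continuous_on {-1..1} f \<longrightarrow>
        (\<forall>s>0. \<forall>t>0. \<forall>r\<in>{-1..1}. kernel_op P (s + t) f r = kernel_op P s (kernel_op P t f) r) \<and>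
        uniform_limit {-1..1} (\<lambda>t. kernel_op P t f) f (at_right 0)) \<and>
     (\<forall>f g. continuous_on {-1..1} f \<longrightarrow> continuous_on {-1..1} g \<longrightarrow>
        (uniform_limit {-1..1} (\<lambda>t r. (kernel_op P t f r - f r) / t) g (at_right 0)
           \<longleftrightarrow> half_neumann_laplacian f g))"

text \<open>The density profile is written \<open>\<rho> r t\<close>, space before time, whereas the kernel is \<open>P t r q\<close>.\<close>
definition macroscopic_solution ::
  "(real \<Rightarrow> real \<Rightarrow> real \<Rightarrow> real) \<Rightarrow> real \<Rightarrow> nat \<Rightarrow> (real \<Rightarrow> real \<Rightarrow> real) \<Rightarrow> bool" where
  "macroscopic_solution P j K \<rho> \<longleftrightarrow>
     (\<forall>r\<in>{-1..1}. \<forall>t\<ge>0. \<rho> r t \<in> {0..1}) \<and>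
     (\<forall>r\<in>{-1..1}. \<forall>t>0.
        \<rho> r t = (\<integral>q. P t r q * \<rho> q 0 \<partial>lebesgue_on {-1..1})
          + j / 2 * (\<integral>s. P s r 1 * (1 - \<rho> 1 (t - s) ^ K)
                        - P s r (-1) * (1 - (1 - \<rho> (-1) (t - s)) ^ K) \<partial>lebesgue_on {0..t}))"

definition stationary_solution ::
  "(real \<Rightarrow> real \<Rightarrow> real \<Rightarrow> real) \<Rightarrow> real \<Rightarrow> nat \<Rightarrow> (real \<Rightarrow> real) \<Rightarrow> bool" where
  "stationary_solution P j K \<rho> \<longleftrightarrow>
     \<rho> \<in> borel_measurable (lebesgue_on {-1..1}) \<and>
     macroscopic_solution P j K (\<lambda>r t. \<rho> r)"

end

theory Submission
  imports Defs "HOL-Real_Asymp.Real_Asymp"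
begin

text \<open>
  The correlation functions of \<open>\<mu>\<^sub>N\<close> solve a discrete Poisson equation for interacting particles whose
  source is bounded and lives near the two reservoirs. A comparison argument, in which two
  configurations differing by the position of one particle coalesce, shows that they are
  equicontinuous on the macroscopic scale, uniformly in \<open>N\<close>. Hence in the boundary terms occupation
  variables may be replaced by averages over small macroscopic boxes. Let \<open>\<xi> = \<eta> - \<rho>\<^sup>*\<close> and let \<open>\<phi>\<close> be \<open>\<xi>\<close>
  smoothed by a resolvent of the discrete Neumann Laplacian. Stationarity of \<open>\<Sum> \<phi>\<^sup>2\<close> says that the
  Dirichlet energy of \<open>\<phi>\<close> plus a boundary term close to \<open>j E[(\<Theta>\<^sup>K - \<alpha>\<^sup>K)(\<Theta> - \<alpha>)]\<close> at each end,
  \<open>\<Theta>\<close> being the local density there, is negligible. Both are nonnegative because \<open>x \<mapsto> x\<^sup>K\<close> is monotone, so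
  \<open>\<phi>\<close> tends to \<open>0\<close> in mean square. The density is therefore asymptotically deterministic and equal to
  \<open>\<rho>\<^sup>*\<close>, which with the equicontinuity gives the factorization of all correlations.

  For the macroscopic equation, \<open>\<integral>\<^sub>0\<^sup>t P\<^sub>s(r, \<plusminus>1) ds = t/2 - (P\<^sub>t f - f)(r)\<close> with
  \<open>f(r) = (1 \<plusminus> r)\<^sup>2/2\<close>. A stationary solution minus the corresponding combination of these parabolas
  is a bounded function which the semigroup shifts by a constant multiple of \<open>t\<close>; so the multiple is \<open>0\<close>,
  the function is invariant, hence in the kernel of the generator, hence constant.
\<close>

section \<open>The resolvent of the discrete Neumann Laplacian\<close>

text \<open>The correlation equations do not close, since births and deaths depend on up to
  \<open>K\<close> sites. They serve only as a Poisson equation with a source of order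
  \<open>j / N\<close>; the nonlinearity is resolved by the dissipation. There the averages at the
  ends are not free to choose: differentiating the sum of squares produces the twice smoothed field,
  so \<Theta> must carry the weights of the squared resolvent. The inverse smoothing length \<theta>
  is squeezed from both sides. Exchanges contribute a quadratic correction of order
  \<open>N ^ 2 * \<theta> ^ 3\<close>, so \<theta> must be much smaller than
  \<open>N powr (- 2 / 3)\<close>. Replacing a site by an average over \<open>1 / \<theta>\<close>
  sites costs \<open>\<delta> + 1 / (\<delta> * \<theta> * N)\<close>, so \<theta> must be much
  larger than \<open>1 / N\<close>. Both hold for \<theta> = \<open>N powr (- 3 / 4)\<close> and
  \<delta> = \<open>N powr (- 1 / 8)\<close>. For the macroscopic equation the obstacle is that each
  parabola has nonzero slope at one end and so lies outside the domain of the generator, while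
  \<open>P\<close> is known only through its action on functions. Polynomial bumps at the end points
  bridge both gaps.\<close>

definition lap :: "nat \<Rightarrow> (int \<Rightarrow> real) \<Rightarrow> int \<Rightarrow> real" where
  "lap N f x = (if x < int N then f (x + 1) - f x else 0) + (if - int N < x then f (x - 1) - f x else 0)"

abbreviation bonds :: "nat \<Rightarrow> int set" where
  "bonds N \<equiv> {- int N..int N - 1}"

abbreviation swap :: "int \<Rightarrow> int \<Rightarrow> int" where
  "swap b \<equiv> Transposition.transpose b (b + 1)"

lemma finite_Lam [simp]: "finite (Lam N)"
  by (simp add: Lam_def)

lemma swap_in_Lam [simp]: "b \<in> bonds N \<Longrightarrow> swap b x \<in> Lam N \<longleftrightarrow> x \<in> Lam N"
  by (auto simp: Lam_def Transposition.transpose_def split: if_splits)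

text \<open>Only the two bonds touching \<open>x\<close> move it, and at an end of the box one of
  them is missing: this is where the reflecting boundary comes from.\<close>

lemma sum_swap_bonds:
  assumes "x \<in> Lam N"
  shows "(\<Sum>b\<in>bonds N. f (swap b x) - f x) = lap N f x"
proof -
  have "(\<Sum>b\<in>bonds N. f (swap b x) - f x)
      = (\<Sum>b\<in>bonds N. (if b = x then f (x + 1) - f x else 0) + (if b = x - 1 then f (x - 1) - f x else 0))"
    by (intro sum.cong refl) (auto simp: Transposition.transpose_def)
  also have "\<dots> = lap N f x"
    using assms by (simp add: sum.distrib sum.delta lap_def Lam_def)
  finally show ?thesis .
qed

text \<open>Arranged bond by bond: swapping one bond changes \<open>g\<close> only at its two ends,
  so no boundary terms appear.\<close>

lemma sum_by_parts:
  fixes f g :: "int \<Rightarrow> real"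
  shows "(\<Sum>x\<in>Lam N. f x * lap N g x) = - (\<Sum>b\<in>bonds N. (f (b + 1) - f b) * (g (b + 1) - g b))"
proof -
  have "(\<Sum>x\<in>Lam N. f x * lap N g x) = (\<Sum>x\<in>Lam N. \<Sum>b\<in>bonds N. f x * (g (swap b x) - g x))"
    by (intro sum.cong refl) (simp add: sum_swap_bonds[symmetric] sum_distrib_left)
  also have "\<dots> = (\<Sum>b\<in>bonds N. \<Sum>x\<in>Lam N. f x * (g (swap b x) - g x))"
    by (rule sum.swap)
  also have "\<dots> = (\<Sum>b\<in>bonds N. - ((f (b + 1) - f b) * (g (b + 1) - g b)))"
  proof (intro sum.cong refl)
    fix b assume b: "b \<in> bonds N"
    have "(\<Sum>x\<in>Lam N. f x * (g (swap b x) - g x)) = (\<Sum>x\<in>{b, b + 1}. f x * (g (swap b x) - g x))"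
      using b by (intro sum.mono_neutral_right) (auto simp: Lam_def Transposition.transpose_def)
    also have "\<dots> = - ((f (b + 1) - f b) * (g (b + 1) - g b))"
      by (simp add: algebra_simps)
    finally show "(\<Sum>x\<in>Lam N. f x * (g (swap b x) - g x)) = - ((f (b + 1) - f b) * (g (b + 1) - g b))" .
  qed
  finally show ?thesis by (simp add: sum_negf)
qed

lemma lap_selfadjoint: "(\<Sum>x\<in>Lam N. f x * lap N g x) = (\<Sum>x\<in>Lam N. lap N f x * g x)"
  using sum_by_parts[where N = N and f = f and g = g] sum_by_parts[where N = N and f = g and g = f] by (simp add: mult.commute)

lemma sum_lap: "(\<Sum>x\<in>Lam N. lap N g x) = 0"
  using sum_by_parts[where N = N and f = "\<lambda>_. 1" and g = g] by simp

lemma lap_sum_fun: "lap N (\<lambda>x. \<Sum>i\<in>A. f i x) x = (\<Sum>i\<in>A. lap N (f i) x)"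
  by (simp add: lap_def sum.distrib sum_subtractf)

lemma lap_mult_const: "lap N (\<lambda>x. f x * c) x = lap N f x * c"
  by (simp add: lap_def algebra_simps)

text \<open>The factor by which the second difference multiplies
  \<open>cosh (\<theta> * x + c)\<close>. It is of order \<open>\<theta> ^ 2\<close>, so \<theta> is
  an inverse length.\<close>

definition res_rate :: "real \<Rightarrow> real" where
  "res_rate \<theta> = 2 * cosh \<theta> - 2"

text \<open>The kernel is the product of the solutions of \<open>lap f = res_rate \<theta> * f\<close> that are reflecting at the
  left and at the right end, divided by their Wronskian.\<close>
definition res_kernel :: "real \<Rightarrow> nat \<Rightarrow> int \<Rightarrow> int \<Rightarrow> real" where
  "res_kernel \<theta> N x z = res_rate \<theta> / (sinh \<theta> * sinh (\<theta> * (2 * real N + 1)))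
     * cosh (\<theta> * (real_of_int (min x z) + real N + 1 / 2))
     * cosh (\<theta> * (real N + 1 / 2 - real_of_int (max x z)))"

lemma res_kernel_sym: "res_kernel \<theta> N x z = res_kernel \<theta> N z x"
  by (simp add: res_kernel_def min.commute max.commute)

lemma res_kernel_uminus: "res_kernel \<theta> N (- x) (- z) = res_kernel \<theta> N x z"
proof -
  have "min (- x) (- z) = - max x z" "max (- x) (- z) = - min x z" by auto
  then show ?thesis by (simp add: res_kernel_def algebra_simps)
qed

lemma res_rate_pos: "\<theta> > 0 \<Longrightarrow> res_rate \<theta> > 0"
  using cosh_real_strict_mono[of 0 \<theta>] by (simp add: res_rate_def)

lemma res_kernel_nonneg:
  assumes "\<theta> > 0" shows "res_kernel \<theta> N x z \<ge> 0"
  using assms res_rate_pos[OF assms] by (auto simp: res_kernel_def intro!: mult_nonneg_nonneg divide_nonneg_nonneg)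

lemma cosh_shift_sum: "cosh (a + b) + cosh (a - b) = 2 * cosh b * cosh (a::real)"
  by (simp add: cosh_add cosh_diff)

lemma res_kernel_lap:
  assumes \<theta>: "\<theta> > 0" and x: "x \<in> Lam N" and z: "z \<in> Lam N" and N: "N \<ge> 1"
  shows "lap N (\<lambda>x. res_kernel \<theta> N x z) x = res_rate \<theta> * (res_kernel \<theta> N x z - (if x = z then 1 else 0))"
proof -
  define c where "c = res_rate \<theta> / (sinh \<theta> * sinh (\<theta> * (2 * real N + 1)))"
  define p where "p = (\<lambda>x::int. cosh (\<theta> * (real_of_int x + real N + 1 / 2)))"
  define q where "q = (\<lambda>x::int. cosh (\<theta> * (real N + 1 / 2 - real_of_int x)))"
  have R: "res_kernel \<theta> N x z = c * p (min x z) * q (max x z)" for x z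
    by (simp add: res_kernel_def c_def p_def q_def)
  have pp: "p (y + 1) + p (y - 1) = (res_rate \<theta> + 2) * p y" for y
    using cosh_shift_sum[of "\<theta> * (real_of_int y + real N + 1 / 2)" \<theta>]
    by (simp add: p_def res_rate_def algebra_simps)
  have qq: "q (y + 1) + q (y - 1) = (res_rate \<theta> + 2) * q y" for y
    using cosh_shift_sum[of "\<theta> * (real N + 1 / 2 - real_of_int y)" \<theta>]
    by (simp add: q_def res_rate_def algebra_simps)
  \<comment> \<open>The offset 1/2 centres \<open>cosh\<close> on the missing bond, so evenness
    gives reflection.\<close>
  have pb: "p (- int N - 1) = p (- int N)"
    using cosh_minus[of "\<theta> / 2"] by (simp add: p_def algebra_simps)
  have qb: "q (int N + 1) = q (int N)"
    using cosh_minus[of "\<theta> / 2"] by (simp add: q_def algebra_simps)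
  \<comment> \<open>The Wronskian is constant in \<open>y\<close> by the addition formulas;
    \<open>c\<close> normalises it to \<open>res_rate \<theta>\<close>.\<close>
  have W: "p (y + 1) * q y - p y * q (y + 1) = sinh (\<theta> * (2 * real N + 1)) * sinh \<theta>" for y
  proof -
    define a where "a = \<theta> * (real_of_int y + real N + 1 / 2)"
    define b where "b = \<theta> * (real N + 1 / 2 - real_of_int y)"
    have "p (y + 1) = cosh (a + \<theta>)" "q (y + 1) = cosh (b - \<theta>)" "p y = cosh a" "q y = cosh b"
      by (simp_all add: p_def q_def a_def b_def algebra_simps)
    moreover have "\<theta> * (2 * real N + 1) = a + b" by (simp add: a_def b_def algebra_simps)
    ultimately have "p (y + 1) * q y - p y * q (y + 1) - sinh (\<theta> * (2 * real N + 1)) * sinh \<theta> = 0"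
      by (simp only: cosh_add cosh_diff sinh_add) (simp add: algebra_simps)
    then show ?thesis by simp
  qed
  have cW: "c * (p (y + 1) * q y - p y * q (y + 1)) = res_rate \<theta>" for y
    unfolding W using \<theta> by (simp add: c_def)
  consider "x < z" | "x = z" | "x > z" by linarith
  then show ?thesis
  proof cases
    case 1
    then have "x < int N" using z by (auto simp: Lam_def)
    moreover have "x = - int N \<Longrightarrow> p (x - 1) - p x = 0" using pb by simp
    moreover have "res_kernel \<theta> N x z = c * q z * p x" "res_kernel \<theta> N (x + 1) z = c * q z * p (x + 1)"
        "res_kernel \<theta> N (x - 1) z = c * q z * p (x - 1)"
      using 1 by (simp_all add: R min_absorb1 max_absorb2)
    ultimately have "lap N (\<lambda>x. res_kernel \<theta> N x z) x = c * q z * (p (x + 1) - p x + (p (x - 1) - p x))"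
      using x by (cases "x = - int N") (simp_all add: lap_def Lam_def algebra_simps)
    also have "\<dots> = c * q z * (res_rate \<theta> * p x)"
      using pp[of x] by (simp add: algebra_simps)
    finally show ?thesis using 1 by (simp add: R)
  next
    case 3
    then have "x > - int N" using z by (auto simp: Lam_def)
    moreover have "x = int N \<Longrightarrow> q (x + 1) - q x = 0" using qb by simp
    moreover have "res_kernel \<theta> N x z = c * p z * q x" "res_kernel \<theta> N (x + 1) z = c * p z * q (x + 1)"
        "res_kernel \<theta> N (x - 1) z = c * p z * q (x - 1)"
      using 3 by (simp_all add: R min_absorb2 max_absorb1)
    ultimately have "lap N (\<lambda>x. res_kernel \<theta> N x z) x = c * p z * (q (x + 1) - q x + (q (x - 1) - q x))"
      using x by (cases "x = int N") (simp_all add: lap_def Lam_def algebra_simps)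
    also have "\<dots> = c * p z * (res_rate \<theta> * q x)"
      using qq[of x] by (simp add: algebra_simps)
    finally show ?thesis using 3 by (simp add: R)
  next
    case 2
    have "x = int N \<Longrightarrow> q (x + 1) - q x = 0" "x = - int N \<Longrightarrow> p (x - 1) - p x = 0"
      using qb pb by simp_all
    then have "lap N (\<lambda>x. res_kernel \<theta> N x z) x
      = c * p x * (q (x + 1) - q x) + c * q x * (p (x - 1) - p x)"
      using 2 x N by (auto simp: lap_def R min_def max_def Lam_def algebra_simps)
    also have "p (x - 1) = (res_rate \<theta> + 2) * p x - p (x + 1)" using pp[of x] by simp
    also have "c * p x * (q (x + 1) - q x) + c * q x * ((res_rate \<theta> + 2) * p x - p (x + 1) - p x)
      = res_rate \<theta> * (c * p x * q x) - c * (p (x + 1) * q x - p x * q (x + 1))"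
      by (simp add: algebra_simps)
    finally show ?thesis using 2 cW[of x] by (simp add: R algebra_simps)
  qed
qed

text \<open>The Laplacian sums to zero, so summing the resolvent equation forces total mass one;
  symmetry gives the other marginal.\<close>

lemma res_kernel_sum:
  assumes "\<theta> > 0" "z \<in> Lam N" "N \<ge> 1"
  shows "(\<Sum>x\<in>Lam N. res_kernel \<theta> N x z) = 1" "(\<Sum>x\<in>Lam N. res_kernel \<theta> N z x) = 1"
proof -
  have "0 = (\<Sum>x\<in>Lam N. res_rate \<theta> * (res_kernel \<theta> N x z - (if x = z then 1 else 0)))"
    using sum_lap[of N "\<lambda>x. res_kernel \<theta> N x z"] res_kernel_lap[OF assms(1) _ assms(2,3)]
    by simp
  also have "\<dots> = res_rate \<theta> * ((\<Sum>x\<in>Lam N. res_kernel \<theta> N x z) - 1)"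
    using assms(2) by (simp add: sum_distrib_left[symmetric] sum_subtractf sum.delta)
  finally show "(\<Sum>x\<in>Lam N. res_kernel \<theta> N x z) = 1"
    using res_rate_pos[OF assms(1)] by simp
  then show "(\<Sum>x\<in>Lam N. res_kernel \<theta> N z x) = 1"
    by (simp add: res_kernel_sym[of \<theta> N z])
qed

section \<open>Size and moments of the resolvent kernel\<close>

lemma le_sinh: "0 \<le> x \<Longrightarrow> x \<le> sinh (x :: real)"
  using real_le_x_sinh[of x] by (simp add: sinh_field_def exp_minus)

lemma res_rate_bounds:
  assumes "0 < \<theta>" "\<theta> \<le> 1"
  shows "\<theta>\<^sup>2 \<le> res_rate \<theta>" "res_rate \<theta> \<le> 2 * \<theta>\<^sup>2"
proof -
  have e: "res_rate \<theta> = 4 * (sinh (\<theta> / 2))\<^sup>2"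
    using cosh_double[of "\<theta> / 2"] cosh_square_eq[of "\<theta> / 2"] by (simp add: res_rate_def)
  have "\<theta> / 2 \<le> sinh (\<theta> / 2)" using le_sinh[of "\<theta> / 2"] assms by simp
  then show "\<theta>\<^sup>2 \<le> res_rate \<theta>" 
    using power_mono[of "\<theta> / 2" "sinh (\<theta> / 2)" 2] assms by (simp add: e power_divide)
  have "exp \<theta> \<le> 1 + \<theta> + \<theta>\<^sup>2" using assms exp_bound[of \<theta>] by simp
  moreover have "exp (- \<theta>) \<le> 1 - \<theta> + \<theta>\<^sup>2"
  proof -
    have "exp (- \<theta>) \<le> 1 / (1 + \<theta>)"
      using exp_ge_add_one_self[of \<theta>] assms by (simp add: exp_minus field_simps)
    also have "\<dots> \<le> 1 - \<theta> + \<theta>\<^sup>2"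
      using assms by (simp add: field_simps power2_eq_square)
    finally show ?thesis .
  qed
  moreover have "res_rate \<theta> = exp \<theta> + exp (- \<theta>) - 2"
    by (simp add: res_rate_def cosh_field_def add_divide_distrib)
  ultimately show "res_rate \<theta> \<le> 2 * \<theta>\<^sup>2" by linarith
qed

text \<open>When the length \<open>1 / \<theta>\<close> fits into the box, reflections change the
  peak of the free kernel, of order \<theta>, only by a bounded factor. For much smaller \<theta>
  the kernel is nearly uniform, of height about \<open>1 / (2 * real N + 1)\<close>, and the bound
  fails.\<close>

lemma res_kernel_le:
  assumes \<theta>: "0 < \<theta>" "\<theta> \<le> 1" and N: "\<theta> * real N \<ge> 1" and x: "x \<in> Lam N" and z: "z \<in> Lam N"
  shows "res_kernel \<theta> N x z \<le> 4 * \<theta>"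
proof -
  define H where "H = \<theta> * (2 * real N + 1)"
  have H: "H \<ge> 1" using N \<theta> by (simp add: H_def algebra_simps)
  define a where "a = \<theta> * (real_of_int (min x z) + real N + 1 / 2)"
  define b where "b = \<theta> * (real N + 1 / 2 - real_of_int (max x z))"
  have ab: "0 \<le> a" "0 \<le> b" using \<theta> x z by (auto simp: a_def b_def Lam_def)
  have "a + b \<le> H" using \<theta> by (simp add: a_def b_def H_def distrib_left[symmetric])
  have "cosh a * cosh b \<le> cosh (a + b)" using ab by (simp add: cosh_add)
  also have "\<dots> \<le> cosh H" using ab \<open>a + b \<le> H\<close> by (simp add: cosh_real_nonneg_le_iff)
  finally have 1: "cosh a * cosh b \<le> cosh H" .
  have "3 \<le> exp (2 * H)" using exp_ge_add_one_self[of "2 * H"] H by linarith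
  then have "3 * exp (- H) \<le> exp (2 * H) * exp (- H)" by (intro mult_right_mono) auto
  then have 2: "cosh H \<le> 2 * sinh H" by (simp add: exp_add[symmetric] cosh_field_def sinh_field_def)
  have 3: "\<theta> \<le> sinh \<theta>" using le_sinh[of \<theta>] \<theta> by simp
  have "res_kernel \<theta> N x z = res_rate \<theta> / (sinh \<theta> * sinh H) * (cosh a * cosh b)"
    by (simp add: res_kernel_def a_def b_def H_def)
  also have "\<dots> \<le> res_rate \<theta> / (sinh \<theta> * sinh H) * (2 * sinh H)"
    using 1 2 res_rate_pos[OF \<theta>(1)] \<theta> H by (intro mult_left_mono) (auto intro!: divide_nonneg_nonneg)
  also have "\<dots> = 2 * res_rate \<theta> / sinh \<theta>" using H by simp
  also have "\<dots> \<le> 2 * (2 * \<theta>\<^sup>2) / \<theta>"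
    using res_rate_bounds[OF \<theta>] 3 \<theta> by (intro frac_le) auto
  also have "\<dots> = 4 * \<theta>" using \<theta> by (simp add: power2_eq_square)
  finally show ?thesis .
qed

text \<open>Self-adjointness moves the Laplacian from the kernel to the squared distance, where it
  is at most 2, reflection at the ends only lowering it.\<close>

lemma res_kernel_second_moment:
  assumes "0 < \<theta>" "x \<in> Lam N" "N \<ge> 1"
  shows "(\<Sum>y\<in>Lam N. res_kernel \<theta> N x y * (real_of_int (y - x))\<^sup>2) \<le> 2 / res_rate \<theta>"
proof -
  let ?f = "\<lambda>y. (real_of_int (y - x))\<^sup>2"
  have lf: "lap N ?f y \<le> 2" if "y \<in> Lam N" for y
    using that assms(2) by (auto simp: lap_def Lam_def power2_eq_square algebra_simps)
  have "res_rate \<theta> * (\<Sum>y\<in>Lam N. res_kernel \<theta> N x y * ?f y)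
      = (\<Sum>y\<in>Lam N. (res_rate \<theta> * (res_kernel \<theta> N y x - (if y = x then 1 else 0))) * ?f y)"
    unfolding sum_distrib_left by (intro sum.cong refl) (simp add: res_kernel_sym[of \<theta> N x])
  also have "\<dots> = (\<Sum>y\<in>Lam N. lap N (\<lambda>y. res_kernel \<theta> N y x) y * ?f y)"
    using res_kernel_lap[OF assms(1) _ assms(2,3)] by simp
  also have "\<dots> = (\<Sum>y\<in>Lam N. res_kernel \<theta> N y x * lap N ?f y)"
    by (simp add: lap_selfadjoint)
  also have "\<dots> \<le> (\<Sum>y\<in>Lam N. res_kernel \<theta> N y x * 2)"
    by (intro sum_mono mult_left_mono lf res_kernel_nonneg assms)
  also have "\<dots> = 2" using res_kernel_sum[OF assms] by (simp add: sum_distrib_right[symmetric])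
  finally show ?thesis using res_rate_pos[OF assms(1)] by (simp add: field_simps)
qed

text \<open>Young's inequality against the second moment, weighted so that both terms are of order
  \<open>1 / \<theta>\<close>.\<close>

lemma res_kernel_first_moment:
  assumes "0 < \<theta>" "\<theta> \<le> 1" "x \<in> Lam N" "N \<ge> 1"
  shows "(\<Sum>y\<in>Lam N. res_kernel \<theta> N x y * \<bar>real_of_int (y - x)\<bar>) \<le> 3 / (2 * \<theta>)"
proof -
  have p: "\<bar>d\<bar> \<le> \<theta> / 2 * d\<^sup>2 + 1 / (2 * \<theta>)" for d :: real
  proof -
    have "0 \<le> (\<theta> * \<bar>d\<bar> - 1)\<^sup>2" by simp
    then have "2 * \<theta> * \<bar>d\<bar> \<le> \<theta>\<^sup>2 * d\<^sup>2 + 1" by (simp add: power2_diff power_mult_distrib)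
    then show ?thesis using assms(1) by (simp add: field_simps power2_eq_square)
  qed
  have "(\<Sum>y\<in>Lam N. res_kernel \<theta> N x y * \<bar>real_of_int (y - x)\<bar>)
     \<le> (\<Sum>y\<in>Lam N. res_kernel \<theta> N x y * (\<theta> / 2 * (real_of_int (y - x))\<^sup>2 + 1 / (2 * \<theta>)))"
    by (intro sum_mono mult_left_mono p res_kernel_nonneg assms)
  also have "\<dots> = \<theta> / 2 * (\<Sum>y\<in>Lam N. res_kernel \<theta> N x y * (real_of_int (y - x))\<^sup>2)
       + 1 / (2 * \<theta>) * (\<Sum>y\<in>Lam N. res_kernel \<theta> N x y)"
    unfolding sum_distrib_left sum.distrib[symmetric] by (intro sum.cong refl) (simp add: algebra_simps)
  also have "\<dots> \<le> \<theta> / 2 * (2 / res_rate \<theta>) + 1 / (2 * \<theta>)"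
    using res_kernel_second_moment[OF assms(1,3,4)] res_kernel_sum(2)[OF assms(1,3,4)] assms(1)
    by (intro add_mono mult_left_mono) auto
  also have "\<theta> / 2 * (2 / res_rate \<theta>) \<le> \<theta> / 2 * (2 / \<theta>\<^sup>2)"
    using res_rate_bounds(1)[OF assms(1,2)] assms(1) by (intro mult_left_mono divide_left_mono) (auto simp: res_rate_pos)
  also have "\<dots> + 1 / (2 * \<theta>) = 3 / (2 * \<theta>)" using assms(1) by (simp add: field_simps power2_eq_square)
  finally show ?thesis by simp
qed

section \<open>Supersolutions for the comparison principle\<close>

text \<open>Here \<open>m\<close> is the distance to an end of the box. The parabola is cut off at
  \<open>L\<close>: its slope near 0 is of order \<open>1 / N\<close>, as large as the source of the
  correlation equation, while its second difference is smaller by the factor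
  \<open>1 / L\<close>.\<close>

definition barrier :: "nat \<Rightarrow> real \<Rightarrow> int \<Rightarrow> real" where
  "barrier N L m = (max 0 (L - real_of_int m))\<^sup>2 / (L * real N)"

lemma barrier_bounds:
  assumes "0 < L" "0 \<le> m"
  shows "0 \<le> barrier N L m" "barrier N L m \<le> L / real N"
proof -
  show "0 \<le> barrier N L m" using assms by (simp add: barrier_def)
  have "(max 0 (L - real_of_int m))\<^sup>2 \<le> L\<^sup>2" using assms by (intro power_mono) auto
  then have "barrier N L m \<le> L\<^sup>2 / (L * real N)"
    unfolding barrier_def using assms by (intro divide_right_mono) auto
  then show "barrier N L m \<le> L / real N" using assms by (simp add: power2_eq_square)
qed

lemma barrier_mono: "0 < L \<Longrightarrow> m \<le> n \<Longrightarrow> barrier N L n \<le> barrier N L m"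
  unfolding barrier_def by (intro divide_right_mono power_mono) auto

lemma barrier_second_difference:
  assumes "0 < L"
  shows "barrier N L (m + 1) + barrier N L (m - 1) - 2 * barrier N L m \<le> 2 / (L * real N)"
proof -
  define t where "t = L - real_of_int m"
  have t: "(max 0 (t - 1))\<^sup>2 + (max 0 (t + 1))\<^sup>2 - 2 * (max 0 t)\<^sup>2 \<le> 2"
  proof -
    consider "t \<ge> 1" | "0 \<le> t" "t < 1" | "-1 \<le> t" "t < 0" | "t < -1" by linarith
    then show ?thesis
    proof cases
      case 2
      then have "t * t \<ge> 0" "(1 - t) * (1 - t) \<ge> 0" by simp_all
      then show ?thesis using 2 by (simp add: max_def power2_eq_square algebra_simps)
    next
      case 3
      then have "(t + 1)\<^sup>2 \<le> 1\<^sup>2" by (intro power_mono) auto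
      then show ?thesis using 3 by (simp add: max_def)
    qed (simp_all add: max_def power2_eq_square algebra_simps)
  qed
  have "barrier N L (m + 1) + barrier N L (m - 1) - 2 * barrier N L m
     = ((max 0 (t - 1))\<^sup>2 + (max 0 (t + 1))\<^sup>2 - 2 * (max 0 t)\<^sup>2) / (L * real N)"
    by (simp add: barrier_def t_def add_divide_distrib diff_divide_distrib algebra_simps)
  also have "\<dots> \<le> 2 / (L * real N)"
    using t assms by (intro divide_right_mono) auto
  finally show ?thesis .
qed

text \<open>The hypothesis keeps \<open>i\<close> in the first half of the range, where at least
  half of the initial slope, about \<open>2 / N\<close>, is left.\<close>

lemma barrier_first_difference:
  assumes "2 * real i + 1 \<le> L" 
  shows "barrier N L (int i + 1) - barrier N L (int i) \<le> - (1 / real N)"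
proof (cases "N = 0")
  case False
  have "barrier N L (int i + 1) - barrier N L (int i) = (1 - 2 * (L - real i)) / (L * real N)"
    using assms by (simp add: barrier_def max_def diff_divide_distrib[symmetric] power2_eq_square algebra_simps)
  also have "\<dots> \<le> (- L) / (L * real N)"
    using assms by (intro divide_right_mono) auto
  also have "\<dots> = - (1 / real N)" using assms by simp
  finally show ?thesis .
qed (simp add: barrier_def)

lemma lap_uminus: "lap N (\<lambda>x. f (- x)) x = lap N f (- x)"
  by (auto simp: lap_def minus_diff_commute)

text \<open>Freezing the parabola on the sites closer than \<open>i\<close> to the end concentrates
  its slope in one kink, at \<open>int N - int i\<close>. Since \<open>L \<le> real N\<close>, it
  vanishes near the opposite end, where reflection then costs nothing.\<close>

lemma lap_barrier:
  assumes i: "2 * real i + 1 \<le> L" and L: "L \<le> real N" and x: "x \<in> Lam N"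
  shows "lap N (\<lambda>x. barrier N L (max (int N - x) (int i))) x
    \<le> 2 / (L * real N) - (if x = int N - int i then 1 / real N else 0)"
proof -
  define r where "r = (\<lambda>x. barrier N L (max (int N - x) (int i)))"
  have Lp: "L > 0" using i by linarith
  then have N: "N \<ge> 1" using L by (cases N) auto
  have iN: "i < N" using i L by linarith
  consider "int N - x < int i" | "int N - x = int i" | "int N - x > int i" by linarith
  then show ?thesis
  proof cases
    case 1
    then have "lap N r x = 0" using x by (auto simp: lap_def r_def max_def)
    moreover have "x \<noteq> int N - int i" using 1 by simp
    ultimately show ?thesis using Lp by (simp add: r_def)
  next
    case 2
    have x': "x = int N - int i" using 2 by simp
    have eqs: "r x = barrier N L (int i)" "r (x + 1) = barrier N L (int i)" "r (x - 1) = barrier N L (int i + 1)"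
      by (simp_all add: r_def x' max_def add.commute)
    have "- int N < x" using iN x' by simp
    then have "lap N r x \<le> barrier N L (int i + 1) - barrier N L (int i)"
      by (simp add: lap_def eqs)
    also have "\<dots> \<le> - (1 / real N)" by (rule barrier_first_difference[OF i])
    finally have "lap N r x \<le> - (1 / real N)" .
    moreover have "0 \<le> 2 / (L * real N)" using Lp by simp
    ultimately have "lap N r x \<le> 2 / (L * real N) - 1 / real N" by linarith
    then show ?thesis unfolding r_def[symmetric] using x' by metis
  next
    case 3
    define m where "m = int N - x"
    have mono: "barrier N L m \<le> barrier N L (m - 1)" by (rule barrier_mono[OF Lp]) simp
    have eqs: "r x = barrier N L m" "r (x + 1) = barrier N L (m - 1)" "r (x - 1) = barrier N L (m + 1)"
      using 3 by (simp_all add: r_def m_def max_absorb1 algebra_simps)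
    have far: "barrier N L (int N + int N) = 0" "barrier N L (int N + int N + 1) = 0"
      "barrier N L (int N + int N - 1) = 0"
      using L N by (simp_all add: barrier_def max_def)
    have "lap N r x \<le> barrier N L (m + 1) + barrier N L (m - 1) - 2 * barrier N L m"
    proof (cases "x = - int N")
      case True
      then have "m = int N + int N" by (simp add: m_def)
      then show ?thesis using far True eqs by (simp add: lap_def)
    next
      case False
      then have "lap N r x = r (x - 1) - r x + (if x < int N then r (x + 1) - r x else 0)"
        using x by (simp add: lap_def Lam_def)
      moreover have "x < int N" using 3 by simp
      ultimately show ?thesis using eqs by simp
    qed
    also have "\<dots> \<le> 2 / (L * real N)" by (rule barrier_second_difference[OF Lp])
    finally have "lap N r x \<le> 2 / (L * real N)" .
    moreover have "x \<noteq> int N - int i" using 3 by simp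
    ultimately show ?thesis unfolding r_def[symmetric] by simp
  qed
qed

text \<open>One kink at each of the \<open>K\<close> sites of a reservoir, so that the Laplacian is of order \<open>- 1 / N\<close> at all
  of them and not only at the end point.\<close>
definition boundary_barrier :: "nat \<Rightarrow> nat \<Rightarrow> real \<Rightarrow> int \<Rightarrow> real" where
  "boundary_barrier K N L x
     = (\<Sum>i<K. barrier N L (max (int N - x) (int i)) + barrier N L (max (int N - - x) (int i)))"

lemma boundary_barrier_bounds:
  assumes "0 < L" 
  shows "0 \<le> boundary_barrier K N L x" "boundary_barrier K N L x \<le> 2 * real K * (L / real N)"
proof -
  show "0 \<le> boundary_barrier K N L x"
    unfolding boundary_barrier_def using assms by (intro sum_nonneg add_nonneg_nonneg barrier_bounds) auto
  have "boundary_barrier K N L x \<le> (\<Sum>i<K. L / real N + L / real N)"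
    unfolding boundary_barrier_def using assms by (intro sum_mono add_mono barrier_bounds) auto
  then show "boundary_barrier K N L x \<le> 2 * real K * (L / real N)" by (simp add: algebra_simps)
qed

lemma lap_boundary_barrier:
  assumes K: "2 * real K \<le> L" and L: "0 < L" "L \<le> real N" and x: "x \<in> Lam N"
  shows "lap N (boundary_barrier K N L) x
    \<le> 4 * real K / (L * real N) - 1 / real N * (of_bool (x \<in> I_plus K N) + of_bool (x \<in> I_minus K N))"
proof -
  have le: "2 * real i + 1 \<le> L" if "i < K" for i
  proof -
    have "real (2 * i + 1) \<le> real (2 * K)" using that by (intro of_nat_mono) auto
    then show ?thesis using K by simp
  qed
  let ?c = "2 / (L * real N)"
  let ?r = "\<lambda>i x. barrier N L (max (int N - x) (int i))"
  have x': "- x \<in> Lam N" using x by (auto simp: Lam_def)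
  have "lap N (boundary_barrier K N L) x
      = (\<Sum>i<K. lap N (?r i) x + lap N (?r i) (- x))"
    unfolding boundary_barrier_def lap_sum_fun
  proof (intro sum.cong refl)
    fix i
    show "lap N (\<lambda>x. ?r i x + ?r i (- x)) x = lap N (?r i) x + lap N (?r i) (- x)"
      by (subst lap_uminus[symmetric]) (simp add: lap_def)
  qed
  also have "\<dots> \<le> (\<Sum>i<K. (?c - (if x = int N - int i then 1 / real N else 0)) + (?c - (if - x = int N - int i then 1 / real N else 0)))"
    by (intro sum_mono add_mono lap_barrier le L x x') auto
  also have "\<dots> = 2 * real K * ?c - (\<Sum>i<K. if x = int N - int i then 1 / real N else 0)
      - (\<Sum>i<K. if - x = int N - int i then 1 / real N else 0)"
    by (simp add: sum.distrib sum_subtractf sum_negf)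
  also have "\<dots> = 4 * real K / (L * real N) - 1 / real N * (of_bool (x \<in> I_plus K N) + of_bool (x \<in> I_minus K N))"
  proof -
    have delta: "(\<Sum>i<K. if u = int N - int i then 1 / real N else 0) = 1 / real N * of_bool (nat (int N - u) < K)"
      if "u \<in> Lam N" for u
    proof -
      have "(\<Sum>i<K. if u = int N - int i then 1 / real N else 0)
          = (\<Sum>i<K. if i = nat (int N - u) then 1 / real N else 0)"
        using that by (intro sum.cong if_cong refl) (auto simp: Lam_def)
      then show ?thesis by (simp add: sum.delta)
    qed
    have "nat (int N - x) < K \<longleftrightarrow> x \<in> I_plus K N" "nat (int N - - x) < K \<longleftrightarrow> x \<in> I_minus K N"
      using x by (auto simp: I_plus_def I_minus_def Lam_def)
    then show ?thesis unfolding delta[OF x] delta[OF x'] by (simp add: algebra_simps)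
  qed
  finally show ?thesis .
qed

text \<open>Concave in the distance, with second difference -2. The constant
  \<open>4 * real N + 2\<close> puts the maximum at distance \<open>2 * N + 1\<close>, so it
  increases over all distances in the box, and an outward move missing at an end can only
  help.\<close>

definition dist_barrier :: "nat \<Rightarrow> int \<Rightarrow> real" where
  "dist_barrier N d = \<bar>real_of_int d\<bar> * (4 * real N + 2 - \<bar>real_of_int d\<bar>)"

lemma dist_barrier_bounds:
  assumes "\<bar>d\<bar> \<le> 2 * int N" "N \<ge> 1"
  shows "0 \<le> dist_barrier N d" "dist_barrier N d \<le> 6 * real N * \<bar>real_of_int d\<bar>"
proof -
  have "real_of_int \<bar>d\<bar> \<le> real_of_int (2 * int N)" using assms(1) by (simp only: of_int_le_iff)
  then have d: "\<bar>real_of_int d\<bar> \<le> 2 * real N" by simp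
  then show "0 \<le> dist_barrier N d" unfolding dist_barrier_def by (intro mult_nonneg_nonneg) auto
  have "dist_barrier N d \<le> \<bar>real_of_int d\<bar> * (6 * real N)"
    unfolding dist_barrier_def using assms(2) by (intro mult_left_mono) auto
  then show "dist_barrier N d \<le> 6 * real N * \<bar>real_of_int d\<bar>" by (simp add: mult_ac)
qed

text \<open>Away from the ends each particle has one outward and one inward step, so concavity gives
  -4. For neighbours the inward steps are replaced by an exchange that keeps the distance; not
  descending to distance 0 leaves the excess \<open>2 * dist_barrier N (y - z)\<close>, later paid
  by the killing.\<close>

lemma dist_barrier_pair_less:
  assumes y: "y \<in> Lam N" and z: "z \<in> Lam N" and yz: "y < z"
  shows "(\<Sum>b\<in>bonds N. dist_barrier N (swap b y - swap b z) - dist_barrier N (y - z))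
    \<le> - 4 + (if z = y + 1 then 2 * dist_barrier N (y - z) else 0)"
proof -
  define d where "d = real_of_int (z - y)"
  define \<phi> where "\<phi> t = t * (4 * real N + 2 - t)" for t :: real
  have d1: "d \<ge> 1" using yz by (simp add: d_def)
  have dN: "d \<le> 2 * real N" using y z by (simp add: d_def Lam_def)
  define u where "u = \<phi> (d + 1) - \<phi> d"
  define v where "v = (if z = y + 1 then 0 else \<phi> (d - 1) - \<phi> d)"
  have u0: "u \<ge> 0" using dN by (simp add: u_def \<phi>_def algebra_simps)
  have D: "dist_barrier N (a - b) = \<phi> (real_of_int (b - a))" if "a \<le> b" for a b
    using that by (simp add: dist_barrier_def \<phi>_def)
  have D0: "dist_barrier N (y - z) = \<phi> d" using D[of y z] yz by (simp add: d_def)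
  have "(\<Sum>b\<in>bonds N. dist_barrier N (swap b y - swap b z) - dist_barrier N (y - z))
     \<le> (\<Sum>b\<in>bonds N. (if b = y - 1 then u else 0) + (if b = z then u else 0)
          + (if b = y then v else 0) + (if b = z - 1 then v else 0) )"
  proof (intro sum_mono)
    fix b assume "b \<in> bonds N"
    consider "b = y - 1" | "b = z" | "b = y" "z = y + 1" | "b = y" "z \<noteq> y + 1" | "b = z - 1" "b \<noteq> y"
      | "b \<notin> {y - 1, y, z - 1, z}" by blast
    then show "dist_barrier N (swap b y - swap b z) - dist_barrier N (y - z)
      \<le> (if b = y - 1 then u else 0) + (if b = z then u else 0)
          + (if b = y then v else 0) + (if b = z - 1 then v else 0)"
    proof cases
      case 1
      then have sw: "swap b y - swap b z = y - 1 - z" using yz by (simp add: Transposition.transpose_def)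
      have "dist_barrier N (y - 1 - z) = \<phi> (d + 1)" using yz D[of "y - 1" z] by (simp add: d_def algebra_simps)
      then show ?thesis unfolding sw D0 using 1 yz by (simp add: u_def)
    next
      case 2
      then have sw: "swap b y - swap b z = y - (z + 1)" using yz by (simp add: Transposition.transpose_def)
      have "dist_barrier N (y - (z + 1)) = \<phi> (d + 1)" using yz D[of y "z + 1"] by (simp add: d_def algebra_simps)
      then show ?thesis unfolding sw D0 using 2 yz by (simp add: u_def)
    next
      case 3
      then have sw: "swap b y - swap b z = z - y" using yz by (simp add: Transposition.transpose_def)
      have "dist_barrier N (z - y) = \<phi> d" using D0 by (simp add: dist_barrier_def abs_minus_commute)
      then show ?thesis unfolding sw D0 using 3 yz by (simp add: v_def)
    next
      case 4
      then have "y + 1 \<le> z" using yz by simp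
      have sw: "swap b y - swap b z = y + 1 - z" using yz 4 by (simp add: Transposition.transpose_def)
      have "dist_barrier N (y + 1 - z) = \<phi> (d - 1)"
        using \<open>y + 1 \<le> z\<close> D[of "y + 1" z] by (simp add: d_def algebra_simps)
      then show ?thesis unfolding sw D0 using 4 yz by (simp add: v_def)
    next
      case 5
      then have "y \<le> z - 1" "z \<noteq> y + 1" using yz by simp_all
      have sw: "swap b y - swap b z = y - (z - 1)" using yz 5 by (simp add: Transposition.transpose_def)
      have "dist_barrier N (y - (z - 1)) = \<phi> (d - 1)"
        using \<open>y \<le> z - 1\<close> D[of y "z - 1"] by (simp add: d_def algebra_simps)
      then show ?thesis unfolding sw D0 using 5 yz \<open>z \<noteq> y + 1\<close> by (simp add: v_def)
    next
      case 6
      then have "swap b y = y" "swap b z = z" by (simp_all add: Transposition.transpose_def)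
      then show ?thesis using 6 by simp
    qed
  qed
  also have "\<dots> = of_bool (y - 1 \<in> bonds N) * u + of_bool (z \<in> bonds N) * u
          + of_bool (y \<in> bonds N) * v + of_bool (z - 1 \<in> bonds N) * v"
    unfolding sum.distrib by (intro arg_cong2[where f = "(+)"]) (simp_all add: sum.delta)
  also have "\<dots> \<le> 1 * u + 1 * u + of_bool (y \<in> bonds N) * v + of_bool (z - 1 \<in> bonds N) * v"
    using u0 by (intro add_mono mult_right_mono order_refl) auto
  also have "\<dots> = 2 * u + 2 * v" using y z yz by (auto simp: Lam_def)
  also have "\<dots> \<le> - 4 + (if z = y + 1 then 2 * dist_barrier N (y - z) else 0)"
  proof (cases "z = y + 1")
    case True
    then have "d = 1" by (simp add: d_def)
    then show ?thesis using True by (simp add: u_def v_def \<phi>_def dist_barrier_def algebra_simps)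
  next
    case False
    then show ?thesis by (simp add: u_def v_def \<phi>_def algebra_simps)
  qed
  finally show ?thesis .
qed

lemma dist_barrier_pair:
  assumes y: "y \<in> Lam N" and z: "z \<in> Lam N" and yz: "y \<noteq> z"
  shows "(\<Sum>b\<in>bonds N. dist_barrier N (swap b y - swap b z) - dist_barrier N (y - z))
    \<le> - 4 + (if \<bar>y - z\<bar> = 1 then 2 * dist_barrier N (y - z) else 0)"
proof (cases "y < z")
  case True
  then show ?thesis using dist_barrier_pair_less[OF y z True] by (auto split: if_splits)
next
  case False
  have sym: "dist_barrier N (a - b) = dist_barrier N (b - a)" for a b
    by (simp add: dist_barrier_def abs_minus_commute)
  from False have "z < y" using yz by simp
  have "(\<Sum>b\<in>bonds N. dist_barrier N (swap b y - swap b z) - dist_barrier N (y - z))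
    = (\<Sum>b\<in>bonds N. dist_barrier N (swap b z - swap b y) - dist_barrier N (z - y))"
    by (intro sum.cong refl arg_cong2[where f = "(-)"] sym)
  also have "\<dots> \<le> - 4 + (if y = z + 1 then 2 * dist_barrier N (z - y) else 0)"
    by (rule dist_barrier_pair_less[OF z y \<open>z < y\<close>])
  also have "\<dots> = - 4 + (if \<bar>y - z\<bar> = 1 then 2 * dist_barrier N (y - z) else 0)"
    using \<open>z < y\<close> unfolding sym[of z y] by auto
  finally show ?thesis .
qed

section \<open>Equicontinuity of the stationary correlation functions\<close>

lemma configs_cases: "\<eta> \<in> configs N \<Longrightarrow> x \<in> Lam N \<Longrightarrow> \<eta> x = 0 \<or> \<eta> x = 1"
  by (auto simp: configs_def PiE_iff)

lemma configs_01: "\<eta> \<in> configs N \<Longrightarrow> x \<in> Lam N \<Longrightarrow> 0 \<le> \<eta> x \<and> \<eta> x \<le> 1"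
  using configs_cases by fastforce

lemma finite_configs: "finite (configs N)"
  unfolding configs_def by (intro finite_PiE) auto

lemma prod_01:
  fixes f :: "'a \<Rightarrow> real"
  assumes "\<And>x. x \<in> A \<Longrightarrow> 0 \<le> f x \<and> f x \<le> 1"
  shows "0 \<le> prod f A" "prod f A \<le> 1"
  using assms by (auto intro!: prod_nonneg prod_le_1)

lemma exchange_eq_swap: "exchange b \<eta> x = \<eta> (swap b x)"
  by (auto simp: exchange_def Transposition.transpose_def)

lemma inj_on_swap: "inj_on (swap b) A"
  by (rule inj_on_inverseI[of _ "swap b"]) simp

lemma swap_eq_iff [simp]: "swap b u = swap b v \<longleftrightarrow> u = v"
  using inj_on_eq_iff[OF inj_on_swap[of b UNIV]] by simp

lemma D_plus_01:
  assumes "\<eta> \<in> configs N" "x \<in> Lam N" shows "0 \<le> D_plus N \<eta> x \<and> D_plus N \<eta> x \<le> 1"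
proof -
  have "0 \<le> (\<Prod>y\<in>{x + 1..int N}. \<eta> y)" "(\<Prod>y\<in>{x + 1..int N}. \<eta> y) \<le> 1"
    using assms(2) configs_01[OF assms(1)] by (intro prod_01; auto simp: Lam_def)+
  then show ?thesis using configs_01[OF assms] by (auto simp: D_plus_def intro!: mult_le_one)
qed

lemma D_minus_01:
  assumes "\<eta> \<in> configs N" "x \<in> Lam N" shows "0 \<le> D_minus N \<eta> x \<and> D_minus N \<eta> x \<le> 1"
proof -
  have "0 \<le> (\<Prod>y\<in>{- int N..x - 1}. 1 - \<eta> y)" "(\<Prod>y\<in>{- int N..x - 1}. 1 - \<eta> y) \<le> 1"
    using assms(2) configs_01[OF assms(1)] by (intro prod_01; auto simp: Lam_def)+
  then show ?thesis using configs_01[OF assms] by (auto simp: D_minus_def intro!: mult_le_one)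
qed

text \<open>Invariance enters only infinitesimally; \<open>invariant_measure_stationary\<close>
  derives this from the semigroup. The condition \<open>2 * K \<le> N\<close> keeps the reservoirs
  inside the box and apart.\<close>

locale stationary_state =
  fixes j :: real and K N :: nat and \<mu> :: "config pmf"
  assumes j_pos: "j > 0" and K_pos: "K \<ge> 1" and K_le: "2 * K \<le> N"
    and set_pmf_subset: "set_pmf \<mu> \<subseteq> configs N"
    and stationary: "measure_pmf.expectation \<mu> (generator j K N f) = 0"
begin

abbreviation E :: "(config \<Rightarrow> real) \<Rightarrow> real" where
  "E f \<equiv> measure_pmf.expectation \<mu> f"

lemma N_pos: "N \<ge> 1" using K_pos K_le by simp

lemma I_plus_subset: "I_plus K N \<subseteq> Lam N" and I_minus_subset: "I_minus K N \<subseteq> Lam N"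
  using K_pos K_le by (auto simp: I_plus_def I_minus_def Lam_def)

lemma integrable_pmf [simp]: "integrable (measure_pmf \<mu>) (f :: config \<Rightarrow> real)"
  using finite_subset[OF set_pmf_subset finite_configs] by (rule integrable_measure_pmf_finite)

lemma E_cong: "(\<And>\<eta>. \<eta> \<in> configs N \<Longrightarrow> f \<eta> = g \<eta>) \<Longrightarrow> E f = E g"
  using set_pmf_subset by (intro integral_cong_AE) (auto simp: AE_measure_pmf_iff)

lemma E_mono: "(\<And>\<eta>. \<eta> \<in> configs N \<Longrightarrow> f \<eta> \<le> g \<eta>) \<Longrightarrow> E f \<le> E g"
  using set_pmf_subset by (intro integral_mono_AE) (auto simp: AE_measure_pmf_iff)

lemma E_abs_le:
  assumes "\<And>\<eta>. \<eta> \<in> configs N \<Longrightarrow> \<bar>f \<eta>\<bar> \<le> c" shows "\<bar>E f\<bar> \<le> c"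
proof -
  have "E f \<le> E (\<lambda>_. c)" "E (\<lambda>_. - c) \<le> E f"
    by (rule E_mono, use assms in \<open>force simp: abs_le_iff\<close>)+
  then show ?thesis by simp
qed

lemma E_L_0: "E (L_0 N f) = - (1 / real N) * E (L_b j K N f)"
proof -
  have "0 = E (\<lambda>\<eta>. (real N)\<^sup>2 * (L_0 N f \<eta> + 1 / real N * L_b j K N f \<eta>))"
    using stationary[of f] by (simp add: generator_def[abs_def])
  also have "\<dots> = (real N)\<^sup>2 * (E (L_0 N f) + 1 / real N * E (L_b j K N f))"
    by simp
  finally have "E (L_0 N f) + 1 / real N * E (L_b j K N f) = 0" using N_pos by simp
  then show ?thesis by simp
qed

definition corr :: "int set \<Rightarrow> real" where
  "corr S = E (\<lambda>\<eta>. \<Prod>x\<in>S. \<eta> x)"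

definition reservoir :: "int \<Rightarrow> real" where
  "reservoir x = of_bool (x \<in> I_plus K N) + of_bool (x \<in> I_minus K N)"

lemma reservoir_nonneg: "0 \<le> reservoir x" by (simp add: reservoir_def)

text \<open>Self-duality of the exclusion process: exchanging occupation numbers in a product is the
  same as moving its sites.\<close>

lemma corr_equation:
  "(\<Sum>b\<in>bonds N. corr (swap b ` S) - corr S)
    = - (2 / real N) * E (L_b j K N (\<lambda>\<eta>. \<Prod>x\<in>S. \<eta> x))"
proof -
  have "E (L_0 N (\<lambda>\<eta>. \<Prod>x\<in>S. \<eta> x))
      = E (\<lambda>\<eta>. 1 / 2 * (\<Sum>b\<in>bonds N. (\<Prod>x\<in>swap b ` S. \<eta> x) - (\<Prod>x\<in>S. \<eta> x)))"
    by (simp add: L_0_def[abs_def] exchange_eq_swap prod.reindex[OF inj_on_swap] o_def)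
  also have "\<dots> = 1 / 2 * (\<Sum>b\<in>bonds N. corr (swap b ` S) - corr S)"
    by (simp add: corr_def)
  finally have "(\<Sum>b\<in>bonds N. corr (swap b ` S) - corr S) = 2 * E (L_0 N (\<lambda>\<eta>. \<Prod>x\<in>S. \<eta> x))" by simp
  also have "\<dots> = - (2 / real N) * E (L_b j K N (\<lambda>\<eta>. \<Prod>x\<in>S. \<eta> x))"
    unfolding E_L_0 by simp
  finally show ?thesis .
qed

text \<open>A flip changes the product only at sites of \<open>S\<close>, and then by at most 1.
  This crude bound stands in for the unclosed hierarchy: all that counts is how many sites of
  \<open>S\<close> lie in a reservoir.\<close>

lemma L_b_prod_bound:
  assumes S: "S \<subseteq> Lam N" and \<eta>: "\<eta> \<in> configs N"
  shows "\<bar>L_b j K N (\<lambda>\<eta>. \<Prod>x\<in>S. \<eta> x) \<eta>\<bar> \<le> j / 2 * (\<Sum>x\<in>S. reservoir x)"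
proof -
  have fS: "finite S" using S by (rule finite_subset) simp
  let ?f = "\<lambda>\<eta>::config. \<Prod>x\<in>S. \<eta> x"
  have flip_bound: "\<bar>?f (flip x \<eta>) - ?f \<eta>\<bar> \<le> of_bool (x \<in> S)" if x: "x \<in> Lam N" for x
  proof (cases "x \<in> S")
    case True
    have a: "0 \<le> ?f \<eta>" "?f \<eta> \<le> 1" using S configs_01[OF \<eta>] by (intro prod_01; auto)+
    have b: "0 \<le> ?f (flip x \<eta>)" "?f (flip x \<eta>) \<le> 1"
      using S configs_01[OF \<eta>] by (intro prod_01; auto simp: flip_def)+
    show ?thesis using a b True by simp
  next
    case False
    then have "?f (flip x \<eta>) = ?f \<eta>" by (intro prod.cong) (auto simp: flip_def)
    then show ?thesis using False by simp
  qed
  have one: "\<bar>\<Sum>x\<in>I. D x * (?f (flip x \<eta>) - ?f \<eta>)\<bar> \<le> (\<Sum>x\<in>S. of_bool (x \<in> I))"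
    if I: "I \<subseteq> Lam N" and D: "\<And>x. x \<in> Lam N \<Longrightarrow> 0 \<le> D x \<and> D x \<le> 1" for I and D :: "int \<Rightarrow> real"
  proof -
    have fI: "finite I" using I by (rule finite_subset) simp
    have "\<bar>\<Sum>x\<in>I. D x * (?f (flip x \<eta>) - ?f \<eta>)\<bar> \<le> (\<Sum>x\<in>I. \<bar>D x * (?f (flip x \<eta>) - ?f \<eta>)\<bar>)"
      by (rule sum_abs)
    also have "\<dots> \<le> (\<Sum>x\<in>I. 1 * of_bool (x \<in> S))"
      unfolding abs_mult by (intro sum_mono mult_mono flip_bound) (use I D in auto)
    also have "\<dots> = (\<Sum>x\<in>S. of_bool (x \<in> I))"
      using fI fS by (simp add: sum_of_bool_eq Int_commute[of S] Int_def conj_commute)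
    finally show ?thesis .
  qed
  have "\<bar>L_b j K N ?f \<eta>\<bar> \<le> j / 2 * \<bar>\<Sum>x\<in>I_plus K N. D_plus N \<eta> x * (?f (flip x \<eta>) - ?f \<eta>)\<bar>
     + j / 2 * \<bar>\<Sum>x\<in>I_minus K N. D_minus N \<eta> x * (?f (flip x \<eta>) - ?f \<eta>)\<bar>"
    unfolding L_b_def L_b_plus_def L_b_minus_def
    using j_pos by (intro order_trans[OF abs_triangle_ineq]) (simp add: abs_mult)
  also have "\<dots> \<le> j / 2 * (\<Sum>x\<in>S. of_bool (x \<in> I_plus K N)) + j / 2 * (\<Sum>x\<in>S. of_bool (x \<in> I_minus K N))"
    using j_pos one[OF I_plus_subset D_plus_01[OF \<eta>]] one[OF I_minus_subset D_minus_01[OF \<eta>]] by (intro add_mono mult_left_mono) auto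
  also have "\<dots> = j / 2 * (\<Sum>x\<in>S. reservoir x)"
    by (simp add: reservoir_def sum.distrib algebra_simps)
  finally show ?thesis .
qed

text \<open>Comparison of the two correlation functions on triples \<open>(A, y, z)\<close>: an exchange across the
  bond \<open>{y, z}\<close> changes the sign of the difference, so it acts as killing.\<close>
lemma corr_diff_le:
  assumes A0: "A0 \<subseteq> Lam N" and y0: "y0 \<in> Lam N - A0" and z0: "z0 \<in> Lam N - A0"
    and L: "2 * real K \<le> L" "L \<le> real N"
  defines "\<kappa> \<equiv> 4 * j * real K * (real (card A0) + 2) / (L * real N)"
  shows "corr (insert y0 A0) - corr (insert z0 A0)
    \<le> 2 * j * (sum (boundary_barrier K N L) A0 + boundary_barrier K N L y0 + boundary_barrier K N L z0)
      + \<kappa> * dist_barrier N (y0 - z0)"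
proof -
  have Lp: "L > 0" using L K_pos by linarith
  have \<kappa>: "\<kappa> > 0" unfolding \<kappa>_def using j_pos K_pos Lp N_pos by (intro divide_pos_pos mult_pos_pos) auto
  let ?\<psi> = "boundary_barrier K N L"
  \<comment> \<open>The supersolution. The weight \<open>2 * j\<close> absorbs the reservoir source;
    \<kappa> lets the concavity of \<open>dist_barrier\<close> outweigh the positive part of the
    Laplacian of \<open>boundary_barrier\<close>, summed over \<open>card A0 + 2\<close>
    sites.\<close>
  define h where "h = (\<lambda>(A, y, z). 2 * j * (sum ?\<psi> A + ?\<psi> y + ?\<psi> z) + \<kappa> * dist_barrier N (y - z))"
  define g where "g = (\<lambda>(A, y, z). corr (insert y A) - corr (insert z A))"
  define T where "T = {(A, y, z). A \<subseteq> Lam N \<and> card A = card A0 \<and> y \<in> Lam N - A \<and> z \<in> Lam N - A \<and> y \<noteq> z}"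
  have dist_le: "\<bar>y - z\<bar> \<le> 2 * int N" if "y \<in> Lam N" "z \<in> Lam N" for y z
    using that by (auto simp: Lam_def)
  have h_ge: "\<kappa> * dist_barrier N (y - z) \<le> h (A, y, z)" for A y z
    unfolding h_def using j_pos boundary_barrier_bounds(1)[OF Lp] by (simp add: sum_nonneg)
  have fT: "finite T"
    by (rule finite_subset[of _ "Pow (Lam N) \<times> Lam N \<times> Lam N"]) (auto simp: T_def)
  have "g (A0, y0, z0) \<le> h (A0, y0, z0)"
  proof (rule ccontr)
    assume contra: "\<not> ?thesis"
    have "y0 \<noteq> z0"
    proof
      assume "y0 = z0"
      then have "g (A0, y0, z0) = 0" by (simp add: g_def)
      moreover have "0 \<le> h (A0, y0, z0)"
        using \<kappa> y0 z0 by (intro order_trans[OF mult_nonneg_nonneg h_ge] dist_barrier_bounds dist_le N_pos) auto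
      ultimately show False using contra by simp
    qed
    then have p0: "(A0, y0, z0) \<in> T" using A0 y0 z0 by (auto simp: T_def)
    \<comment> \<open>Maximum principle: no exchange can raise \<open>g - h\<close> above its
      maximum over the finite set \<open>T\<close> of triples with distinct \<open>y\<close> and
      \<open>z\<close>.\<close>
    obtain p where p: "p \<in> T" and pmax: "\<And>q. q \<in> T \<Longrightarrow> g q - h q \<le> g p - h p"
    proof -
      have "Max ((\<lambda>q. g q - h q) ` T) \<in> (\<lambda>q. g q - h q) ` T"
        using fT p0 by (intro Max_in) auto
      then obtain p where "p \<in> T" "Max ((\<lambda>q. g q - h q) ` T) = g p - h p" by auto
      moreover have "g q - h q \<le> Max ((\<lambda>q. g q - h q) ` T)" if "q \<in> T" for q
        using fT that by (intro Max_ge) auto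
      ultimately show thesis using that by auto
    qed
    obtain A y z where pA: "p = (A, y, z)" by (cases p)
    have A: "A \<subseteq> Lam N" "card A = card A0" and y: "y \<in> Lam N" "y \<notin> A" and z: "z \<in> Lam N" "z \<notin> A"
      and yz: "y \<noteq> z" using p by (auto simp: T_def pA)
    have fA: "finite A" using A(1) by (rule finite_subset) simp
    have gh: "h p < g p" using pmax[OF p0] contra by simp
    define S where "S = (\<lambda>b. (swap b ` A, swap b y, swap b z))"
    have ST: "S b \<in> T" if "b \<in> bonds N" for b
      using that A y z yz
      by (auto simp: S_def T_def card_image inj_on_swap image_subset_iff subset_iff inj_image_mem_iff[OF inj_on_swap])
    define D where "D = (\<lambda>B. E (L_b j K N (\<lambda>\<eta>. \<Prod>x\<in>B. \<eta> x)))"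
    let ?R = "\<Sum>x\<in>insert y (insert z A). reservoir x"
    have lower: "- (2 * j / real N) * ?R \<le> (\<Sum>b\<in>bonds N. g (S b) - g p)"
    proof -
      have "(\<Sum>b\<in>bonds N. g (S b) - g p)
        = (\<Sum>b\<in>bonds N. corr (swap b ` insert y A) - corr (insert y A))
          - (\<Sum>b\<in>bonds N. corr (swap b ` insert z A) - corr (insert z A))"
        unfolding sum_subtractf[symmetric] by (intro sum.cong) (auto simp: g_def S_def pA)
      also have "\<dots> = - (2 / real N) * (D (insert y A) - D (insert z A))"
        unfolding corr_equation D_def by (simp add: algebra_simps)
      finally have eq: "(\<Sum>b\<in>bonds N. g (S b) - g p) = - (2 / real N) * (D (insert y A) - D (insert z A))" .
      have "\<bar>D (insert y A)\<bar> \<le> j / 2 * (\<Sum>x\<in>insert y A. reservoir x)"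
        unfolding D_def by (intro E_abs_le L_b_prod_bound) (use A y in auto)
      moreover have "\<bar>D (insert z A)\<bar> \<le> j / 2 * (\<Sum>x\<in>insert z A. reservoir x)"
        unfolding D_def by (intro E_abs_le L_b_prod_bound) (use A z in auto)
      moreover have "j / 2 * (\<Sum>x\<in>insert y A. reservoir x) + j / 2 * (\<Sum>x\<in>insert z A. reservoir x) \<le> j * ?R"
      proof -
        have "(\<Sum>x\<in>insert y A. reservoir x) \<le> ?R" "(\<Sum>x\<in>insert z A. reservoir x) \<le> ?R"
          using fA by (intro sum_mono2; auto intro: reservoir_nonneg)+
        then have "j / 2 * (\<Sum>x\<in>insert y A. reservoir x) \<le> j / 2 * ?R"
          "j / 2 * (\<Sum>x\<in>insert z A. reservoir x) \<le> j / 2 * ?R"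
          using j_pos by (auto intro: mult_left_mono)
        then show ?thesis by linarith
      qed
      ultimately have "D (insert y A) - D (insert z A) \<le> j * ?R" by linarith
      then have "2 / real N * (D (insert y A) - D (insert z A)) \<le> 2 / real N * (j * ?R)"
        by (intro mult_left_mono) auto
      then show ?thesis unfolding eq by (simp add: mult_ac)
    qed
    \<comment> \<open>The bond shared by neighbours turns \<open>(A, y, z)\<close> into
      \<open>(A, z, y)\<close> and \<open>g\<close> into \<open>- g\<close>. Its contribution
      \<open>- 2 * g p\<close> is at most \<open>- 2 * \<kappa> * dist_barrier N (y - z)\<close>,
      which cancels the excess in \<open>dist_barrier_pair\<close>.\<close>
    have step: "g (S b) - g p \<le> h (S b) - h p
        + (if b = min y z then (if \<bar>y - z\<bar> = 1 then - 2 * \<kappa> * dist_barrier N (y - z) else 0) else 0)"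
      if b: "b \<in> bonds N" for b
    proof (cases "b = min y z \<and> \<bar>y - z\<bar> = 1")
      case True
      then have adj: "y = z + 1 \<and> b = z \<or> z = y + 1 \<and> b = y"
        by (auto simp: min_def split: if_splits)
      then have sw: "swap b y = z" "swap b z = y"
        by (auto simp: Transposition.transpose_def)
      have "swap b ` A = A"
      proof -
        have "swap b x = x" if "x \<in> A" for x
          using that adj y z by (auto simp: Transposition.transpose_def)
        then show ?thesis by simp
      qed
      then have "S b = (A, z, y)" by (simp add: S_def sw)
      then have "g (S b) = - g p" "h (S b) = h p"
        by (simp_all add: g_def h_def pA dist_barrier_def abs_minus_commute)
      moreover have "\<kappa> * dist_barrier N (y - z) \<le> g p" using gh h_ge[of y z A] by (simp add: pA)
      ultimately show ?thesis using True by simp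
    next
      case False
      then show ?thesis using pmax[OF ST[OF b]] by auto
    qed
    have mb: "min y z \<in> bonds N" using y z yz by (auto simp: Lam_def)
    have "(\<Sum>b\<in>bonds N. g (S b) - g p) \<le> (\<Sum>b\<in>bonds N. h (S b) - h p
        + (if b = min y z then (if \<bar>y - z\<bar> = 1 then - 2 * \<kappa> * dist_barrier N (y - z) else 0) else 0))"
      by (intro sum_mono step)
    also have "\<dots> = (\<Sum>b\<in>bonds N. h (S b) - h p) + (if \<bar>y - z\<bar> = 1 then - 2 * \<kappa> * dist_barrier N (y - z) else 0)"
      using mb by (simp add: sum.distrib sum.delta del: atLeastAtMost_iff min_def)
    also have "(\<Sum>b\<in>bonds N. h (S b) - h p)
      = 2 * j * (\<Sum>x\<in>insert y (insert z A). lap N ?\<psi> x)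
        + \<kappa> * (\<Sum>b\<in>bonds N. dist_barrier N (swap b y - swap b z) - dist_barrier N (y - z))"
    proof -
      have "(\<Sum>b\<in>bonds N. h (S b) - h p)
        = (\<Sum>b\<in>bonds N. 2 * j * (\<Sum>x\<in>insert y (insert z A). ?\<psi> (swap b x) - ?\<psi> x)
            + \<kappa> * (dist_barrier N (swap b y - swap b z) - dist_barrier N (y - z)))"
        using y z yz fA
        by (intro sum.cong refl) (simp add: h_def S_def pA sum.reindex[OF inj_on_swap] sum_subtractf algebra_simps)
      also have "\<dots> = 2 * j * (\<Sum>x\<in>insert y (insert z A). \<Sum>b\<in>bonds N. ?\<psi> (swap b x) - ?\<psi> x)
          + \<kappa> * (\<Sum>b\<in>bonds N. dist_barrier N (swap b y - swap b z) - dist_barrier N (y - z))"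
        unfolding sum.distrib sum_distrib_left[symmetric] by (subst sum.swap) simp
      also have "(\<Sum>x\<in>insert y (insert z A). \<Sum>b\<in>bonds N. ?\<psi> (swap b x) - ?\<psi> x)
         = (\<Sum>x\<in>insert y (insert z A). lap N ?\<psi> x)"
        using A y z by (intro sum.cong refl sum_swap_bonds) auto
      finally show ?thesis .
    qed
    also have "2 * j * (\<Sum>x\<in>insert y (insert z A). lap N ?\<psi> x)
        + \<kappa> * (\<Sum>b\<in>bonds N. dist_barrier N (swap b y - swap b z) - dist_barrier N (y - z))
        + (if \<bar>y - z\<bar> = 1 then - 2 * \<kappa> * dist_barrier N (y - z) else 0)
      \<le> 2 * j * (\<Sum>x\<in>insert y (insert z A). 4 * real K / (L * real N) - 1 / real N * reservoir x)
        + \<kappa> * (- 4 + (if \<bar>y - z\<bar> = 1 then 2 * dist_barrier N (y - z) else 0))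
        + (if \<bar>y - z\<bar> = 1 then - 2 * \<kappa> * dist_barrier N (y - z) else 0)"
      unfolding reservoir_def using j_pos \<kappa> A y z yz L Lp
      by (intro add_mono mult_left_mono sum_mono lap_boundary_barrier dist_barrier_pair order_refl) auto
    also have "\<dots> = 2 * j * ((real (card A) + 2) * (4 * real K / (L * real N)) - 1 / real N * ?R) - 4 * \<kappa>"
      using fA y z yz by (simp add: sum_subtractf sum_distrib_left[symmetric] sum_divide_distrib[symmetric] add_divide_distrib algebra_simps)
    \<comment> \<open>By the choice of \<kappa> the barrier error equals
      \<open>2 * \<kappa>\<close>, half of the gain \<open>4 * \<kappa>\<close>; what is left is
      strictly negative and gives the contradiction.\<close>
    also have "\<dots> = - (2 * j / real N) * ?R - 2 * \<kappa>"
      using A by (simp add: \<kappa>_def algebra_simps)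
    finally show False using lower \<kappa> by simp
  qed
  then show ?thesis by (simp add: g_def h_def)
qed

text \<open>The two terms are the sizes of the two supersolutions with
  \<open>L = \<delta> * real N\<close>. The free parameter \<delta> trades the width of the boundary
  layer against the distance; the best choice is of the order of the square root of the macroscopic
  distance.\<close>

lemma corr_equicontinuous:
  assumes A: "A \<subseteq> Lam N" and y: "y \<in> Lam N - A" and z: "z \<in> Lam N - A"
    and \<delta>: "2 * real K \<le> \<delta> * real N" "\<delta> \<le> 1"
  shows "\<bar>corr (insert y A) - corr (insert z A)\<bar>
    \<le> 4 * j * real K * (real (card A) + 2) * (\<delta> + 6 * \<bar>real_of_int (y - z)\<bar> / (\<delta> * real N))"
proof -
  have \<delta>p: "\<delta> > 0" using \<delta> K_pos by (smt (verit) mult_nonpos_nonneg of_nat_0_le_iff of_nat_1 of_nat_mono)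
  have one: "corr (insert y A) - corr (insert z A)
      \<le> 4 * j * real K * (real (card A) + 2) * (\<delta> + 6 * \<bar>real_of_int (y - z)\<bar> / (\<delta> * real N))"
    if y: "y \<in> Lam N - A" and z: "z \<in> Lam N - A" for y z
  proof -
    define L where "L = \<delta> * real N"
    have Lb: "2 * real K \<le> L" "L \<le> real N" using \<delta> by (simp_all add: L_def mult_left_le_one_le \<delta>p less_imp_le)
    have Lp: "L > 0" using \<delta>p N_pos by (simp add: L_def)
    have LN: "L / real N = \<delta>" using N_pos by (simp add: L_def)
    have fA: "finite A" using A(1) by (rule finite_subset) simp
    let ?\<psi> = "boundary_barrier K N L"
    have \<psi>: "?\<psi> x \<le> 2 * real K * \<delta>" for x using boundary_barrier_bounds(2)[OF Lp, of K N x] by (simp add: LN)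
    have d: "\<bar>y - z\<bar> \<le> 2 * int N" using y z by (auto simp: Lam_def)
    have "sum ?\<psi> A \<le> real (card A) * (2 * real K * \<delta>)"
      using sum_bounded_above[of A ?\<psi> "2 * real K * \<delta>"] \<psi> by simp
    then have "sum ?\<psi> A + ?\<psi> y + ?\<psi> z \<le> (real (card A) + 2) * (2 * real K * \<delta>)"
      using \<psi>[of y] \<psi>[of z] by (simp add: algebra_simps)
    then have "2 * j * (sum ?\<psi> A + ?\<psi> y + ?\<psi> z) \<le> 2 * j * ((real (card A) + 2) * (2 * real K * \<delta>))"
      using j_pos by (intro mult_left_mono) auto
    moreover have "4 * j * real K * (real (card A) + 2) / (L * real N) * dist_barrier N (y - z)
       \<le> 4 * j * real K * (real (card A) + 2) / (L * real N) * (6 * real N * \<bar>real_of_int (y - z)\<bar>)"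
      using j_pos Lp dist_barrier_bounds(2)[OF d N_pos] by (intro mult_left_mono) auto
    ultimately have "corr (insert y A) - corr (insert z A) \<le> 2 * j * ((real (card A) + 2) * (2 * real K * \<delta>))
      + 4 * j * real K * (real (card A) + 2) / (L * real N) * (6 * real N * \<bar>real_of_int (y - z)\<bar>)"
      using corr_diff_le[OF A y z Lb] by linarith
    also have "\<dots> = 4 * j * real K * (real (card A) + 2) * (\<delta> + 6 * \<bar>real_of_int (y - z)\<bar> / (\<delta> * real N))"
    proof -
      have "C / (\<delta> * n * n) * (6 * n * d) = C * (6 * d / (\<delta> * n))" if "n \<noteq> 0" for C n d :: real
        using that by (cases "\<delta> = 0") (simp_all add: field_simps)
      from this[of "real N" "4 * j * real K * (real (card A) + 2)"] show ?thesis
        using N_pos by (simp add: L_def distrib_left distrib_right)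
    qed
    finally show ?thesis .
  qed
  show ?thesis using one[OF y z] one[OF z y] by (simp add: abs_le_iff abs_minus_commute)
qed

end

section \<open>Replacing occupation variables by averages\<close>

lemma sum_telescope_int:
  fixes g :: "int \<Rightarrow> real"
  assumes "m \<le> n + 1"
  shows "(\<Sum>b\<in>{m..n}. g (b + 1) - g b) = g (n + 1) - g m"
proof -
  have "m \<le> i + 1 \<Longrightarrow> (\<Sum>b\<in>{m..i}. g (b + 1) - g b) = g (i + 1) - g m" if "m - 1 \<le> i" for i
    using that
  proof (induction i rule: int_ge_induct)
    case (step i)
    then have "{m..i + 1} = insert (i + 1) {m..i}" by auto
    then show ?case using step by simp
  qed simp
  then show ?thesis using assms by simp
qed

text \<open>One-dimensional Sobolev bound: Cauchy-Schwarz along the path joining the two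
  sites.\<close>

lemma path_energy:
  assumes "x \<in> Lam N" "y \<in> Lam N"
  shows "(f x - f y)\<^sup>2 \<le> \<bar>real_of_int (x - y)\<bar> * (\<Sum>b\<in>bonds N. (f (b + 1) - f b :: real)\<^sup>2)"
proof -
  have one: "(f y - f x)\<^sup>2 \<le> real_of_int (y - x) * (\<Sum>b\<in>bonds N. (f (b + 1) - f b :: real)\<^sup>2)"
    if "x \<in> Lam N" "y \<in> Lam N" "x \<le> y" for x y
  proof -
    have "f y - f x = (\<Sum>b\<in>{x..y - 1}. 1 * (f (b + 1) - f b))"
      using sum_telescope_int[of x "y - 1" f] that by simp
    then have "(f y - f x)\<^sup>2 \<le> (\<Sum>b\<in>{x..y - 1}. 1\<^sup>2) * (\<Sum>b\<in>{x..y - 1}. (f (b + 1) - f b)\<^sup>2)"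
      using Cauchy_Schwarz_ineq_sum[of "\<lambda>_. 1" "\<lambda>b. f (b + 1) - f b" "{x..y - 1}"] by simp
    also have "\<dots> \<le> real_of_int (y - x) * (\<Sum>b\<in>bonds N. (f (b + 1) - f b)\<^sup>2)"
      using that by (intro mult_mono sum_mono2) (auto simp: Lam_def intro: sum_nonneg)
    finally show ?thesis .
  qed
  show ?thesis
    using one[of x y] one[of y x] assms by (cases "x \<le> y") (auto simp: power2_commute)
qed

text \<open>Quantitative monotonicity of the power: all terms of the quotient
  \<open>(x ^ n - a ^ n) / (x - a)\<close> are nonnegative, and the one with \<open>i = 0\<close> is
  \<open>a ^ (n - 1)\<close>.\<close>

lemma power_diff_ge:
  fixes x a :: real
  assumes "0 \<le> x" "0 \<le> a" "n \<ge> 1"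
  shows "a ^ (n - 1) * (x - a)\<^sup>2 \<le> (x ^ n - a ^ n) * (x - a)"
proof -
  have "a ^ (n - 1) \<le> (\<Sum>i<n. a ^ (n - Suc i) * x ^ i)"
    using assms member_le_sum[of 0 "{..<n}" "\<lambda>i. a ^ (n - Suc i) * x ^ i"] by simp
  then have "(x - a)\<^sup>2 * a ^ (n - 1) \<le> (x - a)\<^sup>2 * (\<Sum>i<n. a ^ (n - Suc i) * x ^ i)"
    by (intro mult_left_mono) auto
  then show ?thesis using power_diff_sumr2[of x n a] by (simp add: power2_eq_square mult_ac)
qed

context stationary_state
begin

text \<open>Each of up to \<open>n\<close> vacancy factors doubles the number of occupation
  products, whence \<open>2 ^ n\<close>.\<close>

definition equicont_const :: "nat \<Rightarrow> real" where
  "equicont_const n = 2 ^ n * (4 * j * real K * (real n + 2))"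

lemma equicont_const_nonneg: "0 \<le> equicont_const n"
  using j_pos by (simp add: equicont_const_def)

lemma equicont_const_mono: "m \<le> n \<Longrightarrow> equicont_const m \<le> equicont_const n"
  unfolding equicont_const_def using j_pos by (intro mult_mono power_increasing) auto

text \<open>Expanding one vacancy factor gives two expectations with one vacancy fewer, of which the
  second has one more occupied site, so \<open>card A + card B\<close> does not grow.\<close>

lemma mixed_equicontinuous:
  assumes "finite B" and "A \<subseteq> Lam N" "B \<subseteq> Lam N" "A \<inter> B = {}"
    and y: "y \<in> Lam N - A - B" and z: "z \<in> Lam N - A - B"
    and \<delta>: "2 * real K \<le> \<delta> * real N" "\<delta> \<le> 1"
  shows "\<bar>E (\<lambda>\<eta>. (\<Prod>x\<in>A. \<eta> x) * (\<Prod>x\<in>B. 1 - \<eta> x) * (\<eta> y - \<eta> z))\<bar>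
    \<le> 2 ^ card B * (4 * j * real K * (real (card A + card B) + 2)) * (\<delta> + 6 * \<bar>real_of_int (y - z)\<bar> / (\<delta> * real N))"
  using assms(1-6)
proof (induction B arbitrary: A rule: finite_induct)
  case empty
  have fA: "finite A" using empty(1) by (rule finite_subset) simp
  have "E (\<lambda>\<eta>. (\<Prod>x\<in>A. \<eta> x) * (\<eta> y - \<eta> z)) = corr (insert y A) - corr (insert z A)"
    unfolding corr_def using empty fA by (simp add: algebra_simps)
  then show ?case using corr_equicontinuous[OF empty(1) _ _ \<delta>, of y z] empty by (simp add: algebra_simps)
next
  case (insert t B)
  have fA: "finite A" using insert.prems(1) by (rule finite_subset) simp
  let ?w = "\<delta> + 6 * \<bar>real_of_int (y - z)\<bar> / (\<delta> * real N)"
  have w: "0 \<le> ?w"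
  proof -
    have "\<delta> > 0" using \<delta> K_pos by (smt (verit) mult_nonpos_nonneg of_nat_0_le_iff of_nat_1 of_nat_mono)
    then show ?thesis by simp
  qed
  let ?c = "\<lambda>n. 4 * j * real K * (real n + 2)"
  have tA: "t \<notin> A" using insert.prems by auto
  have "E (\<lambda>\<eta>. (\<Prod>x\<in>A. \<eta> x) * (\<Prod>x\<in>insert t B. 1 - \<eta> x) * (\<eta> y - \<eta> z))
      = E (\<lambda>\<eta>. (\<Prod>x\<in>A. \<eta> x) * (\<Prod>x\<in>B. 1 - \<eta> x) * (\<eta> y - \<eta> z)
          - (\<Prod>x\<in>insert t A. \<eta> x) * (\<Prod>x\<in>B. 1 - \<eta> x) * (\<eta> y - \<eta> z))"
    using insert.hyps tA fA by (intro Bochner_Integration.integral_cong refl) (simp add: algebra_simps)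
  also have "\<dots> = E (\<lambda>\<eta>. (\<Prod>x\<in>A. \<eta> x) * (\<Prod>x\<in>B. 1 - \<eta> x) * (\<eta> y - \<eta> z))
          - E (\<lambda>\<eta>. (\<Prod>x\<in>insert t A. \<eta> x) * (\<Prod>x\<in>B. 1 - \<eta> x) * (\<eta> y - \<eta> z))"
    by (rule Bochner_Integration.integral_diff) simp_all
  finally have "\<bar>E (\<lambda>\<eta>. (\<Prod>x\<in>A. \<eta> x) * (\<Prod>x\<in>insert t B. 1 - \<eta> x) * (\<eta> y - \<eta> z))\<bar>
      \<le> \<bar>E (\<lambda>\<eta>. (\<Prod>x\<in>A. \<eta> x) * (\<Prod>x\<in>B. 1 - \<eta> x) * (\<eta> y - \<eta> z))\<bar>
        + \<bar>E (\<lambda>\<eta>. (\<Prod>x\<in>insert t A. \<eta> x) * (\<Prod>x\<in>B. 1 - \<eta> x) * (\<eta> y - \<eta> z))\<bar>"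
    by linarith
  also have "\<dots> \<le> 2 ^ card B * ?c (card A + card B) * ?w + 2 ^ card B * ?c (card (insert t A) + card B) * ?w"
    using insert.prems insert.hyps by (intro add_mono insert.IH) auto
  also have "\<dots> \<le> 2 ^ card B * ?c (card A + card (insert t B)) * ?w + 2 ^ card B * ?c (card A + card (insert t B)) * ?w"
    using insert.hyps tA fA j_pos w by (intro add_mono mult_right_mono mult_left_mono) auto
  also have "\<dots> = 2 ^ card (insert t B) * ?c (card A + card (insert t B)) * ?w"
    using insert.hyps by simp
  finally show ?case .
qed

lemma occupied_equicontinuous:
  assumes A: "A \<subseteq> Lam N" "card A \<le> n" and y: "y \<in> Lam N - A" and z: "z \<in> Lam N - A"
    and \<delta>: "2 * real K \<le> \<delta> * real N" "\<delta> \<le> 1" "0 < \<delta>"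
  shows "\<bar>E (\<lambda>\<eta>. (\<Prod>x\<in>A. \<eta> x) * (\<eta> y - \<eta> z))\<bar>
    \<le> equicont_const n * (\<delta> + 6 * \<bar>real_of_int (y - z)\<bar> / (\<delta> * real N))"
proof -
  have "\<bar>E (\<lambda>\<eta>. (\<Prod>x\<in>A. \<eta> x) * (\<eta> y - \<eta> z))\<bar>
      \<le> 4 * j * real K * (real (card A) + 2) * (\<delta> + 6 * \<bar>real_of_int (y - z)\<bar> / (\<delta> * real N))"
    using mixed_equicontinuous[OF _ A(1) _ _ _ _ \<delta>(1,2), of "{}" y z] y z by simp
  also have "\<dots> \<le> equicont_const n * (\<delta> + 6 * \<bar>real_of_int (y - z)\<bar> / (\<delta> * real N))"
  proof (rule mult_right_mono)
    have "1 * (4 * j * real K * (real (card A) + 2)) \<le> 2 ^ n * (4 * j * real K * (real n + 2))"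
      using A j_pos by (intro mult_mono) auto
    then show "4 * j * real K * (real (card A) + 2) \<le> equicont_const n" by (simp add: equicont_const_def)
  qed (use \<delta> in simp)
  finally show ?thesis .
qed

text \<open>Reflection combined with particle-hole exchange carries the left reservoir to the right
  one. The variables \<open>1 - \<eta> (- x)\<close> thus get the shape of the occupied case, and
  one argument serves both ends.\<close>

lemma vacant_equicontinuous:
  assumes A: "A \<subseteq> Lam N" "card A \<le> n" and y: "y \<in> Lam N - A" and z: "z \<in> Lam N - A"
    and \<delta>: "2 * real K \<le> \<delta> * real N" "\<delta> \<le> 1" "0 < \<delta>"
  shows "\<bar>E (\<lambda>\<eta>. (\<Prod>x\<in>A. 1 - \<eta> (- x)) * ((1 - \<eta> (- y)) - (1 - \<eta> (- z))))\<bar>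
    \<le> equicont_const n * (\<delta> + 6 * \<bar>real_of_int (y - z)\<bar> / (\<delta> * real N))"
proof -
  have fA: "finite A" using A(1) by (rule finite_subset) simp
  have "(\<Prod>x\<in>A. 1 - \<eta> (- x)) = (\<Prod>x\<in>uminus ` A. 1 - \<eta> x)" for \<eta> :: config
    by (simp add: prod.reindex)
  then have "\<bar>E (\<lambda>\<eta>. (\<Prod>x\<in>A. 1 - \<eta> (- x)) * ((1 - \<eta> (- y)) - (1 - \<eta> (- z))))\<bar>
     = \<bar>E (\<lambda>\<eta>. (\<Prod>x\<in>{}. \<eta> x) * (\<Prod>x\<in>uminus ` A. 1 - \<eta> x) * (\<eta> (- z) - \<eta> (- y)))\<bar>"
    by simp
  also have "\<dots> \<le> 2 ^ card A * (4 * j * real K * (real (card A) + 2)) * (\<delta> + 6 * \<bar>real_of_int (- z - - y)\<bar> / (\<delta> * real N))"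
  proof -
    have "uminus ` A \<subseteq> Lam N" using A(1) by (force simp: Lam_def)
    moreover have "- z \<in> Lam N - {} - uminus ` A" "- y \<in> Lam N - {} - uminus ` A"
      using y z by (auto simp: Lam_def)
    moreover have "card (uminus ` A) = card A" by (simp add: card_image inj_on_def)
    ultimately show ?thesis
      using mixed_equicontinuous[of "uminus ` A" "{}" "- z" "- y" \<delta>] fA \<delta> by simp
  qed
  also have "\<dots> = equicont_const (card A) * (\<delta> + 6 * \<bar>real_of_int (y - z)\<bar> / (\<delta> * real N))"
    by (simp add: equicont_const_def)
  also have "\<dots> \<le> equicont_const n * (\<delta> + 6 * \<bar>real_of_int (y - z)\<bar> / (\<delta> * real N))"
    using equicont_const_mono[OF A(2)] \<delta> by (intro mult_right_mono) auto
  finally show ?thesis .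
qed

lemma E_sum_scaled: "E (\<lambda>\<eta>. \<Sum>y\<in>A. c y * f y \<eta>) = (\<Sum>y\<in>A. c y * E (f y))"
  by simp

text \<open>Replacing one factor by an average. The indicator accounts for coinciding sites, where
  the square of an occupation variable is not the square of its average.\<close>
lemma replace_by_average:
  fixes Z :: "int \<Rightarrow> config \<Rightarrow> real"
  assumes Z: "\<And>\<eta> x. \<eta> \<in> configs N \<Longrightarrow> x \<in> Lam N \<Longrightarrow> Z x \<eta> = 0 \<or> Z x \<eta> = 1"
    and eqc: "\<And>A y z. A \<subseteq> Lam N \<Longrightarrow> card A \<le> n \<Longrightarrow> y \<in> Lam N - A \<Longrightarrow> z \<in> Lam N - A \<Longrightarrow>
       \<bar>E (\<lambda>\<eta>. (\<Prod>x\<in>A. Z x \<eta>) * (Z y \<eta> - Z z \<eta>))\<bar> \<le> c * (\<delta> + 6 * \<bar>real_of_int (y - z)\<bar> / (\<delta> * real N))"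
    and c: "0 \<le> c" and \<delta>: "0 < \<delta>"
    and G: "\<And>y. y \<in> Lam N \<Longrightarrow> 0 \<le> G y" "(\<Sum>y\<in>Lam N. G y) = 1" "\<And>y. y \<in> Lam N \<Longrightarrow> G y \<le> g"
    and x: "x \<in> Lam N" "(\<Sum>y\<in>Lam N. G y * \<bar>real_of_int (x - y)\<bar>) \<le> m"
    and S: "S \<subseteq> Lam N" "card S + l \<le> n"
  defines "\<Theta> \<equiv> \<lambda>\<eta>. \<Sum>y\<in>Lam N. G y * Z y \<eta>"
  shows "\<bar>E (\<lambda>\<eta>. \<Theta> \<eta> ^ l * (\<Prod>x\<in>S. Z x \<eta>) * (Z x \<eta> - \<Theta> \<eta>))\<bar>
    \<le> c * (\<delta> + 6 * m / (\<delta> * real N)) + real n * g + real l * g + of_bool (x \<in> S)"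
  using S
proof (induction l arbitrary: S)
  case 0
  have fS: "finite S" using 0(1) by (rule finite_subset) simp
  \<comment> \<open>At coinciding sites equicontinuity says nothing and the trivial bound 1 is used.
    Averaged over \<open>y\<close>, the sites of \<open>S\<close> have weight at most
    \<open>n * g\<close>, small when the weights are spread out.\<close>
  have bd: "\<bar>E (\<lambda>\<eta>. (\<Prod>x\<in>S. Z x \<eta>) * (Z x \<eta> - Z y \<eta>))\<bar>
     \<le> c * (\<delta> + 6 * \<bar>real_of_int (x - y)\<bar> / (\<delta> * real N)) + of_bool (y \<in> S) + of_bool (x \<in> S)"
    if y: "y \<in> Lam N" for y
  proof (cases "x \<in> S \<or> y \<in> S")
    case True
    have "\<bar>E (\<lambda>\<eta>. (\<Prod>x\<in>S. Z x \<eta>) * (Z x \<eta> - Z y \<eta>))\<bar> \<le> 1"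
    proof (rule E_abs_le)
      fix \<eta> assume \<eta>: "\<eta> \<in> configs N"
      have "0 \<le> Z u \<eta> \<and> Z u \<eta> \<le> 1" if "u \<in> Lam N" for u
        using Z[OF \<eta> that] by auto
      then have "0 \<le> (\<Prod>x\<in>S. Z x \<eta>)" "(\<Prod>x\<in>S. Z x \<eta>) \<le> 1" "\<bar>Z x \<eta> - Z y \<eta>\<bar> \<le> 1"
        using 0(1) x(1) y by (auto intro!: prod_nonneg prod_le_1 simp: abs_le_iff subset_iff) (smt (verit))+
      then show "\<bar>(\<Prod>x\<in>S. Z x \<eta>) * (Z x \<eta> - Z y \<eta>)\<bar> \<le> 1"
        unfolding abs_mult by (intro mult_le_one) auto
    qed
    moreover have "0 \<le> c * (\<delta> + 6 * \<bar>real_of_int (x - y)\<bar> / (\<delta> * real N))" using c \<delta> by simp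
    ultimately show ?thesis using True by auto
  next
    case False
    then show ?thesis using eqc[of S x y] 0 x y by simp
  qed
  have "E (\<lambda>\<eta>. (\<Prod>x\<in>S. Z x \<eta>) * (Z x \<eta> - \<Theta> \<eta>))
     = E (\<lambda>\<eta>. \<Sum>y\<in>Lam N. G y * ((\<Prod>x\<in>S. Z x \<eta>) * (Z x \<eta> - Z y \<eta>)))"
  proof (rule Bochner_Integration.integral_cong[OF refl])
    fix \<eta>
    have "Z x \<eta> - \<Theta> \<eta> = (\<Sum>y\<in>Lam N. G y) * Z x \<eta> - \<Theta> \<eta>" using G by simp
    also have "\<dots> = (\<Sum>y\<in>Lam N. G y * (Z x \<eta> - Z y \<eta>))"
      by (simp add: \<Theta>_def sum_distrib_right sum_subtractf right_diff_distrib)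
    finally show "(\<Prod>x\<in>S. Z x \<eta>) * (Z x \<eta> - \<Theta> \<eta>)
        = (\<Sum>y\<in>Lam N. G y * ((\<Prod>x\<in>S. Z x \<eta>) * (Z x \<eta> - Z y \<eta>)))"
      by (simp add: sum_distrib_left mult_ac)
  qed
  also have "\<dots> = (\<Sum>y\<in>Lam N. G y * E (\<lambda>\<eta>. (\<Prod>x\<in>S. Z x \<eta>) * (Z x \<eta> - Z y \<eta>)))"
    by (rule E_sum_scaled)
  finally have "\<bar>E (\<lambda>\<eta>. (\<Prod>x\<in>S. Z x \<eta>) * (Z x \<eta> - \<Theta> \<eta>))\<bar>
     \<le> (\<Sum>y\<in>Lam N. \<bar>G y * E (\<lambda>\<eta>. (\<Prod>x\<in>S. Z x \<eta>) * (Z x \<eta> - Z y \<eta>))\<bar>)"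
    by (simp only: sum_abs)
  also have "\<dots> \<le> (\<Sum>y\<in>Lam N. G y * (c * (\<delta> + 6 * \<bar>real_of_int (x - y)\<bar> / (\<delta> * real N)) + of_bool (y \<in> S) + of_bool (x \<in> S)))"
  proof (rule sum_mono)
    fix y assume y: "y \<in> Lam N"
    show "\<bar>G y * E (\<lambda>\<eta>. (\<Prod>x\<in>S. Z x \<eta>) * (Z x \<eta> - Z y \<eta>))\<bar>
      \<le> G y * (c * (\<delta> + 6 * \<bar>real_of_int (x - y)\<bar> / (\<delta> * real N)) + of_bool (y \<in> S) + of_bool (x \<in> S))"
      unfolding abs_mult using bd[OF y] G(1)[OF y] by (simp add: mult_left_mono)
  qed
  also have "\<dots> = (c * \<delta> + of_bool (x \<in> S)) * (\<Sum>y\<in>Lam N. G y)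
      + c * 6 / (\<delta> * real N) * (\<Sum>y\<in>Lam N. G y * \<bar>real_of_int (x - y)\<bar>) + (\<Sum>y\<in>Lam N. G y * of_bool (y \<in> S))"
    unfolding sum_distrib_left sum.distrib[symmetric] by (intro sum.cong refl) (simp add: algebra_simps)
  also have "\<dots> \<le> (c * \<delta> + of_bool (x \<in> S)) + c * 6 / (\<delta> * real N) * m + real n * g"
  proof (intro add_mono mult_left_mono x(2))
    have g: "0 \<le> g" using G(1,3)[OF x(1)] by simp
    have "(\<Sum>y\<in>Lam N. G y * of_bool (y \<in> S)) = (\<Sum>y\<in>S. G y)"
      using 0(1) by (intro sum.mono_neutral_cong_right) auto
    also have "\<dots> \<le> real (card S) * g" using 0(1) G(3) by (intro sum_bounded_above) auto
    also have "\<dots> \<le> real n * g" using 0(2) g by (intro mult_right_mono) auto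
    finally show "(\<Sum>y\<in>Lam N. G y * of_bool (y \<in> S)) \<le> real n * g" .
  qed (use G c \<delta> in auto)
  finally show ?case by (simp add: algebra_simps)
next
  case (Suc l)
  have fS: "finite S" using Suc(2) by (rule finite_subset) simp
  let ?e = "c * (\<delta> + 6 * m / (\<delta> * real N)) + real n * g + real l * g"
  \<comment> \<open>As \<open>Z\<close> takes the values 0 and 1, a repeated factor is absorbed. So
    one factor \<Theta> expands into products over enlarged sets, and the case \<open>x = y\<close>
    costs only \<open>G x\<close>.\<close>
  have ins: "Z y \<eta> * (\<Prod>x\<in>S. Z x \<eta>) = (\<Prod>x\<in>insert y S. Z x \<eta>)" if "\<eta> \<in> configs N" "y \<in> Lam N" for \<eta> y
  proof (cases "y \<in> S")
    case True
    then have "(\<Prod>x\<in>S. Z x \<eta>) = Z y \<eta> * (\<Prod>x\<in>S - {y}. Z x \<eta>)" using fS by (simp add: prod.remove)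
    then show ?thesis using True Z[OF that] by (auto simp: insert_absorb)
  qed (use fS in simp)
  have "E (\<lambda>\<eta>. \<Theta> \<eta> ^ Suc l * (\<Prod>x\<in>S. Z x \<eta>) * (Z x \<eta> - \<Theta> \<eta>))
      = E (\<lambda>\<eta>. \<Sum>y\<in>Lam N. G y * (\<Theta> \<eta> ^ l * (\<Prod>x\<in>insert y S. Z x \<eta>) * (Z x \<eta> - \<Theta> \<eta>)))"
  proof (rule E_cong)
    fix \<eta> assume \<eta>: "\<eta> \<in> configs N"
    have "\<Theta> \<eta> ^ Suc l * (\<Prod>x\<in>S. Z x \<eta>) * (Z x \<eta> - \<Theta> \<eta>)
        = (\<Sum>y\<in>Lam N. G y * Z y \<eta>) * (\<Theta> \<eta> ^ l * (\<Prod>x\<in>S. Z x \<eta>) * (Z x \<eta> - \<Theta> \<eta>))"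
      by (simp add: \<Theta>_def mult_ac)
    also have "\<dots> = (\<Sum>y\<in>Lam N. G y * (\<Theta> \<eta> ^ l * (Z y \<eta> * (\<Prod>x\<in>S. Z x \<eta>)) * (Z x \<eta> - \<Theta> \<eta>)))"
      unfolding sum_distrib_right by (intro sum.cong refl) (simp add: mult_ac)
    also have "\<dots> = (\<Sum>y\<in>Lam N. G y * (\<Theta> \<eta> ^ l * (\<Prod>x\<in>insert y S. Z x \<eta>) * (Z x \<eta> - \<Theta> \<eta>)))"
      by (intro sum.cong refl) (simp only: ins[OF \<eta>])
    finally show "\<Theta> \<eta> ^ Suc l * (\<Prod>x\<in>S. Z x \<eta>) * (Z x \<eta> - \<Theta> \<eta>)
       = (\<Sum>y\<in>Lam N. G y * (\<Theta> \<eta> ^ l * (\<Prod>x\<in>insert y S. Z x \<eta>) * (Z x \<eta> - \<Theta> \<eta>)))" .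
  qed
  also have "\<dots> = (\<Sum>y\<in>Lam N. G y * E (\<lambda>\<eta>. \<Theta> \<eta> ^ l * (\<Prod>x\<in>insert y S. Z x \<eta>) * (Z x \<eta> - \<Theta> \<eta>)))"
    by (rule E_sum_scaled)
  finally have "\<bar>E (\<lambda>\<eta>. \<Theta> \<eta> ^ Suc l * (\<Prod>x\<in>S. Z x \<eta>) * (Z x \<eta> - \<Theta> \<eta>))\<bar>
    \<le> (\<Sum>y\<in>Lam N. \<bar>G y * E (\<lambda>\<eta>. \<Theta> \<eta> ^ l * (\<Prod>x\<in>insert y S. Z x \<eta>) * (Z x \<eta> - \<Theta> \<eta>))\<bar>)"
    by (simp only: sum_abs)
  also have "\<dots> \<le> (\<Sum>y\<in>Lam N. G y * (?e + of_bool (x \<in> S) + of_bool (x = y)))"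
  proof (rule sum_mono)
    fix y assume y: "y \<in> Lam N"
    have "card (insert y S) + l \<le> n" using Suc(3) card_insert_le_m1[of "Suc (card S)" S y] fS
      by (simp add: card_insert_if)
    then have "\<bar>E (\<lambda>\<eta>. \<Theta> \<eta> ^ l * (\<Prod>x\<in>insert y S. Z x \<eta>) * (Z x \<eta> - \<Theta> \<eta>))\<bar> \<le> ?e + of_bool (x \<in> insert y S)"
      using Suc(2) y by (intro Suc.IH) auto
    also have "\<dots> \<le> ?e + of_bool (x \<in> S) + of_bool (x = y)" by auto
    finally show "\<bar>G y * E (\<lambda>\<eta>. \<Theta> \<eta> ^ l * (\<Prod>x\<in>insert y S. Z x \<eta>) * (Z x \<eta> - \<Theta> \<eta>))\<bar>
      \<le> G y * (?e + of_bool (x \<in> S) + of_bool (x = y))"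
      unfolding abs_mult using G(1)[OF y] by (simp add: mult_left_mono)
  qed
  also have "\<dots> = (?e + of_bool (x \<in> S)) * (\<Sum>y\<in>Lam N. G y) + (\<Sum>y\<in>Lam N. if x = y then G y else 0)"
    unfolding sum_distrib_left sum.distrib[symmetric] by (intro sum.cong refl) (simp add: algebra_simps)
  also have "\<dots> = ?e + of_bool (x \<in> S) + G x" using G x by (simp add: sum.delta)
  also have "\<dots> \<le> ?e + of_bool (x \<in> S) + g" using G(3)[OF x(1)] by simp
  finally show ?case by (simp add: algebra_simps)
qed

text \<open>Turns the product over a reservoir into \<open>\<Theta> ^ K\<close> and applies
  \<open>power_diff_ge\<close>. The number \<open>b\<close> will be the smoothed profile at the end,
  which the dissipation identity provides in place of \<open>a\<close>.\<close>

lemma boundary_lower_bound: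
  fixes Z :: "int \<Rightarrow> config \<Rightarrow> real"
  assumes Z: "\<And>\<eta> x. \<eta> \<in> configs N \<Longrightarrow> x \<in> Lam N \<Longrightarrow> Z x \<eta> = 0 \<or> Z x \<eta> = 1"
    and eqc: "\<And>A y z. A \<subseteq> Lam N \<Longrightarrow> card A \<le> K \<Longrightarrow> y \<in> Lam N - A \<Longrightarrow> z \<in> Lam N - A \<Longrightarrow>
       \<bar>E (\<lambda>\<eta>. (\<Prod>x\<in>A. Z x \<eta>) * (Z y \<eta> - Z z \<eta>))\<bar> \<le> c * (\<delta> + 6 * \<bar>real_of_int (y - z)\<bar> / (\<delta> * real N))"
    and c: "0 \<le> c" and \<delta>: "0 < \<delta>"
    and G: "\<And>y. y \<in> Lam N \<Longrightarrow> 0 \<le> G y" "(\<Sum>y\<in>Lam N. G y) = 1" "\<And>y. y \<in> Lam N \<Longrightarrow> G y \<le> g"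
    and I: "I \<subseteq> Lam N" "card I = K"
    and m: "\<And>x. x \<in> I \<Longrightarrow> (\<Sum>y\<in>Lam N. G y * \<bar>real_of_int (x - y)\<bar>) \<le> m"
    and a: "0 \<le> a" "a \<le> 1"
  defines "\<Theta> \<equiv> \<lambda>\<eta>. \<Sum>y\<in>Lam N. G y * Z y \<eta>"
  shows "a ^ (K - 1) * E (\<lambda>\<eta>. (\<Theta> \<eta> - a)\<^sup>2)
      - 2 * real K * (c * (\<delta> + 6 * m / (\<delta> * real N)) + 2 * real K * g)
      - \<bar>a - b\<bar> \<le> E (\<lambda>\<eta>. ((\<Prod>x\<in>I. Z x \<eta>) - a ^ K) * (\<Theta> \<eta> - b))"
proof -
  let ?e = "c * (\<delta> + 6 * m / (\<delta> * real N)) + 2 * real K * g"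
  have Z01: "0 \<le> Z x \<eta>" "Z x \<eta> \<le> 1" if "\<eta> \<in> configs N" "x \<in> Lam N" for \<eta> x
    using Z[OF that] by auto
  have fI: "finite I" using I(1) by (rule finite_subset) simp
  obtain x0 where x0: "x0 \<in> I" using I(2) K_pos by fastforce
  have g0: "0 \<le> g" using G(1,3) x0 I by force
  \<comment> \<open>Sites are traded one by one for factors \<Theta>. The cases \<open>p = 0\<close>
    and \<open>p = 1\<close> are both needed, as the product is tested against
    \<open>\<Theta> - a\<close>.\<close>
  have chain: "\<bar>E (\<lambda>\<eta>. \<Theta> \<eta> ^ p * (\<Prod>x\<in>B. Z x \<eta>)) - E (\<lambda>\<eta>. \<Theta> \<eta> ^ (p + card B))\<bar> \<le> real (card B) * ?e"
    if "finite B" "B \<subseteq> I" "p + card B \<le> Suc K" for p B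
    using that
  proof (induction B arbitrary: p rule: finite_induct)
    case (insert x B)
    have xL: "x \<in> Lam N" and BL: "B \<subseteq> Lam N" using insert.prems I by auto
    have "\<bar>E (\<lambda>\<eta>. \<Theta> \<eta> ^ p * (\<Prod>x\<in>B. Z x \<eta>) * (Z x \<eta> - \<Theta> \<eta>))\<bar>
      \<le> c * (\<delta> + 6 * m / (\<delta> * real N)) + real K * g + real p * g + of_bool (x \<in> B)"
      unfolding \<Theta>_def using insert.prems insert.hyps
      by (intro replace_by_average[OF Z eqc c \<delta> G xL m BL]) auto
    also have "\<dots> \<le> ?e"
    proof -
      have "p \<le> K" using insert.prems insert.hyps by simp
      then have "real p * g \<le> real K * g" using g0 by (intro mult_right_mono) auto
      then show ?thesis using insert.hyps by (simp add: algebra_simps)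
    qed
    finally have 1: "\<bar>E (\<lambda>\<eta>. \<Theta> \<eta> ^ p * (\<Prod>x\<in>B. Z x \<eta>) * (Z x \<eta> - \<Theta> \<eta>))\<bar> \<le> ?e" .
    have "E (\<lambda>\<eta>. \<Theta> \<eta> ^ p * (\<Prod>x\<in>B. Z x \<eta>) * (Z x \<eta> - \<Theta> \<eta>))
       = E (\<lambda>\<eta>. \<Theta> \<eta> ^ p * (\<Prod>x\<in>insert x B. Z x \<eta>) - \<Theta> \<eta> ^ Suc p * (\<Prod>x\<in>B. Z x \<eta>))"
      using insert.hyps by (intro Bochner_Integration.integral_cong refl) (simp add: algebra_simps)
    also have "\<dots> = E (\<lambda>\<eta>. \<Theta> \<eta> ^ p * (\<Prod>x\<in>insert x B. Z x \<eta>)) - E (\<lambda>\<eta>. \<Theta> \<eta> ^ Suc p * (\<Prod>x\<in>B. Z x \<eta>))"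
      by (rule Bochner_Integration.integral_diff) simp_all
    finally have 2: "\<bar>E (\<lambda>\<eta>. \<Theta> \<eta> ^ p * (\<Prod>x\<in>insert x B. Z x \<eta>)) - E (\<lambda>\<eta>. \<Theta> \<eta> ^ Suc p * (\<Prod>x\<in>B. Z x \<eta>))\<bar> \<le> ?e"
      using 1 by simp
    have "\<bar>E (\<lambda>\<eta>. \<Theta> \<eta> ^ Suc p * (\<Prod>x\<in>B. Z x \<eta>)) - E (\<lambda>\<eta>. \<Theta> \<eta> ^ (Suc p + card B))\<bar> \<le> real (card B) * ?e"
      using insert.prems insert.hyps by (intro insert.IH) auto
    then have "\<bar>E (\<lambda>\<eta>. \<Theta> \<eta> ^ p * (\<Prod>x\<in>insert x B. Z x \<eta>)) - E (\<lambda>\<eta>. \<Theta> \<eta> ^ (Suc p + card B))\<bar> \<le> real (card B) * ?e + ?e"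
      using 2 by linarith
    moreover have "Suc p + card B = p + card (insert x B)" "real (card (insert x B)) = real (card B) + 1"
      using insert.hyps by simp_all
    ultimately show ?case by (simp only: distrib_right mult_1)
  qed simp
  define Pr where "Pr = (\<lambda>\<eta>. \<Prod>x\<in>I. Z x \<eta>)"
  have c0: "\<bar>E Pr - E (\<lambda>\<eta>. \<Theta> \<eta> ^ K)\<bar> \<le> real K * ?e"
    using chain[of I 0] fI I by (simp add: Pr_def)
  have c1: "\<bar>E (\<lambda>\<eta>. \<Theta> \<eta> * Pr \<eta>) - E (\<lambda>\<eta>. \<Theta> \<eta> ^ Suc K)\<bar> \<le> real K * ?e"
    using chain[of I 1] fI I by (simp add: Pr_def)
  have \<Theta>0: "0 \<le> \<Theta> \<eta>" if "\<eta> \<in> configs N" for \<eta>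
    unfolding \<Theta>_def by (intro sum_nonneg mult_nonneg_nonneg G Z01 that)
  have Pr01: "0 \<le> Pr \<eta> \<and> Pr \<eta> \<le> 1" if "\<eta> \<in> configs N" for \<eta>
    unfolding Pr_def using Z01[OF that] I by (intro conjI prod_nonneg prod_le_1) auto
  have aK: "0 \<le> a ^ K" "a ^ K \<le> 1" using a by (auto intro: power_le_one)
  have "a ^ (K - 1) * E (\<lambda>\<eta>. (\<Theta> \<eta> - a)\<^sup>2) = E (\<lambda>\<eta>. a ^ (K - 1) * (\<Theta> \<eta> - a)\<^sup>2)" by simp
  also have "\<dots> \<le> E (\<lambda>\<eta>. (\<Theta> \<eta> ^ K - a ^ K) * (\<Theta> \<eta> - a))"
    using \<Theta>0 a K_pos by (intro E_mono power_diff_ge) auto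
  also have "\<dots> = E (\<lambda>\<eta>. \<Theta> \<eta> ^ Suc K) - a * E (\<lambda>\<eta>. \<Theta> \<eta> ^ K) - a ^ K * (E \<Theta> - a)"
    by (simp add: left_diff_distrib right_diff_distrib mult_ac)
  also have "\<dots> \<le> E (\<lambda>\<eta>. \<Theta> \<eta> * Pr \<eta>) - a * E Pr - a ^ K * (E \<Theta> - a) + 2 * real K * ?e"
  proof -
    have "a * (E Pr - E (\<lambda>\<eta>. \<Theta> \<eta> ^ K)) \<le> a * (real K * ?e)"
      using c0 a by (intro mult_left_mono) auto
    also have "\<dots> \<le> 1 * (real K * ?e)"
      using c0 a by (intro mult_right_mono) auto
    finally have "a * E Pr - a * E (\<lambda>\<eta>. \<Theta> \<eta> ^ K) \<le> real K * ?e" by (simp only: right_diff_distrib mult_1)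
    then have "E (\<lambda>\<eta>. \<Theta> \<eta> ^ Suc K) - a * E (\<lambda>\<eta>. \<Theta> \<eta> ^ K) \<le> E (\<lambda>\<eta>. \<Theta> \<eta> * Pr \<eta>) - a * E Pr + (real K * ?e + real K * ?e)"
      using c1 by (simp only: abs_le_iff) linarith
    moreover have "2 * real K * ?e = real K * ?e + real K * ?e" by simp
    ultimately show ?thesis by (simp only:)
  qed
  also have "E (\<lambda>\<eta>. \<Theta> \<eta> * Pr \<eta>) - a * E Pr - a ^ K * (E \<Theta> - a) = E (\<lambda>\<eta>. (Pr \<eta> - a ^ K) * (\<Theta> \<eta> - a))"
    by (simp add: left_diff_distrib right_diff_distrib mult_ac)
  also have "\<dots> = E (\<lambda>\<eta>. (Pr \<eta> - a ^ K) * (\<Theta> \<eta> - b) + (Pr \<eta> - a ^ K) * (b - a))"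
    by (intro Bochner_Integration.integral_cong refl) (simp add: algebra_simps)
  also have "\<dots> = E (\<lambda>\<eta>. (Pr \<eta> - a ^ K) * (\<Theta> \<eta> - b)) + E (\<lambda>\<eta>. (Pr \<eta> - a ^ K) * (b - a))"
    by (rule Bochner_Integration.integral_add) simp_all
  also have "E (\<lambda>\<eta>. (Pr \<eta> - a ^ K) * (b - a)) \<le> \<bar>a - b\<bar>"
  proof -
    have "\<bar>E (\<lambda>\<eta>. (Pr \<eta> - a ^ K) * (b - a))\<bar> \<le> \<bar>a - b\<bar>"
    proof (rule E_abs_le)
      fix \<eta> assume "\<eta> \<in> configs N"
      then have "\<bar>Pr \<eta> - a ^ K\<bar> \<le> 1" using Pr01[of \<eta>] aK by (auto simp: abs_le_iff)
      then show "\<bar>(Pr \<eta> - a ^ K) * (b - a)\<bar> \<le> \<bar>a - b\<bar>"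
        unfolding abs_mult abs_minus_commute[of a b] by (rule mult_left_le_one_le[rotated 2]) auto
    qed
    then show ?thesis by linarith
  qed
  finally show ?thesis by (simp add: Pr_def algebra_simps)
qed

end

section \<open>The balance of dissipation\<close>

text \<open>The operator \<open>res_rate \<theta>\<close> times the inverse of
  \<open>res_rate \<theta> - lap\<close>: a self-adjoint averaging over the length
  \<open>1 / \<theta>\<close>.\<close>

definition smooth :: "real \<Rightarrow> nat \<Rightarrow> (int \<Rightarrow> real) \<Rightarrow> int \<Rightarrow> real" where
  "smooth \<theta> N f z = (\<Sum>y\<in>Lam N. res_kernel \<theta> N z y * f y)"

lemma lap_smooth:
  assumes "\<theta> > 0" "z \<in> Lam N" "N \<ge> 1"
  shows "lap N (smooth \<theta> N f) z = res_rate \<theta> * (smooth \<theta> N f z - f z)"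
proof -
  have "lap N (smooth \<theta> N f) z = (\<Sum>y\<in>Lam N. lap N (\<lambda>z. res_kernel \<theta> N z y) z * f y)"
    unfolding smooth_def lap_sum_fun lap_mult_const ..
  also have "\<dots> = (\<Sum>y\<in>Lam N. res_rate \<theta> * (res_kernel \<theta> N z y * f y) - (if z = y then res_rate \<theta> * f y else 0))"
    by (intro sum.cong refl) (simp add: res_kernel_lap[OF assms(1,2) _ assms(3)] algebra_simps)
  also have "\<dots> = res_rate \<theta> * (smooth \<theta> N f z - f z)"
    using assms by (simp add: sum_subtractf sum.delta smooth_def sum_distrib_left algebra_simps)
  finally show ?thesis .
qed

lemma smooth_selfadjoint:
  "(\<Sum>x\<in>Lam N. f x * smooth \<theta> N g x) = (\<Sum>x\<in>Lam N. smooth \<theta> N f x * g x)"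
proof -
  have "(\<Sum>x\<in>Lam N. f x * smooth \<theta> N g x) = (\<Sum>x\<in>Lam N. \<Sum>y\<in>Lam N. f x * (res_kernel \<theta> N x y * g y))"
    by (simp add: smooth_def sum_distrib_left)
  also have "\<dots> = (\<Sum>y\<in>Lam N. \<Sum>x\<in>Lam N. f x * (res_kernel \<theta> N x y * g y))" by (rule sum.swap)
  also have "\<dots> = (\<Sum>x\<in>Lam N. smooth \<theta> N f x * g x)"
    unfolding smooth_def sum_distrib_right
    by (intro sum.cong refl) (simp add: res_kernel_sym[of \<theta> N] mult.left_commute mult.commute)
  finally show ?thesis .
qed

lemma smooth_bound:
  assumes "\<theta> > 0" "z \<in> Lam N" "N \<ge> 1" and "\<And>y. y \<in> Lam N \<Longrightarrow> \<bar>f y - k\<bar> \<le> c"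
  shows "\<bar>smooth \<theta> N f z - k\<bar> \<le> c"
proof -
  have "smooth \<theta> N f z - k = (\<Sum>y\<in>Lam N. res_kernel \<theta> N z y * (f y - k))"
    using res_kernel_sum(2)[OF assms(1-3)]
    by (simp add: smooth_def right_diff_distrib sum_subtractf sum_distrib_right[symmetric])
  also have "\<bar>\<dots>\<bar> \<le> (\<Sum>y\<in>Lam N. \<bar>res_kernel \<theta> N z y * (f y - k)\<bar>)" by (rule sum_abs)
  also have "\<dots> \<le> (\<Sum>y\<in>Lam N. res_kernel \<theta> N z y * c)"
    unfolding abs_mult using assms res_kernel_nonneg[OF assms(1)] by (intro sum_mono mult_mono) auto
  also have "\<dots> = c" using res_kernel_sum(2)[OF assms(1-3)] by (simp add: sum_distrib_right[symmetric])
  finally show ?thesis .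
qed

text \<open>Pairs the resolvent equation with the smoothed field. It identifies the dissipation, and
  it also bounds the energy of a smoothed field, for fields bounded by 1, by
  \<open>res_rate \<theta>\<close> times the volume.\<close>

lemma smooth_energy:
  assumes "\<theta> > 0" "N \<ge> 1"
  shows "(\<Sum>b\<in>bonds N. (smooth \<theta> N f (b + 1) - smooth \<theta> N f b)\<^sup>2)
    = res_rate \<theta> * ((\<Sum>x\<in>Lam N. f x * smooth \<theta> N f x) - (\<Sum>x\<in>Lam N. (smooth \<theta> N f x)\<^sup>2))"
proof -
  have "(\<Sum>b\<in>bonds N. (smooth \<theta> N f (b + 1) - smooth \<theta> N f b)\<^sup>2)
      = - (\<Sum>x\<in>Lam N. smooth \<theta> N f x * lap N (smooth \<theta> N f) x)"
    unfolding sum_by_parts by (simp add: power2_eq_square)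
  also have "\<dots> = (\<Sum>x\<in>Lam N. res_rate \<theta> * (f x * smooth \<theta> N f x - (smooth \<theta> N f x)\<^sup>2))"
    unfolding sum_negf[symmetric]
    by (intro sum.cong refl) (simp add: lap_smooth[OF assms(1) _ assms(2)] algebra_simps power2_eq_square)
  finally show ?thesis by (simp add: sum_distrib_left[symmetric] sum_subtractf)
qed

text \<open>The same identity for a point mass, minus a nonnegative square. It controls the
  quadratic correction due to exchanges.\<close>

lemma kernel_energy:
  assumes "\<theta> > 0" "z \<in> Lam N" "N \<ge> 1"
  shows "(\<Sum>b\<in>bonds N. (res_kernel \<theta> N z (b + 1) - res_kernel \<theta> N z b)\<^sup>2) \<le> res_rate \<theta> * res_kernel \<theta> N z z"
proof -
  let ?R = "\<lambda>x. res_kernel \<theta> N x z"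
  have "(\<Sum>b\<in>bonds N. (?R (b + 1) - ?R b)\<^sup>2) = - (\<Sum>x\<in>Lam N. ?R x * lap N ?R x)"
    unfolding sum_by_parts by (simp add: power2_eq_square)
  also have "\<dots> = (\<Sum>x\<in>Lam N. (if x = z then res_rate \<theta> * ?R x else 0) - res_rate \<theta> * (?R x)\<^sup>2)"
    unfolding sum_negf[symmetric]
    by (intro sum.cong refl) (simp add: res_kernel_lap[OF assms(1) _ assms(2,3)] algebra_simps power2_eq_square)
  also have "\<dots> = res_rate \<theta> * ?R z - (\<Sum>x\<in>Lam N. res_rate \<theta> * (?R x)\<^sup>2)"
    using assms by (simp add: sum_subtractf sum.delta)
  also have "\<dots> \<le> res_rate \<theta> * ?R z"
    using res_rate_pos[OF assms(1)] by (simp add: sum_nonneg)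
  also have "(\<Sum>b\<in>bonds N. (?R (b + 1) - ?R b)\<^sup>2)
      = (\<Sum>b\<in>bonds N. (res_kernel \<theta> N z (b + 1) - res_kernel \<theta> N z b)\<^sup>2)"
    by (intro sum.cong refl) (metis res_kernel_sym)
  finally show ?thesis .
qed

context stationary_state
begin

text \<open>On configurations a birth can occur only at the rightmost vacancy, so the total rate
  telescopes to the indicator that the reservoir is not full.\<close>

lemma sum_D_plus:
  "(\<Sum>x\<in>I_plus K N. D_plus N \<eta> x) = 1 - (\<Prod>x\<in>I_plus K N. \<eta> x)"
proof -
  have "(\<Sum>x\<in>I_plus K N. D_plus N \<eta> x)
      = (\<Sum>x\<in>{int N - int K + 1..int N}. (\<Prod>y\<in>{x + 1..int N}. \<eta> y) - (\<Prod>y\<in>{x..int N}. \<eta> y))"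
    unfolding I_plus_def
  proof (rule sum.cong[OF refl])
    fix x assume "x \<in> {int N - int K + 1..int N}"
    then have "{x..int N} = insert x {x + 1..int N}" by auto
    then have "(\<Prod>y\<in>{x..int N}. \<eta> y) = \<eta> x * (\<Prod>y\<in>{x + 1..int N}. \<eta> y)" by simp
    then show "D_plus N \<eta> x = (\<Prod>y\<in>{x + 1..int N}. \<eta> y) - (\<Prod>y\<in>{x..int N}. \<eta> y)"
      by (simp add: D_plus_def algebra_simps)
  qed
  then show ?thesis
    using sum_telescope_int[of "int N - int K + 1" "int N" "\<lambda>x. \<Prod>y\<in>{x..int N}. \<eta> y"]
    by (simp add: I_plus_def)
qed

lemma sum_D_minus:
  "(\<Sum>x\<in>I_minus K N. D_minus N \<eta> x) = 1 - (\<Prod>x\<in>I_minus K N. 1 - \<eta> x)"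
proof -
  have "(\<Sum>x\<in>I_minus K N. D_minus N \<eta> x)
      = - (\<Sum>x\<in>{- int N..- int N + int K - 1}. (\<Prod>y\<in>{- int N..x + 1 - 1}. 1 - \<eta> y) - (\<Prod>y\<in>{- int N..x - 1}. 1 - \<eta> y))"
    unfolding I_minus_def sum_negf[symmetric]
  proof (rule sum.cong[OF refl])
    fix x assume "x \<in> {- int N..- int N + int K - 1}"
    then have "{- int N..x} = insert x {- int N..x - 1}" by auto
    then have "(\<Prod>y\<in>{- int N..x}. 1 - \<eta> y) = (1 - \<eta> x) * (\<Prod>y\<in>{- int N..x - 1}. 1 - \<eta> y)" by simp
    then show "D_minus N \<eta> x = - ((\<Prod>y\<in>{- int N..x + 1 - 1}. 1 - \<eta> y) - (\<Prod>y\<in>{- int N..x - 1}. 1 - \<eta> y))"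
      by (simp add: D_minus_def algebra_simps)
  qed
  then show ?thesis
    using sum_telescope_int[of "- int N" "- int N + int K - 1" "\<lambda>x. \<Prod>y\<in>{- int N..x - 1}. 1 - \<eta> y"]
    by (simp add: I_minus_def)
qed

lemma D_plus_cases:
  assumes "\<eta> \<in> configs N" "x \<in> I_plus K N"
  shows "0 \<le> D_plus N \<eta> x" "\<eta> x = 0 \<or> D_plus N \<eta> x = 0"
  using D_plus_01[of \<eta> N x] configs_cases[of \<eta> N x] assms I_plus_subset by (auto simp: D_plus_def)

lemma D_minus_cases:
  assumes "\<eta> \<in> configs N" "x \<in> I_minus K N"
  shows "0 \<le> D_minus N \<eta> x" "\<eta> x = 1 \<or> D_minus N \<eta> x = 0"
  using D_minus_01[of \<eta> N x] configs_cases[of \<eta> N x] assms I_minus_subset by (auto simp: D_minus_def)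

definition profile :: "real \<Rightarrow> int \<Rightarrow> real" where
  "profile a x = j * (1 - a ^ K) / real N * real_of_int x + 1 / 2"

definition deviation :: "real \<Rightarrow> config \<Rightarrow> int \<Rightarrow> real" where
  "deviation a \<eta> x = \<eta> x - profile a x"

text \<open>Stationarity applied to the squared \<open>L\<^sup>2\<close> norm of the smoothed deviation: the
  Dirichlet energy and the two boundary terms balance up to discretisation errors.\<close>
lemma dissipation:
  assumes \<theta>: "0 < \<theta>" "\<theta> \<le> 1" "\<theta> * real N \<ge> 1"
    and prof: "\<And>x. x \<in> Lam N \<Longrightarrow> 0 \<le> profile a x \<and> profile a x \<le> 1"
  defines "\<phi> \<equiv> \<lambda>\<eta>. smooth \<theta> N (deviation a \<eta>)"
  defines "\<psi> \<equiv> \<lambda>\<eta>. smooth \<theta> N (\<phi> \<eta>)"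
  shows "real N * E (\<lambda>\<eta>. \<Sum>b\<in>bonds N. (\<phi> \<eta> (b + 1) - \<phi> \<eta> b)\<^sup>2)
      + j * E (\<lambda>\<eta>. ((\<Prod>x\<in>I_plus K N. \<eta> x) - a ^ K) * \<psi> \<eta> (int N))
      - j * E (\<lambda>\<eta>. ((\<Prod>x\<in>I_minus K N. 1 - \<eta> x) - a ^ K) * \<psi> \<eta> (- int N))
    \<le> 2 * real N * res_rate \<theta> * (2 * real N + 1) * \<theta>
      + 2 * j * (sqrt (real K * (2 * res_rate \<theta> * (2 * real N + 1))) + 2 * \<theta>)"
proof -
  define J where "J = j * (1 - a ^ K)"
  define \<tau> where "\<tau> = sqrt (real K * (2 * res_rate \<theta> * (2 * real N + 1)))"
  define r where "r = res_kernel \<theta> N"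
  define F where "F = (\<lambda>\<eta>. \<Sum>z\<in>Lam N. (\<phi> \<eta> z)\<^sup>2)"
  define Q where "Q = 2 * res_rate \<theta> * (2 * real N + 1) * \<theta>"
  note rp = res_rate_pos[OF \<theta>(1)]
  have Nr: "real N > 0" using N_pos by simp
  have \<psi>_eq: "\<psi> \<eta> x = (\<Sum>z\<in>Lam N. \<phi> \<eta> z * r z x)" for \<eta> x
    by (simp add: \<psi>_def smooth_def r_def res_kernel_sym[of \<theta> N x] mult.commute)
  have \<phi>_eq: "\<phi> \<eta> z = (\<Sum>y\<in>Lam N. r z y * deviation a \<eta> y)" for \<eta> z
    by (simp add: \<phi>_def smooth_def r_def)
  have r_le: "r x z \<le> 4 * \<theta>" "0 \<le> r x z" if "x \<in> Lam N" "z \<in> Lam N" for x z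
    unfolding r_def using \<theta> that by (auto intro: res_kernel_le res_kernel_nonneg)
  have L0: "L_0 N F \<eta> \<le> - (\<Sum>b\<in>bonds N. (\<phi> \<eta> (b + 1) - \<phi> \<eta> b)\<^sup>2) - J / real N * (\<psi> \<eta> (int N) - \<psi> \<eta> (- int N)) + Q"
    if \<eta>: "\<eta> \<in> configs N" for \<eta>
  proof -
    define d where "d = (\<lambda>b. \<eta> (b + 1) - \<eta> b)"
    have d2: "(d b)\<^sup>2 \<le> 1" if "b \<in> bonds N" for b
      using configs_cases[OF \<eta>, of b] configs_cases[OF \<eta>, of "b + 1"] that by (auto simp: d_def Lam_def)
    \<comment> \<open>\<open>F\<close> is quadratic, so the expansion is exact: its gradient is
      \<open>2 * \<psi>\<close>, and the squared term is bounded by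
      \<open>kernel_energy\<close>.\<close>
    have ex: "F (exchange b \<eta>) - F \<eta> = 2 * (d b * (\<psi> \<eta> b - \<psi> \<eta> (b + 1))) + (d b)\<^sup>2 * (\<Sum>z\<in>Lam N. (r z b - r z (b + 1))\<^sup>2)"
      if b: "b \<in> bonds N" for b
    proof -
      have \<phi>ex: "\<phi> (exchange b \<eta>) z = \<phi> \<eta> z + d b * (r z b - r z (b + 1))" for z
      proof -
        have "\<phi> (exchange b \<eta>) z - \<phi> \<eta> z = (\<Sum>y\<in>Lam N. r z y * (exchange b \<eta> y - \<eta> y))"
          by (simp add: \<phi>_eq deviation_def sum_subtractf[symmetric] right_diff_distrib)
        also have "\<dots> = (\<Sum>y\<in>{b, b + 1}. r z y * (exchange b \<eta> y - \<eta> y))"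
          using b by (intro sum.mono_neutral_right) (auto simp: Lam_def exchange_def)
        also have "\<dots> = d b * (r z b - r z (b + 1))" by (simp add: exchange_def d_def algebra_simps)
        finally show ?thesis by simp
      qed
      have "F (exchange b \<eta>) - F \<eta> = (\<Sum>z\<in>Lam N. 2 * d b * (\<phi> \<eta> z * r z b) - 2 * d b * (\<phi> \<eta> z * r z (b + 1)) + (d b)\<^sup>2 * (r z b - r z (b + 1))\<^sup>2)"
        unfolding F_def \<phi>ex sum_subtractf[symmetric]
        by (intro sum.cong refl) (simp add: power2_eq_square algebra_simps)
      also have "\<dots> = 2 * d b * \<psi> \<eta> b - 2 * d b * \<psi> \<eta> (b + 1) + (d b)\<^sup>2 * (\<Sum>z\<in>Lam N. (r z b - r z (b + 1))\<^sup>2)"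
        by (simp add: \<psi>_eq sum.distrib sum_subtractf sum_distrib_left)
      finally show ?thesis by (simp add: algebra_simps)
    qed
    have "L_0 N F \<eta> = (\<Sum>b\<in>bonds N. d b * (\<psi> \<eta> b - \<psi> \<eta> (b + 1))) + 1 / 2 * (\<Sum>b\<in>bonds N. (d b)\<^sup>2 * (\<Sum>z\<in>Lam N. (r z b - r z (b + 1))\<^sup>2))"
      unfolding L_0_def using ex by (simp add: sum.distrib sum_distrib_left[symmetric])
    also have "(\<Sum>b\<in>bonds N. (d b)\<^sup>2 * (\<Sum>z\<in>Lam N. (r z b - r z (b + 1))\<^sup>2)) \<le> (\<Sum>b\<in>bonds N. 1 * (\<Sum>z\<in>Lam N. (r z b - r z (b + 1))\<^sup>2))"
      using d2 by (intro sum_mono mult_right_mono sum_nonneg) auto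
    also have "(\<Sum>b\<in>bonds N. 1 * (\<Sum>z\<in>Lam N. (r z b - r z (b + 1))\<^sup>2)) = (\<Sum>z\<in>Lam N. \<Sum>b\<in>bonds N. (r z b - r z (b + 1))\<^sup>2)"
      unfolding mult_1 by (rule sum.swap)
    also have "\<dots> \<le> (\<Sum>z\<in>Lam N. res_rate \<theta> * (4 * \<theta>))"
    proof (rule sum_mono)
      fix z assume z: "z \<in> Lam N"
      have "(\<Sum>b\<in>bonds N. (r z b - r z (b + 1))\<^sup>2) \<le> res_rate \<theta> * r z z"
        using kernel_energy[OF \<theta>(1) z N_pos] by (simp add: r_def power2_commute)
      also have "\<dots> \<le> res_rate \<theta> * (4 * \<theta>)" using rp r_le z by (intro mult_left_mono) auto
      finally show "(\<Sum>b\<in>bonds N. (r z b - r z (b + 1))\<^sup>2) \<le> res_rate \<theta> * (4 * \<theta>)" .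
    qed
    also have "1 / 2 * (\<Sum>z\<in>Lam N. res_rate \<theta> * (4 * \<theta>)) = Q"
      by (simp add: Lam_def Q_def algebra_simps)
    also have "(\<Sum>b\<in>bonds N. d b * (\<psi> \<eta> b - \<psi> \<eta> (b + 1))) = (\<Sum>x\<in>Lam N. \<eta> x * lap N (\<psi> \<eta>) x)"
      unfolding sum_by_parts sum_negf[symmetric] by (intro sum.cong refl) (simp add: d_def algebra_simps)
    also have "\<dots> = (\<Sum>x\<in>Lam N. deviation a \<eta> x * lap N (\<psi> \<eta>) x) + (\<Sum>x\<in>Lam N. profile a x * lap N (\<psi> \<eta>) x)"
      unfolding sum.distrib[symmetric] by (intro sum.cong refl) (simp add: deviation_def algebra_simps)
    \<comment> \<open>The profile is affine, so only the end values of \<psi> survive summation by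
      parts.\<close>
    also have "(\<Sum>x\<in>Lam N. profile a x * lap N (\<psi> \<eta>) x) = - (J / real N * (\<psi> \<eta> (int N) - \<psi> \<eta> (- int N)))"
    proof -
      have "(\<Sum>x\<in>Lam N. profile a x * lap N (\<psi> \<eta>) x) = - (\<Sum>b\<in>bonds N. J / real N * (\<psi> \<eta> (b + 1) - \<psi> \<eta> b))"
      proof -
        have "profile a (b + 1) - profile a b = J / real N" for b
          by (simp add: profile_def J_def[symmetric] distrib_left)
        then show ?thesis unfolding sum_by_parts by simp
      qed
      then show ?thesis using sum_telescope_int[of "- int N" "int N - 1" "\<psi> \<eta>"]
        unfolding sum_distrib_left[symmetric] by simp
    qed
    also have "(\<Sum>x\<in>Lam N. deviation a \<eta> x * lap N (\<psi> \<eta>) x) = - (\<Sum>b\<in>bonds N. (\<phi> \<eta> (b + 1) - \<phi> \<eta> b)\<^sup>2)"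
    proof -
      have "(\<Sum>x\<in>Lam N. deviation a \<eta> x * lap N (\<psi> \<eta>) x)
        = (\<Sum>x\<in>Lam N. res_rate \<theta> * (deviation a \<eta> x * smooth \<theta> N (\<phi> \<eta>) x - deviation a \<eta> x * \<phi> \<eta> x))"
        unfolding \<psi>_def by (intro sum.cong refl) (simp add: lap_smooth[OF \<theta>(1) _ N_pos] algebra_simps)
      also have "\<dots> = res_rate \<theta> * ((\<Sum>x\<in>Lam N. (\<phi> \<eta> x)\<^sup>2) - (\<Sum>x\<in>Lam N. deviation a \<eta> x * \<phi> \<eta> x))"
        unfolding sum_distrib_left[symmetric] sum_subtractf smooth_selfadjoint
        by (simp add: \<phi>_def power2_eq_square)
      also have "\<dots> = - (\<Sum>b\<in>bonds N. (\<phi> \<eta> (b + 1) - \<phi> \<eta> b)\<^sup>2)"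
        unfolding \<phi>_def smooth_energy[OF \<theta>(1) N_pos] by (simp add: algebra_simps)
      finally show ?thesis .
    qed
    finally show ?thesis by simp
  qed
  have dev1: "\<bar>deviation a \<eta> x - 0\<bar> \<le> 1" if "\<eta> \<in> configs N" "x \<in> Lam N" for \<eta> x
    using configs_01[OF that] prof[OF that(2)] by (auto simp: deviation_def)
  have \<phi>1: "\<bar>\<phi> \<eta> x - 0\<bar> \<le> 1" if "\<eta> \<in> configs N" "x \<in> Lam N" for \<eta> x
    unfolding \<phi>_def by (rule smooth_bound[OF \<theta>(1) that(2) N_pos dev1[OF that(1)]])
  have \<psi>1: "\<bar>\<psi> \<eta> x - 0\<bar> \<le> 1" if "\<eta> \<in> configs N" "x \<in> Lam N" for \<eta> x
    unfolding \<psi>_def by (rule smooth_bound[OF \<theta>(1) that(2) N_pos \<phi>1[OF that(1)]])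
  \<comment> \<open>Inside a reservoir \<psi> may be replaced by its value at the end: over
    \<open>K\<close> bonds it oscillates by at most \<tau>, since its energy is bounded by
    \<open>res_rate \<theta>\<close> times the volume, up to a factor 2.\<close>
  have \<psi>diff: "\<bar>\<psi> \<eta> x - \<psi> \<eta> y\<bar> \<le> \<tau>"
    if \<eta>: "\<eta> \<in> configs N" and xy: "x \<in> Lam N" "y \<in> Lam N" "\<bar>x - y\<bar> \<le> int K" for \<eta> x y
  proof -
    have "(\<psi> \<eta> x - \<psi> \<eta> y)\<^sup>2 \<le> \<bar>real_of_int (x - y)\<bar> * (\<Sum>b\<in>bonds N. (\<psi> \<eta> (b + 1) - \<psi> \<eta> b)\<^sup>2)"
      by (rule path_energy[OF xy(1,2)])
    also have "\<dots> \<le> real K * (2 * res_rate \<theta> * (2 * real N + 1))"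
    proof (rule mult_mono)
      have "real_of_int \<bar>x - y\<bar> \<le> real_of_int (int K)" using xy(3) by (simp only: of_int_le_iff)
      then show "\<bar>real_of_int (x - y)\<bar> \<le> real K" by simp
      have "(\<Sum>b\<in>bonds N. (\<psi> \<eta> (b + 1) - \<psi> \<eta> b)\<^sup>2)
        = res_rate \<theta> * ((\<Sum>x\<in>Lam N. \<phi> \<eta> x * \<psi> \<eta> x) - (\<Sum>x\<in>Lam N. (\<psi> \<eta> x)\<^sup>2))"
        unfolding \<psi>_def by (rule smooth_energy[OF \<theta>(1) N_pos])
      also have "\<dots> \<le> res_rate \<theta> * (\<Sum>x\<in>Lam N. 1)"
      proof (intro mult_left_mono)
        have "(\<Sum>x\<in>Lam N. \<phi> \<eta> x * \<psi> \<eta> x) \<le> (\<Sum>x\<in>Lam N. 1)"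
        proof (rule sum_mono)
          fix x assume x: "x \<in> Lam N"
          have "\<bar>\<phi> \<eta> x * \<psi> \<eta> x\<bar> \<le> 1"
            unfolding abs_mult using \<phi>1[OF \<eta> x] \<psi>1[OF \<eta> x] by (intro mult_le_one) auto
          then show "\<phi> \<eta> x * \<psi> \<eta> x \<le> 1" by simp
        qed
        moreover have "0 \<le> (\<Sum>x\<in>Lam N. (\<psi> \<eta> x)\<^sup>2)" by (intro sum_nonneg) auto
        ultimately show "(\<Sum>x\<in>Lam N. \<phi> \<eta> x * \<psi> \<eta> x) - (\<Sum>x\<in>Lam N. (\<psi> \<eta> x)\<^sup>2) \<le> (\<Sum>x\<in>Lam N. 1)" by linarith
      qed (use rp in simp)
      also have "\<dots> \<le> 2 * res_rate \<theta> * (2 * real N + 1)" using rp by (simp add: Lam_def algebra_simps)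
      finally show "(\<Sum>b\<in>bonds N. (\<psi> \<eta> (b + 1) - \<psi> \<eta> b)\<^sup>2) \<le> 2 * res_rate \<theta> * (2 * real N + 1)" .
    qed (auto intro: sum_nonneg)
    finally show ?thesis unfolding \<tau>_def by (intro real_le_rsqrt) simp
  qed
  have flip: "F (flip x \<eta>) - F \<eta> = 2 * (1 - 2 * \<eta> x) * \<psi> \<eta> x + (1 - 2 * \<eta> x)\<^sup>2 * (\<Sum>z\<in>Lam N. (r z x)\<^sup>2)"
    if "x \<in> Lam N" for x \<eta>
  proof -
    have \<phi>fl: "\<phi> (flip x \<eta>) z = \<phi> \<eta> z + (1 - 2 * \<eta> x) * r z x" for z
    proof -
      have "\<phi> (flip x \<eta>) z - \<phi> \<eta> z = (\<Sum>y\<in>Lam N. r z y * (flip x \<eta> y - \<eta> y))"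
        by (simp add: \<phi>_eq deviation_def sum_subtractf[symmetric] right_diff_distrib)
      also have "\<dots> = (\<Sum>y\<in>{x}. r z y * (flip x \<eta> y - \<eta> y))"
        using that by (intro sum.mono_neutral_right) (auto simp: flip_def)
      also have "\<dots> = (1 - 2 * \<eta> x) * r z x" by (simp add: flip_def algebra_simps)
      finally show ?thesis by simp
    qed
    have "F (flip x \<eta>) - F \<eta> = (\<Sum>z\<in>Lam N. 2 * (1 - 2 * \<eta> x) * (\<phi> \<eta> z * r z x) + (1 - 2 * \<eta> x)\<^sup>2 * (r z x)\<^sup>2)"
      unfolding F_def \<phi>fl sum_subtractf[symmetric]
      by (intro sum.cong refl) (simp add: power2_eq_square algebra_simps)
    then show ?thesis by (simp add: \<psi>_eq sum.distrib sum_distrib_left)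
  qed
  have r2: "0 \<le> (\<Sum>z\<in>Lam N. (r z x)\<^sup>2)" "(\<Sum>z\<in>Lam N. (r z x)\<^sup>2) \<le> 4 * \<theta>" if "x \<in> Lam N" for x
  proof -
    have "(\<Sum>z\<in>Lam N. (r z x)\<^sup>2) \<le> (\<Sum>z\<in>Lam N. 4 * \<theta> * r z x)"
      unfolding power2_eq_square using r_le that by (intro sum_mono mult_right_mono) auto
    also have "\<dots> = 4 * \<theta>" using res_kernel_sum(1)[OF \<theta>(1) that N_pos] by (simp add: r_def sum_distrib_left[symmetric])
    finally show "(\<Sum>z\<in>Lam N. (r z x)\<^sup>2) \<le> 4 * \<theta>" .
  qed (auto intro: sum_nonneg)
  have NL: "int N \<in> Lam N" "- int N \<in> Lam N" by (auto simp: Lam_def)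
  have Lbp: "L_b_plus j K N F \<eta> \<le> j * ((1 - (\<Prod>x\<in>I_plus K N. \<eta> x)) * \<psi> \<eta> (int N)) + j * (\<tau> + 2 * \<theta>)"
    if \<eta>: "\<eta> \<in> configs N" for \<eta>
  proof -
    have "(\<Sum>x\<in>I_plus K N. D_plus N \<eta> x * (F (flip x \<eta>) - F \<eta>))
      \<le> (\<Sum>x\<in>I_plus K N. D_plus N \<eta> x * (2 * \<psi> \<eta> (int N) + 2 * \<tau> + 4 * \<theta>))"
    proof (rule sum_mono)
      fix x assume x: "x \<in> I_plus K N"
      then have xL: "x \<in> Lam N" using I_plus_subset by auto
      show "D_plus N \<eta> x * (F (flip x \<eta>) - F \<eta>) \<le> D_plus N \<eta> x * (2 * \<psi> \<eta> (int N) + 2 * \<tau> + 4 * \<theta>)"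
      proof (cases "D_plus N \<eta> x = 0")
        case False
        \<comment> \<open>Births act on vacant sites, so \<open>1 - 2 * \<eta> x\<close> is 1; for
          deaths it is -1, whence the opposite sign at the left end.\<close>
        then have "\<eta> x = 0" using D_plus_cases[OF \<eta> x] by auto
        then have "F (flip x \<eta>) - F \<eta> = 2 * \<psi> \<eta> x + (\<Sum>z\<in>Lam N. (r z x)\<^sup>2)" using flip[OF xL, of \<eta>] by simp
        moreover have "\<bar>\<psi> \<eta> x - \<psi> \<eta> (int N)\<bar> \<le> \<tau>"
          using x by (intro \<psi>diff[OF \<eta> xL NL(1)]) (auto simp: I_plus_def)
        ultimately have "F (flip x \<eta>) - F \<eta> \<le> 2 * \<psi> \<eta> (int N) + 2 * \<tau> + 4 * \<theta>"
          using r2(2)[OF xL] by linarith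
        then show ?thesis using D_plus_cases(1)[OF \<eta> x] by (rule mult_left_mono)
      qed simp
    qed
    also have "\<dots> = 2 * ((1 - (\<Prod>x\<in>I_plus K N. \<eta> x)) * \<psi> \<eta> (int N)) + (1 - (\<Prod>x\<in>I_plus K N. \<eta> x)) * (2 * \<tau> + 4 * \<theta>)"
      unfolding sum_distrib_right[symmetric] sum_D_plus by (simp add: algebra_simps)
    also have "\<dots> \<le> 2 * ((1 - (\<Prod>x\<in>I_plus K N. \<eta> x)) * \<psi> \<eta> (int N)) + 1 * (2 * \<tau> + 4 * \<theta>)"
    proof (intro add_left_mono mult_right_mono)
      show "1 - (\<Prod>x\<in>I_plus K N. \<eta> x) \<le> 1"
        using configs_01[OF \<eta>] I_plus_subset by (auto intro!: prod_nonneg)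
      show "0 \<le> 2 * \<tau> + 4 * \<theta>" using \<theta> rp by (simp add: \<tau>_def)
    qed
    finally have *: "(\<Sum>x\<in>I_plus K N. D_plus N \<eta> x * (F (flip x \<eta>) - F \<eta>))
        \<le> 2 * ((1 - (\<Prod>x\<in>I_plus K N. \<eta> x)) * \<psi> \<eta> (int N)) + (2 * \<tau> + 4 * \<theta>)" by simp
    show ?thesis unfolding L_b_plus_def
      using mult_left_mono[OF *, of "j / 2"] j_pos by (simp add: algebra_simps)
  qed
  have Lbm: "L_b_minus j K N F \<eta> \<le> - (j * ((1 - (\<Prod>x\<in>I_minus K N. 1 - \<eta> x)) * \<psi> \<eta> (- int N))) + j * (\<tau> + 2 * \<theta>)"
    if \<eta>: "\<eta> \<in> configs N" for \<eta>
  proof -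
    have "(\<Sum>x\<in>I_minus K N. D_minus N \<eta> x * (F (flip x \<eta>) - F \<eta>))
      \<le> (\<Sum>x\<in>I_minus K N. D_minus N \<eta> x * (- 2 * \<psi> \<eta> (- int N) + 2 * \<tau> + 4 * \<theta>))"
    proof (rule sum_mono)
      fix x assume x: "x \<in> I_minus K N"
      then have xL: "x \<in> Lam N" using I_minus_subset by auto
      show "D_minus N \<eta> x * (F (flip x \<eta>) - F \<eta>) \<le> D_minus N \<eta> x * (- 2 * \<psi> \<eta> (- int N) + 2 * \<tau> + 4 * \<theta>)"
      proof (cases "D_minus N \<eta> x = 0")
        case False
        then have "\<eta> x = 1" using D_minus_cases[OF \<eta> x] by auto
        then have "F (flip x \<eta>) - F \<eta> = - 2 * \<psi> \<eta> x + (\<Sum>z\<in>Lam N. (r z x)\<^sup>2)" using flip[OF xL, of \<eta>] by simp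
        moreover have "\<bar>\<psi> \<eta> x - \<psi> \<eta> (- int N)\<bar> \<le> \<tau>"
          using x by (intro \<psi>diff[OF \<eta> xL NL(2)]) (auto simp: I_minus_def)
        ultimately have "F (flip x \<eta>) - F \<eta> \<le> - 2 * \<psi> \<eta> (- int N) + 2 * \<tau> + 4 * \<theta>"
          using r2(2)[OF xL] by linarith
        then show ?thesis using D_minus_cases(1)[OF \<eta> x] by (rule mult_left_mono)
      qed simp
    qed
    also have "\<dots> = - 2 * ((1 - (\<Prod>x\<in>I_minus K N. 1 - \<eta> x)) * \<psi> \<eta> (- int N)) + (1 - (\<Prod>x\<in>I_minus K N. 1 - \<eta> x)) * (2 * \<tau> + 4 * \<theta>)"
      unfolding sum_distrib_right[symmetric] sum_D_minus by (simp add: algebra_simps)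
    also have "\<dots> \<le> - 2 * ((1 - (\<Prod>x\<in>I_minus K N. 1 - \<eta> x)) * \<psi> \<eta> (- int N)) + 1 * (2 * \<tau> + 4 * \<theta>)"
    proof (intro add_left_mono mult_right_mono)
      show "1 - (\<Prod>x\<in>I_minus K N. 1 - \<eta> x) \<le> 1"
        using configs_01[OF \<eta>] I_minus_subset by (auto intro!: prod_nonneg)
      show "0 \<le> 2 * \<tau> + 4 * \<theta>" using \<theta> rp by (simp add: \<tau>_def)
    qed
    finally have *: "(\<Sum>x\<in>I_minus K N. D_minus N \<eta> x * (F (flip x \<eta>) - F \<eta>))
        \<le> - 2 * ((1 - (\<Prod>x\<in>I_minus K N. 1 - \<eta> x)) * \<psi> \<eta> (- int N)) + (2 * \<tau> + 4 * \<theta>)" by simp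
    show ?thesis unfolding L_b_minus_def
      using mult_left_mono[OF *, of "j / 2"] j_pos by (simp add: algebra_simps)
  qed
  define energy where "energy = (\<lambda>\<eta>. \<Sum>b\<in>bonds N. (\<phi> \<eta> (b + 1) - \<phi> \<eta> b)\<^sup>2)"
  define bp where "bp = (\<lambda>\<eta>. ((\<Prod>x\<in>I_plus K N. \<eta> x) - a ^ K) * \<psi> \<eta> (int N))"
  define bm where "bm = (\<lambda>\<eta>. ((\<Prod>x\<in>I_minus K N. 1 - \<eta> x) - a ^ K) * \<psi> \<eta> (- int N))"
  have "0 = real N * (E (L_0 N F) + 1 / real N * E (L_b j K N F))"
    unfolding E_L_0[of F] by simp
  also have "\<dots> = E (\<lambda>\<eta>. real N * L_0 N F \<eta> + L_b j K N F \<eta>)"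
    using Nr by (simp add: algebra_simps)
  also have "\<dots> \<le> E (\<lambda>\<eta>. - (real N * energy \<eta>) - j * bp \<eta> + j * bm \<eta> + (real N * Q + 2 * j * (\<tau> + 2 * \<theta>)))"
  proof (rule E_mono)
    fix \<eta> assume \<eta>: "\<eta> \<in> configs N"
    have "real N * L_0 N F \<eta> \<le> real N * (- energy \<eta> - J / real N * (\<psi> \<eta> (int N) - \<psi> \<eta> (- int N)) + Q)"
      unfolding energy_def by (intro mult_left_mono L0 \<eta>) auto
    also have "\<dots> = - (real N * energy \<eta>) - J * (\<psi> \<eta> (int N) - \<psi> \<eta> (- int N)) + real N * Q"
      using Nr by (simp add: algebra_simps)
    finally have 1: "real N * L_0 N F \<eta> \<le> - (real N * energy \<eta>) - J * (\<psi> \<eta> (int N) - \<psi> \<eta> (- int N)) + real N * Q" .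
    \<comment> \<open>The flux \<open>J\<close> of the profile cancels the constant part of the
      reservoir rate and leaves the deviation of the product from \<open>a ^ K\<close>.\<close>
    have "J * \<psi> \<eta> (int N) - j * ((1 - (\<Prod>x\<in>I_plus K N. \<eta> x)) * \<psi> \<eta> (int N)) = j * bp \<eta>"
      "J * \<psi> \<eta> (- int N) - j * ((1 - (\<Prod>x\<in>I_minus K N. 1 - \<eta> x)) * \<psi> \<eta> (- int N)) = j * bm \<eta>"
      by (simp_all add: J_def bp_def bm_def algebra_simps)
    then show "real N * L_0 N F \<eta> + L_b j K N F \<eta> \<le> - (real N * energy \<eta>) - j * bp \<eta> + j * bm \<eta> + (real N * Q + 2 * j * (\<tau> + 2 * \<theta>))"
      using 1 Lbp[OF \<eta>] Lbm[OF \<eta>] unfolding L_b_def by (simp add: algebra_simps)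
  qed
  also have "\<dots> = - (real N * E energy) - j * E bp + j * E bm + (real N * Q + 2 * j * (\<tau> + 2 * \<theta>))"
    by simp
  finally have "real N * E energy + j * E bp - j * E bm \<le> real N * Q + 2 * j * (\<tau> + 2 * \<theta>)" by linarith
  then show ?thesis unfolding energy_def bp_def bm_def Q_def \<tau>_def by (simp add: mult_ac)
qed

end

section \<open>Factorization of the correlations\<close>

text \<open>The square of the resolvent: unlike the resolvent itself it has no kink on the diagonal, where the
  exclusion rule would otherwise contribute an error of order one.\<close>
definition res_kernel2 :: "real \<Rightarrow> nat \<Rightarrow> int \<Rightarrow> int \<Rightarrow> real" where
  "res_kernel2 \<theta> N x y = (\<Sum>z\<in>Lam N. res_kernel \<theta> N x z * res_kernel \<theta> N z y)"

lemma smooth_smooth: "smooth \<theta> N (smooth \<theta> N f) x = (\<Sum>y\<in>Lam N. res_kernel2 \<theta> N x y * f y)"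
proof -
  have "smooth \<theta> N (smooth \<theta> N f) x = (\<Sum>z\<in>Lam N. \<Sum>y\<in>Lam N. res_kernel \<theta> N x z * (res_kernel \<theta> N z y * f y))"
    by (simp add: smooth_def sum_distrib_left)
  also have "\<dots> = (\<Sum>y\<in>Lam N. \<Sum>z\<in>Lam N. res_kernel \<theta> N x z * (res_kernel \<theta> N z y * f y))"
    by (rule sum.swap)
  finally show ?thesis unfolding res_kernel2_def sum_distrib_right by (simp only: mult.assoc)
qed

lemma sum_Lam_uminus: "(\<Sum>x\<in>Lam N. f (- x)) = (\<Sum>x\<in>Lam N. f x)"
  by (rule sum.reindex_bij_witness[of _ uminus uminus]) (auto simp: Lam_def)

lemma res_kernel2_uminus: "res_kernel2 \<theta> N (- x) (- y) = res_kernel2 \<theta> N x y"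
proof -
  have "res_kernel2 \<theta> N (- x) (- y) = (\<Sum>z\<in>Lam N. res_kernel \<theta> N (- x) (- z) * res_kernel \<theta> N (- z) (- y))"
    unfolding res_kernel2_def by (rule sum_Lam_uminus[symmetric])
  then show ?thesis by (simp add: res_kernel_uminus res_kernel2_def)
qed

lemma res_kernel2_nonneg: "\<theta> > 0 \<Longrightarrow> 0 \<le> res_kernel2 \<theta> N x y"
  unfolding res_kernel2_def by (intro sum_nonneg mult_nonneg_nonneg res_kernel_nonneg)

lemma res_kernel2_sum:
  assumes "\<theta> > 0" "x \<in> Lam N" "N \<ge> 1"
  shows "(\<Sum>y\<in>Lam N. res_kernel2 \<theta> N x y) = 1"
  using smooth_smooth[of \<theta> N "\<lambda>_. 1" x] res_kernel_sum(2)[OF assms(1) _ assms(3)] assms(2)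
  by (simp add: smooth_def)

lemma res_kernel2_le:
  assumes "0 < \<theta>" "\<theta> \<le> 1" "\<theta> * real N \<ge> 1" "x \<in> Lam N" "y \<in> Lam N" "N \<ge> 1"
  shows "res_kernel2 \<theta> N x y \<le> 4 * \<theta>"
proof -
  have "res_kernel2 \<theta> N x y \<le> (\<Sum>z\<in>Lam N. res_kernel \<theta> N x z * (4 * \<theta>))"
    unfolding res_kernel2_def using assms
    by (intro sum_mono mult_left_mono res_kernel_le res_kernel_nonneg) auto
  then show ?thesis using res_kernel_sum(2)[OF assms(1,4,6)] by (simp add: sum_distrib_right[symmetric])
qed

text \<open>The mean displacements of two resolvent steps add up. The point \<open>x'\<close> may
  differ from \<open>x\<close> because every reservoir site is compared with one average centred at
  the end.\<close>

lemma res_kernel2_first_moment: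
  assumes "0 < \<theta>" "\<theta> \<le> 1" "x \<in> Lam N" "N \<ge> 1"
  shows "(\<Sum>y\<in>Lam N. res_kernel2 \<theta> N x y * \<bar>real_of_int (x' - y)\<bar>) \<le> \<bar>real_of_int (x' - x)\<bar> + 3 / \<theta>"
proof -
  have z: "smooth \<theta> N (\<lambda>y. \<bar>real_of_int (x' - y)\<bar>) z \<le> \<bar>real_of_int (x' - z)\<bar> + 3 / (2 * \<theta>)"
    if z: "z \<in> Lam N" for z x'
  proof -
    have "smooth \<theta> N (\<lambda>y. \<bar>real_of_int (x' - y)\<bar>) z
       \<le> (\<Sum>y\<in>Lam N. res_kernel \<theta> N z y * (\<bar>real_of_int (x' - z)\<bar> + \<bar>real_of_int (y - z)\<bar>))"
      unfolding smooth_def by (intro sum_mono mult_left_mono res_kernel_nonneg assms) auto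
    also have "\<dots> = \<bar>real_of_int (x' - z)\<bar> + (\<Sum>y\<in>Lam N. res_kernel \<theta> N z y * \<bar>real_of_int (y - z)\<bar>)"
      using res_kernel_sum(2)[OF assms(1) z assms(4)]
      by (simp add: distrib_left sum.distrib sum_distrib_right[symmetric])
    finally show ?thesis using res_kernel_first_moment[OF assms(1,2) z assms(4)] by simp
  qed
  have "(\<Sum>y\<in>Lam N. res_kernel2 \<theta> N x y * \<bar>real_of_int (x' - y)\<bar>)
      = smooth \<theta> N (smooth \<theta> N (\<lambda>y. \<bar>real_of_int (x' - y)\<bar>)) x"
    by (simp add: smooth_smooth)
  also have "\<dots> \<le> smooth \<theta> N (\<lambda>z. \<bar>real_of_int (x' - z)\<bar> + 3 / (2 * \<theta>)) x"
    unfolding smooth_def[of \<theta> N _ x] by (intro sum_mono mult_left_mono z res_kernel_nonneg assms)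
  also have "\<dots> = smooth \<theta> N (\<lambda>z. \<bar>real_of_int (x' - z)\<bar>) x + 3 / (2 * \<theta>)"
    using res_kernel_sum(2)[OF assms(1,3,4)]
    by (simp add: smooth_def distrib_left sum.distrib sum_distrib_right[symmetric] sum_divide_distrib[symmetric])
  also have "\<dots> \<le> \<bar>real_of_int (x' - x)\<bar> + 3 / (2 * \<theta>) + 3 / (2 * \<theta>)"
    using z[OF assms(3), of x'] by simp
  finally show ?thesis using assms(1) by (simp add: field_simps)
qed

context stationary_state
begin

text \<open>These constants collect errors in units of \<open>e\<close>:
  \<open>19 + 6 * real K\<close> is \<delta> plus \<open>averaging_error\<close>,
  \<open>8 * real K\<close> the coinciding sites, 3 the smoothing of the profile; 12,
  \<open>12 * real K\<close> and 2 are the exchange correction, the oscillation \<tau> and the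
  flips. None depends on \<open>N\<close>.\<close>

definition boundary_const :: real where
  "boundary_const = 2 * real K * (equicont_const K * (19 + 6 * real K) + 8 * real K) + 3"

definition energy_const :: real where
  "energy_const = 12 + 2 * j * (12 * real K + 2) + 2 * j * boundary_const"

definition deviation_const :: "real \<Rightarrow> real" where
  "deviation_const a = 4 * energy_const + 4 * (energy_const / (j * a ^ (K - 1))) + 36"

lemma deviation_const_nonneg:
  assumes "0 < a" shows "0 \<le> deviation_const a"
proof -
  have "0 \<le> boundary_const" using equicont_const_nonneg by (simp add: boundary_const_def)
  then have "0 \<le> energy_const" using j_pos by (simp add: energy_const_def)
  then show ?thesis using assms j_pos by (simp add: deviation_const_def)
qed

definition factor_const :: "real \<Rightarrow> nat \<Rightarrow> real" where
  "factor_const a k = 10 * equicont_const k + 4 * real k + (deviation_const a + 1) / 2 + 2"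

text \<open>All scales are powers of \<open>e = N powr (- 1 / 8)\<close>. The resolvent parameter is \<open>e ^ 6\<close>, so smoothing acts
  on the macroscopic length \<open>1 / (e ^ 6 * N) = e\<^sup>2\<close>; the equicontinuity estimate is used with \<open>\<delta> = e\<close>.\<close>
context
  fixes a e :: real
  assumes a: "0 < a" "a \<le> 1" "a = j * (1 - a ^ K) + 1 / 2"
    and e: "0 < e" "real N * e ^ 8 = 1" "2 * real K * e ^ 7 \<le> 1"
begin

section \<open>Scales, profile and boundary weights\<close>

lemma e_le: "e \<le> 1"
proof -
  have "1 * e ^ 7 \<le> 2 * real K * e ^ 7" using K_pos e by (intro mult_right_mono) auto
  then have "e ^ 7 \<le> 1 ^ 7" using e(3) by (simp only: mult_1 power_one)
  then show ?thesis using e power_le_imp_le_base[of e 6 1] by simp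
qed

lemma e_power_le: "n \<ge> 1 \<Longrightarrow> e ^ n \<le> e"
  using e e_le power_decreasing[of 1 n e] by simp

lemma N_eq: "real N = 1 / e ^ 8"
  using e by (simp add: field_simps)

lemma a_ge: "1 / 2 \<le> a"
proof -
  have "0 \<le> j * (1 - a ^ K)" using a j_pos by (intro mult_nonneg_nonneg) (auto intro: power_le_one)
  then show ?thesis using a(3) by linarith
qed

lemma profile_eq: "profile a x = (a - 1 / 2) / real N * real_of_int x + 1 / 2"
proof -
  have "j * (1 - a ^ K) = a - 1 / 2" using a by linarith
  then show ?thesis unfolding profile_def by (simp only:)
qed

lemma profile_Lip: "\<bar>profile a x - profile a y\<bar> \<le> 1 / real N * \<bar>real_of_int (x - y)\<bar>"
proof -
  have "profile a x - profile a y = (a - 1 / 2) / real N * real_of_int (x - y)"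
    by (simp add: profile_eq algebra_simps diff_divide_distrib)
  also have "\<bar>\<dots>\<bar> = \<bar>(a - 1 / 2) / real N\<bar> * \<bar>real_of_int (x - y)\<bar>" by (rule abs_mult)
  also have "\<dots> \<le> 1 / real N * \<bar>real_of_int (x - y)\<bar>"
    using a a_ge by (intro mult_right_mono) (auto simp: abs_divide intro!: divide_right_mono)
  finally show ?thesis .
qed

lemma profile_01: "x \<in> Lam N \<Longrightarrow> 0 \<le> profile a x \<and> profile a x \<le> 1"
proof -
  assume x: "x \<in> Lam N"
  then have "\<bar>x\<bar> \<le> int N" by (auto simp: Lam_def)
  then have "real_of_int \<bar>x\<bar> \<le> real_of_int (int N)" by (simp only: of_int_le_iff)
  then have x: "\<bar>real_of_int x / real N\<bar> \<le> 1" using N_pos by (simp add: abs_divide)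
  have "\<bar>(a - 1 / 2) * (real_of_int x / real N)\<bar> \<le> 1 / 2 * 1"
    unfolding abs_mult using a a_ge x by (intro mult_mono) auto
  moreover have "profile a x = (a - 1 / 2) * (real_of_int x / real N) + 1 / 2" by (simp add: profile_eq)
  ultimately show ?thesis unfolding abs_le_iff by linarith
qed

lemma profile_uminus: "profile a (- x) = 1 - profile a x"
  by (simp add: profile_eq)

lemma profile_N: "profile a (int N) = a"
  using N_pos by (simp add: profile_eq)

abbreviation "\<theta> \<equiv> e ^ 6"
abbreviation "energy \<eta> \<equiv> \<Sum>b\<in>bonds N. (smooth \<theta> N (deviation a \<eta>) (b + 1) - smooth \<theta> N (deviation a \<eta>) b)\<^sup>2"
abbreviation "G \<equiv> res_kernel2 \<theta> N (int N)"

lemma scale_bounds: "0 < \<theta>" "\<theta> \<le> 1" "\<theta> * real N \<ge> 1" "\<theta> \<le> e"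
proof -
  show "0 < \<theta>" "\<theta> \<le> 1" "\<theta> \<le> e" using e e_le e_power_le[of 6] by auto
  have "\<theta> * real N = 1 / e ^ 2" using e by (simp add: N_eq field_simps flip: power_add)
  then show "\<theta> * real N \<ge> 1" using e e_le by (simp add: power_le_one)
qed

lemma ends_in_Lam: "int N \<in> Lam N" "- int N \<in> Lam N"
  by (auto simp: Lam_def)

text \<open>\<open>e * real N\<close> equals \<open>1 / e ^ 7\<close>, so the third assumption on
  \<open>e\<close> says that \<delta> = \<open>e\<close> is admissible in the equicontinuity
  estimate.\<close>

lemma delta_admissible: "2 * real K \<le> e * real N"
proof -
  have "e * real N = 1 / e ^ 7" using e by (simp add: N_eq field_simps flip: power_Suc)
  then have "2 * real K = (2 * real K * e ^ 7) * (e * real N)" using e by simp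
  also have "\<dots> \<le> 1 * (e * real N)" using e by (intro mult_right_mono) auto
  finally show ?thesis by simp
qed

lemma averaging_error: "6 * (real K + 3 / \<theta>) / (e * real N) \<le> (6 * real K + 18) * e"
proof -
  have "6 * (real K + 3 / \<theta>) / (e * real N) = 6 * real K * e ^ 7 + 18 * e"
    using e by (simp add: N_eq field_simps flip: power_Suc power_add)
  also have "\<dots> \<le> 6 * real K * e + 18 * e"
    using e_power_le[of 7] by (intro add_mono mult_left_mono) auto
  finally show ?thesis by (simp add: algebra_simps)
qed

lemma G_kernel:
  "\<And>y. y \<in> Lam N \<Longrightarrow> 0 \<le> G y" "(\<Sum>y\<in>Lam N. G y) = 1" "\<And>y. y \<in> Lam N \<Longrightarrow> G y \<le> 4 * e"
  using scale_bounds ends_in_Lam N_pos res_kernel2_nonneg res_kernel2_sum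
  by (auto intro!: order_trans[OF res_kernel2_le])

lemma G_moment:
  assumes "x \<in> I_plus K N"
  shows "(\<Sum>y\<in>Lam N. G y * \<bar>real_of_int (x - y)\<bar>) \<le> real K + 3 / \<theta>"
proof -
  have "\<bar>x - int N\<bar> \<le> int K" using assms by (auto simp: I_plus_def)
  then have "real_of_int \<bar>x - int N\<bar> \<le> real_of_int (int K)" by (simp only: of_int_le_iff)
  then show ?thesis using res_kernel2_first_moment[OF scale_bounds(1,2) ends_in_Lam(1) N_pos, of x] by simp
qed

text \<open>The profile changes by at most \<open>1 / N\<close> per site and \<open>G\<close>
  reaches at most \<open>3 / \<theta>\<close> sites on average, a macroscopic distance
  \<open>3 * e ^ 2\<close>.\<close>

lemma G_profile: "\<bar>a - (\<Sum>y\<in>Lam N. G y * profile a y)\<bar> \<le> 3 * e"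
proof -
  have "a - (\<Sum>y\<in>Lam N. G y * profile a y) = (\<Sum>y\<in>Lam N. G y * (profile a (int N) - profile a y))"
    using G_kernel(2) by (simp add: profile_N right_diff_distrib sum_subtractf sum_distrib_right[symmetric])
  also have "\<bar>\<dots>\<bar> \<le> (\<Sum>y\<in>Lam N. \<bar>G y * (profile a (int N) - profile a y)\<bar>)" by (rule sum_abs)
  also have "\<dots> \<le> (\<Sum>y\<in>Lam N. G y * (1 / real N * \<bar>real_of_int (int N - y)\<bar>))"
    unfolding abs_mult using G_kernel(1) by (intro sum_mono mult_mono profile_Lip) auto
  also have "\<dots> = 1 / real N * (\<Sum>y\<in>Lam N. G y * \<bar>real_of_int (int N - y)\<bar>)"
    unfolding sum_distrib_left by (intro sum.cong refl) simp
  also have "\<dots> \<le> 1 / real N * (\<bar>real_of_int (int N - int N)\<bar> + 3 / \<theta>)"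
    by (intro mult_left_mono res_kernel2_first_moment scale_bounds ends_in_Lam N_pos) auto
  also have "\<dots> = 3 * e ^ 2" using e by (simp add: N_eq field_simps flip: power_add)
  also have "\<dots> \<le> 3 * e" using e_power_le[of 2] by simp
  finally show ?thesis .
qed

lemma boundary_term_lower_bound:
  fixes Z :: "int \<Rightarrow> config \<Rightarrow> real"
  assumes Z: "\<And>\<eta> x. \<eta> \<in> configs N \<Longrightarrow> x \<in> Lam N \<Longrightarrow> Z x \<eta> = 0 \<or> Z x \<eta> = 1"
    and eqc: "\<And>A y z. A \<subseteq> Lam N \<Longrightarrow> card A \<le> K \<Longrightarrow> y \<in> Lam N - A \<Longrightarrow> z \<in> Lam N - A \<Longrightarrow>
       \<bar>E (\<lambda>\<eta>. (\<Prod>x\<in>A. Z x \<eta>) * (Z y \<eta> - Z z \<eta>))\<bar> \<le> equicont_const K * (e + 6 * \<bar>real_of_int (y - z)\<bar> / (e * real N))"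
  shows "a ^ (K - 1) * E (\<lambda>\<eta>. ((\<Sum>y\<in>Lam N. G y * Z y \<eta>) - a)\<^sup>2) - boundary_const * e
    \<le> E (\<lambda>\<eta>. ((\<Prod>x\<in>I_plus K N. Z x \<eta>) - a ^ K) * ((\<Sum>y\<in>Lam N. G y * Z y \<eta>) - (\<Sum>y\<in>Lam N. G y * profile a y)))"
proof -
  let ?b = "\<Sum>y\<in>Lam N. G y * profile a y"
  have "equicont_const K * (e + 6 * (real K + 3 / \<theta>) / (e * real N)) + 2 * real K * (4 * e)
      \<le> equicont_const K * ((19 + 6 * real K) * e) + 2 * real K * (4 * e)"
  proof (intro add_right_mono mult_left_mono equicont_const_nonneg)
    have "(19 + 6 * real K) * e = e + (6 * real K + 18) * e" by (simp add: algebra_simps)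
    then show "e + 6 * (real K + 3 / \<theta>) / (e * real N) \<le> (19 + 6 * real K) * e" using averaging_error by linarith
  qed
  then have "2 * real K * (equicont_const K * (e + 6 * (real K + 3 / \<theta>) / (e * real N)) + 2 * real K * (4 * e)) + \<bar>a - ?b\<bar>
     \<le> 2 * real K * (equicont_const K * ((19 + 6 * real K) * e) + 2 * real K * (4 * e)) + 3 * e"
    by (intro add_mono[OF mult_left_mono G_profile]) auto
  also have "\<dots> = boundary_const * e" by (simp add: boundary_const_def algebra_simps)
  finally show ?thesis
    using boundary_lower_bound[OF Z eqc equicont_const_nonneg e(1) G_kernel I_plus_subset _ G_moment, of a ?b] a
    by (simp add: I_plus_def)
qed

text \<open>With both boundary bounds inserted, \<open>dissipation\<close> bounds a sum of three
  nonnegative terms, the energy and the mean squared error of the local density at either end; so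
  each of them is small.\<close>

lemma energy_bound:
  "real N * E energy \<le> energy_const * e"
  "E (\<lambda>\<eta>. ((\<Sum>y\<in>Lam N. G y * \<eta> y) - a)\<^sup>2) \<le> energy_const / (j * a ^ (K - 1)) * e"
proof -
  let ?b = "\<Sum>y\<in>Lam N. G y * profile a y"
  let ?\<psi> = "\<lambda>\<eta>. smooth \<theta> N (smooth \<theta> N (deviation a \<eta>))"
  let ?V = "E (\<lambda>\<eta>. ((\<Sum>y\<in>Lam N. G y * \<eta> y) - a)\<^sup>2)"
  let ?V' = "E (\<lambda>\<eta>. ((\<Sum>y\<in>Lam N. G y * (1 - \<eta> (- y))) - a)\<^sup>2)"
  have \<psi>p: "?\<psi> \<eta> (int N) = (\<Sum>y\<in>Lam N. G y * \<eta> y) - ?b" for \<eta>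
    by (simp add: smooth_smooth deviation_def right_diff_distrib sum_subtractf)
  \<comment> \<open>As \<open>profile a (- x) = 1 - profile a x\<close>, reflection with
    particle-hole exchange reproduces the right end up to the sign with which the left term enters
    \<open>dissipation\<close>.\<close>
  have \<psi>m: "?\<psi> \<eta> (- int N) = - ((\<Sum>y\<in>Lam N. G y * (1 - \<eta> (- y))) - ?b)" for \<eta>
  proof -
    have "?\<psi> \<eta> (- int N) = (\<Sum>y\<in>Lam N. res_kernel2 \<theta> N (- int N) (- y) * deviation a \<eta> (- y))"
      unfolding smooth_smooth by (rule sum_Lam_uminus[symmetric])
    also have "\<dots> = (\<Sum>y\<in>Lam N. - (G y * (1 - \<eta> (- y)) - G y * profile a y))"
      by (intro sum.cong refl) (simp add: res_kernel2_uminus deviation_def profile_uminus algebra_simps)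
    finally show ?thesis by (simp add: sum_negf sum_subtractf)
  qed
  have Im: "(\<Prod>x\<in>I_minus K N. 1 - \<eta> x) = (\<Prod>x\<in>I_plus K N. 1 - \<eta> (- x))" for \<eta> :: config
    by (rule prod.reindex_bij_witness[of _ uminus uminus]) (auto simp: I_minus_def I_plus_def)
  have p: "a ^ (K - 1) * ?V - boundary_const * e
      \<le> E (\<lambda>\<eta>. ((\<Prod>x\<in>I_plus K N. \<eta> x) - a ^ K) * ?\<psi> \<eta> (int N))"
    unfolding \<psi>p
    by (rule boundary_term_lower_bound[of "\<lambda>x \<eta>. \<eta> x"], rule configs_cases, assumption+,
        rule occupied_equicontinuous, use delta_admissible e e_le in auto)
  have m: "a ^ (K - 1) * ?V' - boundary_const * e
      \<le> - E (\<lambda>\<eta>. ((\<Prod>x\<in>I_minus K N. 1 - \<eta> x) - a ^ K) * ?\<psi> \<eta> (- int N))"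
  proof -
    have "a ^ (K - 1) * ?V' - boundary_const * e
      \<le> E (\<lambda>\<eta>. ((\<Prod>x\<in>I_plus K N. 1 - \<eta> (- x)) - a ^ K) * ((\<Sum>y\<in>Lam N. G y * (1 - \<eta> (- y))) - ?b))"
    proof (rule boundary_term_lower_bound[of "\<lambda>x \<eta>. 1 - \<eta> (- x)"])
      show "1 - \<eta> (- x) = 0 \<or> 1 - \<eta> (- x) = 1" if "\<eta> \<in> configs N" "x \<in> Lam N" for \<eta> x
        using configs_cases[OF that(1), of "- x"] that(2) by (auto simp: Lam_def)
    qed (rule vacant_equicontinuous, use delta_admissible e e_le in auto)
    also have "\<dots> = - E (\<lambda>\<eta>. ((\<Prod>x\<in>I_minus K N. 1 - \<eta> x) - a ^ K) * ?\<psi> \<eta> (- int N))"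
      unfolding \<psi>m Im mult_minus_right by (simp only: Bochner_Integration.integral_minus minus_minus)
    finally show ?thesis .
  qed
  have rr: "res_rate \<theta> \<le> 2 * e ^ 12" "0 < res_rate \<theta>"
    using res_rate_bounds(2)[OF scale_bounds(1,2)] res_rate_pos[OF scale_bounds(1)] by (simp_all flip: power_mult)
  have N3: "2 * real N + 1 \<le> 3 * real N" using N_pos by simp
  have q1: "2 * real N * res_rate \<theta> * (2 * real N + 1) * \<theta> \<le> 12 * e"
  proof -
    have "2 * real N * res_rate \<theta> * (2 * real N + 1) * \<theta> \<le> 2 * real N * (2 * e ^ 12) * (3 * real N) * \<theta>"
      using rr N3 scale_bounds e by (intro mult_mono mult_nonneg_nonneg) auto
    also have "\<dots> = 12 * e ^ 2" using e by (simp add: N_eq field_simps flip: power_add)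
    also have "\<dots> \<le> 12 * e" using e_power_le[of 2] by simp
    finally show ?thesis .
  qed
  have q2: "sqrt (real K * (2 * res_rate \<theta> * (2 * real N + 1))) \<le> 12 * real K * e"
  proof (rule real_le_lsqrt)
    have "real K * (2 * res_rate \<theta> * (2 * real N + 1)) \<le> real K * (2 * (2 * e ^ 12) * (3 * real N))"
      using rr N3 e by (intro mult_mono mult_nonneg_nonneg) auto
    also have "\<dots> = 12 * real K * e ^ 4" using e by (simp add: N_eq field_simps flip: power_add)
    also have "\<dots> \<le> 12 * real K * e ^ 2" using e e_le by (intro mult_left_mono power_decreasing) auto
    \<comment> \<open>Crude, but it completes a square, so that the root needs no further
      estimate.\<close>
    also have "\<dots> \<le> (12 * real K)\<^sup>2 * e ^ 2"
    proof (rule mult_right_mono)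
      have "12 * real K * 1 \<le> 12 * real K * (12 * real K)" using K_pos by (intro mult_left_mono) auto
      then show "12 * real K \<le> (12 * real K)\<^sup>2" by (simp add: power2_eq_square)
    qed simp
    finally show "real K * (2 * res_rate \<theta> * (2 * real N + 1)) \<le> (12 * real K * e)\<^sup>2"
      by (simp add: power_mult_distrib)
  qed (use e in auto)
  have q3: "2 * j * (sqrt (real K * (2 * res_rate \<theta> * (2 * real N + 1))) + 2 * \<theta>) \<le> 2 * j * (12 * real K * e + 2 * e)"
    using q2 scale_bounds j_pos by (intro mult_left_mono add_mono) auto
  have p': "j * (a ^ (K - 1) * ?V) - j * (boundary_const * e) \<le> j * E (\<lambda>\<eta>. ((\<Prod>x\<in>I_plus K N. \<eta> x) - a ^ K) * ?\<psi> \<eta> (int N))"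
    using mult_left_mono[OF p, of j] j_pos by (simp add: right_diff_distrib)
  have m': "j * (a ^ (K - 1) * ?V') - j * (boundary_const * e) \<le> - (j * E (\<lambda>\<eta>. ((\<Prod>x\<in>I_minus K N. 1 - \<eta> x) - a ^ K) * ?\<psi> \<eta> (- int N)))"
    using mult_left_mono[OF m, of j] j_pos by (simp add: right_diff_distrib)
  have main: "real N * E energy + j * (a ^ (K - 1) * ?V) + j * (a ^ (K - 1) * ?V') \<le> energy_const * e"
  proof -
    have "real N * E energy + j * (a ^ (K - 1) * ?V) + j * (a ^ (K - 1) * ?V')
       \<le> 12 * e + 2 * j * (12 * real K * e + 2 * e) + j * (boundary_const * e) + j * (boundary_const * e)"
      using dissipation[OF scale_bounds(1-3) profile_01] p' m' q1 q3 by linarith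
    also have "\<dots> = energy_const * e" by (simp add: energy_const_def algebra_simps)
    finally show ?thesis .
  qed
  have pos: "0 < j * a ^ (K - 1)" using a j_pos by simp
  have "0 \<le> ?V" "0 \<le> ?V'" "0 \<le> E energy" by (rule Bochner_Integration.integral_nonneg; simp add: sum_nonneg)+
  then have nn: "0 \<le> j * (a ^ (K - 1) * ?V)" "0 \<le> j * (a ^ (K - 1) * ?V')" "0 \<le> real N * E energy"
    using a j_pos by auto
  show "real N * E energy \<le> energy_const * e" using main nn by linarith
  have "(j * a ^ (K - 1)) * ?V \<le> energy_const * e" using main nn by (simp add: mult.assoc)
  then show "?V \<le> energy_const / (j * a ^ (K - 1)) * e" using pos by (simp add: field_simps)
qed

text \<open>The energy controls oscillations only; the density at the right end supplies the
  additive constant. In one dimension a path across the whole box costs just a factor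
  \<open>2 * real N\<close> on the energy, which \<open>energy_bound\<close> covers.\<close>

lemma smoothed_deviation:
  assumes z: "z \<in> Lam N"
  shows "E (\<lambda>\<eta>. \<bar>smooth \<theta> N (deviation a \<eta>) z\<bar>) \<le> (deviation_const a + 1) / 2 * sqrt e"
proof -
  let ?b = "\<Sum>y\<in>Lam N. G y * profile a y"
  let ?\<phi> = "\<lambda>\<eta>. smooth \<theta> N (deviation a \<eta>)"
  let ?V = "\<lambda>\<eta>. ((\<Sum>y\<in>Lam N. G y * \<eta> y) - a)\<^sup>2"
  have pw: "(?\<phi> \<eta> z)\<^sup>2 \<le> 4 * real N * energy \<eta> + 4 * ?V \<eta> + 36 * e" for \<eta>
  proof -
    let ?\<psi> = "smooth \<theta> N (?\<phi> \<eta>) (int N)"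
    have energy_nonneg: "0 \<le> energy \<eta>" by (intro sum_nonneg) auto
    have "\<bar>?\<psi> - ?\<phi> \<eta> z\<bar> \<le> sqrt (2 * real N * energy \<eta>)"
    proof (rule smooth_bound[OF scale_bounds(1) ends_in_Lam(1) N_pos])
      fix y assume y: "y \<in> Lam N"
      have "\<bar>y - z\<bar> \<le> 2 * int N" using y z by (auto simp: Lam_def)
      then have "real_of_int \<bar>y - z\<bar> \<le> real_of_int (2 * int N)" by (simp only: of_int_le_iff)
      then have "(?\<phi> \<eta> y - ?\<phi> \<eta> z)\<^sup>2 \<le> 2 * real N * energy \<eta>"
        using path_energy[OF y z, of "?\<phi> \<eta>"] energy_nonneg by (elim order_trans) (intro mult_right_mono; simp)
      then show "\<bar>?\<phi> \<eta> y - ?\<phi> \<eta> z\<bar> \<le> sqrt (2 * real N * energy \<eta>)"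
        by (intro real_le_rsqrt) simp
    qed
    then have "(?\<psi> - ?\<phi> \<eta> z)\<^sup>2 \<le> (sqrt (2 * real N * energy \<eta>))\<^sup>2"
      by (intro abs_le_square_iff[THEN iffD1]) (use energy_nonneg in simp)
    then have 1: "(?\<psi> - ?\<phi> \<eta> z)\<^sup>2 \<le> 2 * real N * energy \<eta>" using energy_nonneg by simp
    have sq: "(u + v)\<^sup>2 \<le> 2 * u\<^sup>2 + 2 * v\<^sup>2" for u v :: real
      using sum_squares_bound[of u v] by (simp add: power2_sum)
    have "?\<psi> = ((\<Sum>y\<in>Lam N. G y * \<eta> y) - a) + (a - ?b)"
      by (simp add: smooth_smooth deviation_def right_diff_distrib sum_subtractf)
    then have "?\<psi>\<^sup>2 \<le> 2 * ?V \<eta> + 2 * (a - ?b)\<^sup>2" using sq by (simp only:)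
    moreover have "(a - ?b)\<^sup>2 \<le> 9 * e"
    proof -
      have "(a - ?b)\<^sup>2 \<le> (3 * e)\<^sup>2" using G_profile e by (intro abs_le_square_iff[THEN iffD1]) simp
      also have "\<dots> \<le> 9 * e" using e_power_le[of 2] by (simp add: power_mult_distrib)
      finally show ?thesis .
    qed
    ultimately have 2: "?\<psi>\<^sup>2 \<le> 2 * ?V \<eta> + 18 * e" by linarith
    have "(?\<phi> \<eta> z)\<^sup>2 \<le> 2 * (?\<psi> - ?\<phi> \<eta> z)\<^sup>2 + 2 * ?\<psi>\<^sup>2"
      using sq[of "?\<phi> \<eta> z - ?\<psi>" ?\<psi>] by (simp add: power2_commute)
    then show ?thesis using 1 2 by linarith
  qed
  have "E (\<lambda>\<eta>. (?\<phi> \<eta> z)\<^sup>2) \<le> E (\<lambda>\<eta>. 4 * real N * energy \<eta> + 4 * ?V \<eta> + 36 * e)"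
    by (intro E_mono pw)
  also have "\<dots> = 4 * (real N * E energy) + 4 * E ?V + 36 * e" by simp
  also have "\<dots> \<le> 4 * (energy_const * e) + 4 * (energy_const / (j * a ^ (K - 1)) * e) + 36 * e"
    using energy_bound by (intro add_mono mult_left_mono) auto
  also have "\<dots> = deviation_const a * e" by (simp add: deviation_const_def algebra_simps)
  finally have 1: "E (\<lambda>\<eta>. (?\<phi> \<eta> z)\<^sup>2) \<le> deviation_const a * e" .
  have s: "sqrt e > 0" using e by simp
  \<comment> \<open>Young's inequality weighted by \<open>sqrt e\<close>, the order of the root of
    the second moment.\<close>
  have amgm: "\<bar>u\<bar> \<le> 1 / (2 * sqrt e) * u\<^sup>2 + sqrt e / 2" for u :: real
  proof -
    have "(\<bar>u\<bar> - sqrt e)\<^sup>2 = u\<^sup>2 + e - 2 * sqrt e * \<bar>u\<bar>" using e by (simp add: power2_diff)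
    then have "2 * sqrt e * \<bar>u\<bar> \<le> u\<^sup>2 + e" using zero_le_power2[of "\<bar>u\<bar> - sqrt e"] by linarith
    then show ?thesis using s e by (simp add: field_simps power2_eq_square)
  qed
  have "E (\<lambda>\<eta>. \<bar>?\<phi> \<eta> z\<bar>) \<le> E (\<lambda>\<eta>. 1 / (2 * sqrt e) * (?\<phi> \<eta> z)\<^sup>2 + sqrt e / 2)"
    by (intro E_mono amgm)
  also have "\<dots> = 1 / (2 * sqrt e) * E (\<lambda>\<eta>. (?\<phi> \<eta> z)\<^sup>2) + sqrt e / 2" by simp
  also have "\<dots> \<le> 1 / (2 * sqrt e) * (deviation_const a * (sqrt e * sqrt e)) + sqrt e / 2"
    using 1 s e by (intro add_mono mult_left_mono) auto
  also have "\<dots> = (deviation_const a + 1) / 2 * sqrt e"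
  proof -
    have "1 / (2 * r) * (d * (r * r)) + r / 2 = (d + 1) / 2 * r" if "r > 0" for r d :: real
      using that by (simp add: field_simps)
    then show ?thesis using s by blast
  qed
  finally show ?thesis .
qed

text \<open>Splits \<open>\<eta> x - profile a x\<close> into three parts: \<open>\<eta> x\<close>
  minus its average, small by equicontinuity even against the product over \<open>S\<close>; the
  smoothed deviation, small in mean; and the smoothing error of the profile.\<close>

lemma single_factor:
  assumes S: "S \<subseteq> Lam N" "card S \<le> k" and x: "x \<in> Lam N" "x \<notin> S"
  shows "\<bar>E (\<lambda>\<eta>. (\<Prod>x\<in>S. \<eta> x) * (\<eta> x - profile a x))\<bar> \<le> factor_const a k * sqrt e"
proof -
  let ?P = "\<lambda>\<eta>::config. \<Prod>x\<in>S. \<eta> x"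
  let ?R = "res_kernel \<theta> N x"
  let ?\<phi> = "\<lambda>\<eta>. smooth \<theta> N (deviation a \<eta>) x"
  have s: "e \<le> sqrt e" using e e_le by (intro real_le_rsqrt) (simp add: power2_eq_square mult_le_one mult_left_le)
  have P01: "\<bar>?P \<eta>\<bar> \<le> 1" if "\<eta> \<in> configs N" for \<eta>
    using prod_01[of S \<eta>] configs_01[OF that] S by (auto simp: abs_le_iff subset_iff)
  have "\<bar>E (\<lambda>\<eta>. (\<Sum>y\<in>Lam N. ?R y * \<eta> y) ^ 0 * ?P \<eta> * (\<eta> x - (\<Sum>y\<in>Lam N. ?R y * \<eta> y)))\<bar>
    \<le> equicont_const k * (e + 6 * (3 / (2 * \<theta>)) / (e * real N)) + real k * (4 * e) + real 0 * (4 * e) + of_bool (x \<in> S)"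
  proof (rule replace_by_average[of "\<lambda>x \<eta>. \<eta> x"])
    show "\<bar>E (\<lambda>\<eta>. (\<Prod>x\<in>A. \<eta> x) * (\<eta> y - \<eta> z))\<bar> \<le> equicont_const k * (e + 6 * \<bar>real_of_int (y - z)\<bar> / (e * real N))"
      if "A \<subseteq> Lam N" "card A \<le> k" "y \<in> Lam N - A" "z \<in> Lam N - A" for A y z
      using that delta_admissible e e_le by (intro occupied_equicontinuous) auto
    show "?R y \<le> 4 * e" if "y \<in> Lam N" for y
      using res_kernel_le[OF scale_bounds(1-3) x(1) that] scale_bounds(4) by simp
    show "(\<Sum>y\<in>Lam N. ?R y * \<bar>real_of_int (x - y)\<bar>) \<le> 3 / (2 * \<theta>)"
      using res_kernel_first_moment[OF scale_bounds(1,2) x(1) N_pos] by (simp add: abs_minus_commute)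
  qed (use S x e configs_cases equicont_const_nonneg res_kernel_nonneg[OF scale_bounds(1)] res_kernel_sum(2)[OF scale_bounds(1) x(1) N_pos] in auto)
  then have 1: "\<bar>E (\<lambda>\<eta>. ?P \<eta> * (\<eta> x - smooth \<theta> N \<eta> x))\<bar> \<le> equicont_const k * (10 * e) + 4 * real k * e"
  proof -
    have "6 * (3 / (2 * \<theta>)) / (e * real N) = 9 * e"
      using e by (simp add: N_eq field_simps flip: power_Suc power_add)
    moreover assume "\<bar>E (\<lambda>\<eta>. (\<Sum>y\<in>Lam N. ?R y * \<eta> y) ^ 0 * ?P \<eta> * (\<eta> x - (\<Sum>y\<in>Lam N. ?R y * \<eta> y)))\<bar>
    \<le> equicont_const k * (e + 6 * (3 / (2 * \<theta>)) / (e * real N)) + real k * (4 * e) + real 0 * (4 * e) + of_bool (x \<in> S)"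
    ultimately show ?thesis using x by (simp add: smooth_def algebra_simps)
  qed
  have 2: "\<bar>E (\<lambda>\<eta>. ?P \<eta> * ?\<phi> \<eta>)\<bar> \<le> (deviation_const a + 1) / 2 * sqrt e"
  proof -
    have "\<bar>E (\<lambda>\<eta>. ?P \<eta> * ?\<phi> \<eta>)\<bar> \<le> E (\<lambda>\<eta>. \<bar>?P \<eta> * ?\<phi> \<eta>\<bar>)" by (rule integral_abs_bound)
    also have "\<dots> \<le> E (\<lambda>\<eta>. \<bar>?\<phi> \<eta>\<bar>)"
      unfolding abs_mult using P01 by (intro E_mono mult_left_le_one_le) auto
    finally show ?thesis using smoothed_deviation[OF x(1)] by linarith
  qed
  have 3: "\<bar>smooth \<theta> N (profile a) x - profile a x\<bar> \<le> 2 * e"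
  proof -
    have "smooth \<theta> N (profile a) x - profile a x = (\<Sum>y\<in>Lam N. ?R y * (profile a y - profile a x))"
      using res_kernel_sum(2)[OF scale_bounds(1) x(1) N_pos]
      by (simp add: smooth_def right_diff_distrib sum_subtractf sum_distrib_right[symmetric])
    also have "\<bar>\<dots>\<bar> \<le> (\<Sum>y\<in>Lam N. \<bar>?R y * (profile a y - profile a x)\<bar>)" by (rule sum_abs)
    also have "\<dots> \<le> (\<Sum>y\<in>Lam N. ?R y * (1 / real N * \<bar>real_of_int (y - x)\<bar>))"
      unfolding abs_mult using res_kernel_nonneg[OF scale_bounds(1)] by (intro sum_mono mult_mono profile_Lip) auto
    also have "\<dots> = 1 / real N * (\<Sum>y\<in>Lam N. ?R y * \<bar>real_of_int (y - x)\<bar>)"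
      unfolding sum_distrib_left by (intro sum.cong refl) simp
    also have "\<dots> \<le> 1 / real N * (3 / (2 * \<theta>))"
      by (intro mult_left_mono res_kernel_first_moment scale_bounds x N_pos) auto
    also have "\<dots> = 3 / 2 * e ^ 2" using e by (simp add: N_eq field_simps flip: power_add)
    also have "\<dots> \<le> 2 * e" using e_power_le[of 2] e by simp
    finally show ?thesis .
  qed
  have 4: "\<bar>E (\<lambda>\<eta>. ?P \<eta> * (smooth \<theta> N (profile a) x - profile a x))\<bar> \<le> 2 * e"
  proof (rule E_abs_le)
    fix \<eta> assume "\<eta> \<in> configs N"
    then have "\<bar>?P \<eta>\<bar> * \<bar>smooth \<theta> N (profile a) x - profile a x\<bar> \<le> 1 * (2 * e)"
      using P01 3 by (intro mult_mono) auto
    then show "\<bar>?P \<eta> * (smooth \<theta> N (profile a) x - profile a x)\<bar> \<le> 2 * e" by (simp add: abs_mult)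
  qed
  have "E (\<lambda>\<eta>. ?P \<eta> * (\<eta> x - profile a x))
     = E (\<lambda>\<eta>. ?P \<eta> * (\<eta> x - smooth \<theta> N \<eta> x) + ?P \<eta> * ?\<phi> \<eta> + ?P \<eta> * (smooth \<theta> N (profile a) x - profile a x))"
    by (intro Bochner_Integration.integral_cong refl)
      (simp add: smooth_def deviation_def right_diff_distrib sum_subtractf algebra_simps)
  also have "\<dots> = E (\<lambda>\<eta>. ?P \<eta> * (\<eta> x - smooth \<theta> N \<eta> x)) + E (\<lambda>\<eta>. ?P \<eta> * ?\<phi> \<eta>)
     + E (\<lambda>\<eta>. ?P \<eta> * (smooth \<theta> N (profile a) x - profile a x))"
    by (simp only: Bochner_Integration.integral_add integrable_pmf)
  finally have "\<bar>E (\<lambda>\<eta>. ?P \<eta> * (\<eta> x - profile a x))\<bar>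
    \<le> equicont_const k * (10 * e) + 4 * real k * e + (deviation_const a + 1) / 2 * sqrt e + 2 * e"
    using 1 2 4 by linarith
  also have "\<dots> \<le> equicont_const k * (10 * sqrt e) + 4 * real k * sqrt e + (deviation_const a + 1) / 2 * sqrt e + 2 * sqrt e"
    using s equicont_const_nonneg deviation_const_nonneg[of a] a by (intro add_mono mult_left_mono) auto
  also have "\<dots> = factor_const a k * sqrt e" by (simp add: factor_const_def algebra_simps)
  finally show ?thesis .
qed

lemma factorization:
  assumes "finite S" "S \<subseteq> Lam N" "card S \<le> k"
  shows "\<bar>corr S - (\<Prod>x\<in>S. profile a x)\<bar> \<le> real (card S) * (factor_const a k * sqrt e)"
  using assms
proof (induction S rule: finite_induct)
  case empty
  then show ?case by (simp add: corr_def)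
next
  case (insert x S)
  have "E (\<lambda>\<eta>. (\<Prod>x\<in>S. \<eta> x) * (\<eta> x - profile a x)) = corr (insert x S) - profile a x * corr S"
    using insert.hyps by (simp add: corr_def right_diff_distrib mult.commute)
  then have 1: "\<bar>corr (insert x S) - profile a x * corr S\<bar> \<le> factor_const a k * sqrt e"
    using single_factor[of S k x] insert by simp
  have px: "0 \<le> profile a x \<and> profile a x \<le> 1" using insert.prems profile_01 by auto
  have "\<bar>profile a x * (corr S - (\<Prod>x\<in>S. profile a x))\<bar> \<le> \<bar>corr S - (\<Prod>x\<in>S. profile a x)\<bar>"
    unfolding abs_mult using px by (intro mult_left_le_one_le) auto
  also have "\<dots> \<le> real (card S) * (factor_const a k * sqrt e)"
    using insert by (intro insert.IH) auto
  finally have "\<bar>profile a x * corr S - profile a x * (\<Prod>x\<in>S. profile a x)\<bar> \<le> real (card S) * (factor_const a k * sqrt e)"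
    by (simp add: right_diff_distrib)
  then have "\<bar>corr (insert x S) - profile a x * (\<Prod>x\<in>S. profile a x)\<bar> \<le> real (card S) * (factor_const a k * sqrt e) + factor_const a k * sqrt e"
    using 1 by linarith
  then show ?case using insert.hyps by (simp add: algebra_simps)
qed

end

end

section \<open>From the semigroup to the generator\<close>

lemma exchange_configs: "\<eta> \<in> configs N \<Longrightarrow> b \<in> bonds N \<Longrightarrow> exchange b \<eta> \<in> configs N"
  by (auto simp: configs_def PiE_iff extensional_def exchange_def Lam_def)

lemma flip_configs: "\<eta> \<in> configs N \<Longrightarrow> x \<in> Lam N \<Longrightarrow> flip x \<eta> \<in> configs N"
  by (auto simp: configs_def PiE_iff extensional_def flip_def)

text \<open>The generator is bounded in the sup norm over configurations, so its iterates grow at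
  most geometrically and the exponential series can be handled termwise.\<close>

lemma generator_bound:
  assumes j: "j > 0" and I: "I_plus K N \<subseteq> Lam N" "I_minus K N \<subseteq> Lam N"
  obtains c where "0 \<le> c"
    "\<And>g m \<eta>. (\<And>\<zeta>. \<zeta> \<in> configs N \<Longrightarrow> \<bar>g \<zeta>\<bar> \<le> m) \<Longrightarrow> \<eta> \<in> configs N \<Longrightarrow> \<bar>generator j K N g \<eta>\<bar> \<le> c * m"
proof
  define c where "c = (real N)\<^sup>2 * (1 / 2 * (\<Sum>b\<in>bonds N. 2)
      + 1 / real N * (j / 2 * (\<Sum>x\<in>I_plus K N. 2) + j / 2 * (\<Sum>x\<in>I_minus K N. 2)))"
  show "0 \<le> c" unfolding c_def using j by (intro mult_nonneg_nonneg add_nonneg_nonneg sum_nonneg) auto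
  fix g :: "config \<Rightarrow> real" and m \<eta>
  assume g: "\<And>\<zeta>. \<zeta> \<in> configs N \<Longrightarrow> \<bar>g \<zeta>\<bar> \<le> m" and \<eta>: "\<eta> \<in> configs N"
  have diff: "\<bar>g \<zeta> - g \<eta>\<bar> \<le> 2 * m" if "\<zeta> \<in> configs N" for \<zeta>
    using g[OF that] g[OF \<eta>] by linarith
  have m: "0 \<le> m" using g[OF \<eta>] by linarith
  have 1: "\<bar>L_0 N g \<eta>\<bar> \<le> 1 / 2 * (\<Sum>b\<in>bonds N. 2 * m)"
    unfolding L_0_def abs_mult
    using diff exchange_configs[OF \<eta>] by (intro mult_mono order_trans[OF sum_abs] sum_mono) auto
  have wt: "\<bar>\<Sum>x\<in>A. D x * (g (flip x \<eta>) - g \<eta>)\<bar> \<le> (\<Sum>x\<in>A. 2 * m)"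
    if "A \<subseteq> Lam N" "\<And>x. x \<in> Lam N \<Longrightarrow> 0 \<le> D x \<and> D x \<le> 1" for A and D :: "int \<Rightarrow> real"
  proof (intro order_trans[OF sum_abs] sum_mono)
    fix x assume "x \<in> A"
    then have "\<bar>D x\<bar> * \<bar>g (flip x \<eta>) - g \<eta>\<bar> \<le> 1 * (2 * m)"
      using that diff[OF flip_configs[OF \<eta>]] m by (intro mult_mono) (auto simp: subset_iff)
    then show "\<bar>D x * (g (flip x \<eta>) - g \<eta>)\<bar> \<le> 2 * m" by (simp add: abs_mult)
  qed
  have 2: "\<bar>L_b_plus j K N g \<eta>\<bar> \<le> j / 2 * (\<Sum>x\<in>I_plus K N. 2 * m)"
    using j mult_left_mono[OF wt[OF I(1) D_plus_01[OF \<eta>]], where c = "j / 2"] by (simp add: L_b_plus_def abs_mult)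
  have 3: "\<bar>L_b_minus j K N g \<eta>\<bar> \<le> j / 2 * (\<Sum>x\<in>I_minus K N. 2 * m)"
    using j mult_left_mono[OF wt[OF I(2) D_minus_01[OF \<eta>]], where c = "j / 2"] by (simp add: L_b_minus_def abs_mult)
  have 4: "\<bar>L_b j K N g \<eta>\<bar> \<le> j / 2 * (\<Sum>x\<in>I_plus K N. 2 * m) + j / 2 * (\<Sum>x\<in>I_minus K N. 2 * m)"
    using 2 3 unfolding L_b_def by linarith
  have "\<bar>L_0 N g \<eta> + 1 / real N * L_b j K N g \<eta>\<bar> \<le> \<bar>L_0 N g \<eta>\<bar> + 1 / real N * \<bar>L_b j K N g \<eta>\<bar>"
    using abs_triangle_ineq[of "L_0 N g \<eta>" "1 / real N * L_b j K N g \<eta>"] by (simp add: abs_mult)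
  also have "\<dots> \<le> 1 / 2 * (\<Sum>b\<in>bonds N. 2 * m)
      + 1 / real N * (j / 2 * (\<Sum>x\<in>I_plus K N. 2 * m) + j / 2 * (\<Sum>x\<in>I_minus K N. 2 * m))"
    using 1 4 by (intro add_mono mult_left_mono) auto
  finally have "\<bar>generator j K N g \<eta>\<bar> \<le> (real N)\<^sup>2 * (1 / 2 * (\<Sum>b\<in>bonds N. 2 * m)
      + 1 / real N * (j / 2 * (\<Sum>x\<in>I_plus K N. 2 * m) + j / 2 * (\<Sum>x\<in>I_minus K N. 2 * m)))"
    unfolding generator_def abs_mult by (intro mult_mono) auto
  also have "\<dots> = c * m"
    unfolding c_def sum_distrib_right[symmetric] by (simp only: distrib_right distrib_left mult.assoc)
  finally show "\<bar>generator j K N g \<eta>\<bar> \<le> c * m" .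
qed

text \<open>Compare the coefficients of \<open>t\<close> in the power series of the invariance identity.\<close>
lemma invariant_measure_stationary:
  assumes j: "j > 0" and I: "I_plus K N \<subseteq> Lam N" "I_minus K N \<subseteq> Lam N"
    and inv: "invariant_measure j K N \<mu>"
  shows "measure_pmf.expectation \<mu> (generator j K N f) = 0"
proof -
  let ?L = "generator j K N"
  let ?E = "measure_pmf.expectation \<mu>"
  have supp: "set_pmf \<mu> \<subseteq> configs N" using inv by (simp add: invariant_measure_def)
  have E_sum: "?E g = (\<Sum>\<eta>\<in>configs N. pmf \<mu> \<eta> * g \<eta>)" for g :: "config \<Rightarrow> real"
    using supp finite_configs by (subst integral_measure_pmf[of "configs N"]) auto
  obtain c where c: "0 \<le> c"
    "\<And>g m \<eta>. (\<And>\<zeta>. \<zeta> \<in> configs N \<Longrightarrow> \<bar>g \<zeta>\<bar> \<le> m) \<Longrightarrow> \<eta> \<in> configs N \<Longrightarrow> \<bar>?L g \<eta>\<bar> \<le> c * m"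
    using generator_bound[OF j I] by metis
  define m where "m = (\<Sum>\<zeta>\<in>configs N. \<bar>f \<zeta>\<bar>)"
  have m0: "0 \<le> m" by (simp add: m_def sum_nonneg)
  have Ln: "\<bar>(?L ^^ n) f \<eta>\<bar> \<le> c ^ n * m" if "\<eta> \<in> configs N" for n \<eta>
    using that
  proof (induction n arbitrary: \<eta>)
    case 0
    then show ?case using finite_configs member_le_sum[of \<eta> "configs N" "\<lambda>\<zeta>. \<bar>f \<zeta>\<bar>"] by (simp add: m_def)
  next
    case (Suc n)
    then show ?case using c(2)[of "(?L ^^ n) f" "c ^ n * m" \<eta>] by (simp add: mult.assoc)
  qed
  have summ: "summable (\<lambda>n. b n * x ^ n / fact n)" if b: "\<And>n. \<bar>b n\<bar> \<le> C * c ^ n" for b :: "nat \<Rightarrow> real" and x C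
  proof (rule summable_comparison_test)
    show "\<exists>n0. \<forall>n\<ge>n0. norm (b n * x ^ n / fact n) \<le> C * (inverse (fact n) * (c * \<bar>x\<bar>) ^ n)"
    proof (intro exI[of _ 0] allI impI)
      fix n
      have "\<bar>b n\<bar> * \<bar>x\<bar> ^ n / fact n \<le> C * c ^ n * \<bar>x\<bar> ^ n / fact n"
        using b by (intro divide_right_mono mult_right_mono) auto
      then show "norm (b n * x ^ n / fact n) \<le> C * (inverse (fact n) * (c * \<bar>x\<bar>) ^ n)"
        by (simp add: abs_mult power_abs power_mult_distrib field_simps)
    qed
    show "summable (\<lambda>n. C * (inverse (fact n) * (c * \<bar>x\<bar>) ^ n))"
      by (intro summable_mult summable_exp)
  qed
  define e where "e n = ?E ((?L ^^ n) f)" for n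
  have e_bound: "\<bar>e n\<bar> \<le> m * c ^ n" for n
  proof -
    have "\<bar>e n\<bar> \<le> (\<Sum>\<eta>\<in>configs N. pmf \<mu> \<eta> * (c ^ n * m))"
      unfolding e_def E_sum
      using Ln by (intro order_trans[OF sum_abs] sum_mono) (simp add: abs_mult mult_left_mono)
    also have "\<dots> = c ^ n * m"
      using sum_pmf_eq_1[OF finite_configs supp] by (simp add: sum_distrib_right[symmetric])
    finally show ?thesis by (simp add: mult.commute)
  qed
  have series: "(\<lambda>n. t ^ n / fact n * e n) sums e 0" if t: "t \<ge> 0" for t
  proof -
    have "(\<lambda>n. t ^ n / fact n * (?L ^^ n) f \<eta>) sums markov_semigroup j K N t f \<eta>" if \<eta>: "\<eta> \<in> configs N" for \<eta>
    proof -
      have "summable (\<lambda>n. (?L ^^ n) f \<eta> * t ^ n / fact n)"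
        using Ln[OF \<eta>] by (intro summ[of _ m]) (simp add: mult.commute)
      then show ?thesis unfolding markov_semigroup_def by (simp add: summable_sums mult.commute)
    qed
    then have "(\<lambda>n. \<Sum>\<eta>\<in>configs N. pmf \<mu> \<eta> * (t ^ n / fact n * (?L ^^ n) f \<eta>)) sums
        (\<Sum>\<eta>\<in>configs N. pmf \<mu> \<eta> * markov_semigroup j K N t f \<eta>)"
      by (intro sums_sum sums_mult)
    moreover have "(\<Sum>\<eta>\<in>configs N. pmf \<mu> \<eta> * markov_semigroup j K N t f \<eta>) = e 0"
      using inv t by (simp add: invariant_measure_def E_sum[symmetric] e_def)
    moreover have "(\<Sum>\<eta>\<in>configs N. pmf \<mu> \<eta> * (t ^ n / fact n * (?L ^^ n) f \<eta>)) = t ^ n / fact n * e n" for n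
      by (simp add: e_def E_sum sum_distrib_left mult_ac)
    ultimately show ?thesis by simp
  qed
  \<comment> \<open>Coefficients of the difference quotient in \<open>t\<close> of the expectation
    of \<open>markov_semigroup j K N t f\<close>; \<open>a 0\<close> is the expectation of the
    generator.\<close>
  define a where "a n = e (Suc n) / fact (Suc n)" for n
  have suma: "summable (\<lambda>n. a n * x ^ n)" for x
  proof -
    have "\<bar>e (Suc n) / real (Suc n)\<bar> \<le> (m * c) * c ^ n" for n
    proof -
      have "\<bar>e (Suc n)\<bar> / real (Suc n) \<le> \<bar>e (Suc n)\<bar> / 1" by (intro divide_left_mono) auto
      also have "\<dots> \<le> m * c ^ Suc n" using e_bound[of "Suc n"] by simp
      finally show ?thesis by (simp add: abs_divide mult_ac)
    qed
    from summ[OF this, of x] show ?thesis by (simp add: a_def field_simps)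
  qed
  define h where "h x = (\<Sum>n. a n * x ^ n)" for x
  have "(h \<longlongrightarrow> a 0) (at 0)"
    by (rule powser_limit_0[of 1]) (use suma in \<open>auto simp: h_def summable_sums\<close>)
  \<comment> \<open>Invariance is available for nonnegative times only, hence the one-sided
    limit.\<close>
  then have lim: "(h \<longlongrightarrow> a 0) (at_right 0)"
    by (rule filterlim_mono) (auto simp: at_le)
  have "h t = 0" if t: "t > 0" for t
  proof -
    have "(\<lambda>n. t ^ Suc n / fact (Suc n) * e (Suc n)) sums (e 0 - t ^ 0 / fact 0 * e 0)"
      using series[of t] t by (subst sums_Suc_iff) simp
    then have "(\<lambda>n. t * (a n * t ^ n)) sums 0" by (simp add: a_def mult_ac)
    moreover have "(\<lambda>n. t * (a n * t ^ n)) sums (t * h t)"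
      unfolding h_def by (intro sums_mult summable_sums suma)
    ultimately have "t * h t = 0" using sums_unique2 by blast
    then show ?thesis using t by simp
  qed
  then have "(h \<longlongrightarrow> 0) (at_right 0)"
    by (intro tendsto_eventually) (auto simp: eventually_at_right_field intro!: exI[of _ 1])
  then have "a 0 = 0" using lim tendsto_unique trivial_limit_at_right_real by blast
  then show ?thesis by (simp add: a_def e_def)
qed

lemma invariant_measure_stationary_state:
  assumes "j > 0" "K \<ge> 1" "2 * K \<le> N" "invariant_measure j K N \<mu>"
  shows "stationary_state j K N \<mu>"
proof
  have I: "I_plus K N \<subseteq> Lam N" "I_minus K N \<subseteq> Lam N"
    using assms by (auto simp: I_plus_def I_minus_def Lam_def)
  show "measure_pmf.expectation \<mu> (generator j K N f) = 0" for f
    by (rule invariant_measure_stationary[OF assms(1) I assms(4)])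
qed (use assms in \<open>auto simp: invariant_measure_def\<close>)

section \<open>The Neumann heat semigroup\<close>

lemma integrable_bounded_lebesgue_on:
  fixes f :: "real \<Rightarrow> real"
  assumes "f \<in> borel_measurable (lebesgue_on {a..b})" "\<And>x. x \<in> {a..b} \<Longrightarrow> \<bar>f x\<bar> \<le> c"
  shows "integrable (lebesgue_on {a..b}) f"
proof -
  interpret finite_measure "lebesgue_on {a..b}" by (rule finite_measure_lebesgue_on) simp
  show ?thesis using assms by (intro integrable_const_bound[of _ c] AE_I2) auto
qed

lemma continuous_borel_measurable_lebesgue_on:
  fixes f :: "real \<Rightarrow> real"
  shows "continuous_on {a..b} f \<Longrightarrow> f \<in> borel_measurable (lebesgue_on {a..b})"
  by (rule continuous_imp_measurable_on_sets_lebesgue) simp_all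

lemma continuous_bounded_interval:
  fixes f :: "real \<Rightarrow> real"
  assumes "continuous_on {a..b} f"
  obtains c where "0 \<le> c" "\<And>x. x \<in> {a..b} \<Longrightarrow> \<bar>f x\<bar> \<le> c"
proof -
  have "bounded (f ` {a..b})" using assms by (intro compact_imp_bounded compact_continuous_image) auto
  then obtain c where "\<forall>x\<in>{a..b}. \<bar>f x\<bar> \<le> c" by (auto simp: bounded_iff)
  then show thesis by (intro that[of "max 0 c"]) force+
qed

text \<open>The semigroup has to act on stationary solutions, which are a priori only bounded and
  measurable.\<close>

definition bounded_density :: "(real \<Rightarrow> real) \<Rightarrow> bool" where
  "bounded_density f \<longleftrightarrow> f \<in> borel_measurable (lebesgue_on {-1..1}) \<and> (\<exists>c. \<forall>q\<in>{-1..1}. \<bar>f q\<bar> \<le> c)"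

lemma bounded_density_continuous: "continuous_on {-1..1} f \<Longrightarrow> bounded_density f"
  unfolding bounded_density_def using continuous_borel_measurable_lebesgue_on continuous_bounded_interval by metis

lemma bounded_density_diff: "bounded_density f \<Longrightarrow> bounded_density g \<Longrightarrow> bounded_density (\<lambda>q. f q - g q)"
  unfolding bounded_density_def
proof (elim conjE exE, intro conjI)
  fix c d assume "\<forall>q\<in>{-1..1}. \<bar>f q\<bar> \<le> c" "\<forall>q\<in>{-1..1}. \<bar>g q\<bar> \<le> d"
  then show "\<exists>c. \<forall>q\<in>{-1..1}. \<bar>f q - g q\<bar> \<le> c"
    by (intro exI[of _ "c + d"]) (smt (verit))
qed auto

lemma bounded_density_mult: "bounded_density f \<Longrightarrow> bounded_density g \<Longrightarrow> bounded_density (\<lambda>q. f q * g q)"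
  unfolding bounded_density_def
proof (elim conjE exE, intro conjI)
  fix c d assume "\<forall>q\<in>{-1..1}. \<bar>f q\<bar> \<le> c" "\<forall>q\<in>{-1..1}. \<bar>g q\<bar> \<le> d"
  then show "\<exists>c. \<forall>q\<in>{-1..1}. \<bar>f q * g q\<bar> \<le> c"
    by (intro exI[of _ "c * d"]) (auto simp: abs_mult intro!: mult_mono intro: order_trans[OF abs_ge_zero])
qed auto

lemma bounded_density_integrable: "bounded_density f \<Longrightarrow> integrable (lebesgue_on {-1..1}) f"
  unfolding bounded_density_def using integrable_bounded_lebesgue_on by blast

locale neumann_kernel =
  fixes P :: "real \<Rightarrow> real \<Rightarrow> real \<Rightarrow> real"
  assumes density: "neumann_transition_density P"
begin

section \<open>Contraction, continuity and differentiation in time\<close>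

abbreviation T :: "real \<Rightarrow> (real \<Rightarrow> real) \<Rightarrow> real \<Rightarrow> real" where "T \<equiv> kernel_op P"

lemma P_continuous: "t > 0 \<Longrightarrow> continuous_on ({-1..1} \<times> {-1..1}) (\<lambda>(r, q). P t r q)"
  and P_nonneg: "t > 0 \<Longrightarrow> r \<in> {-1..1} \<Longrightarrow> q \<in> {-1..1} \<Longrightarrow> 0 \<le> P t r q"
  and T_one: "t > 0 \<Longrightarrow> r \<in> {-1..1} \<Longrightarrow> T t (\<lambda>_. 1) r = 1"
  and T_semigroup: "continuous_on {-1..1} f \<Longrightarrow> s > 0 \<Longrightarrow> t > 0 \<Longrightarrow> r \<in> {-1..1} \<Longrightarrow> T (s + t) f r = T s (T t f) r"
  and T_strong: "continuous_on {-1..1} f \<Longrightarrow> uniform_limit {-1..1} (\<lambda>t. T t f) f (at_right 0)"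
  and T_generator: "continuous_on {-1..1} f \<Longrightarrow> continuous_on {-1..1} g \<Longrightarrow>
      uniform_limit {-1..1} (\<lambda>t r. (T t f r - f r) / t) g (at_right 0) \<longleftrightarrow> half_neumann_laplacian f g"
  using density unfolding neumann_transition_density_def by blast+

lemma P_section: "t > 0 \<Longrightarrow> r \<in> {-1..1} \<Longrightarrow> continuous_on {-1..1} (P t r)"
  using continuous_on_compose2[OF P_continuous, of t "{-1..1}" "\<lambda>q. (r, q)"]
  by (force intro: continuous_intros)

lemma P_section': "t > 0 \<Longrightarrow> q \<in> {-1..1} \<Longrightarrow> continuous_on {-1..1} (\<lambda>r. P t r q)"
  using continuous_on_compose2[OF P_continuous, of t "{-1..1}" "\<lambda>r. (r, q)"]
  by (force intro: continuous_intros)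

lemma P_bounded:
  assumes "t > 0" obtains B where "0 \<le> B" "\<And>r q. r \<in> {-1..1} \<Longrightarrow> q \<in> {-1..1} \<Longrightarrow> \<bar>P t r q\<bar> \<le> B"
proof -
  have "bounded ((\<lambda>(r, q). P t r q) ` ({-1..1} \<times> {-1..1}))"
    using P_continuous[OF assms] by (intro compact_imp_bounded compact_continuous_image compact_Times) auto
  then obtain c where "\<forall>x\<in>{-1..1} \<times> {-1..1}. \<bar>(\<lambda>(r, q). P t r q) x\<bar> \<le> c" by (auto simp: bounded_iff)
  then show thesis by (intro that[of "max 0 c"]) force+
qed

lemma P_uniformly_continuous:
  assumes "t > 0" "\<epsilon> > 0"
  obtains \<delta> where "\<delta> > 0"
    "\<And>r q r' q'. r \<in> {-1..1} \<Longrightarrow> q \<in> {-1..1} \<Longrightarrow> r' \<in> {-1..1} \<Longrightarrow> q' \<in> {-1..1} \<Longrightarrow>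
        dist (r, q) (r', q') < \<delta> \<Longrightarrow> \<bar>P t r q - P t r' q'\<bar> < \<epsilon>"
proof -
  have "uniformly_continuous_on ({-1..1} \<times> {-1..1}) (\<lambda>(r, q). P t r q)"
    using P_continuous[OF assms(1)] by (intro compact_uniformly_continuous compact_Times) auto
  then obtain \<delta> where "\<delta> > 0" "\<forall>x\<in>{-1..1} \<times> {-1..1}. \<forall>x'\<in>{-1..1} \<times> {-1..1}. dist x' x < \<delta> \<longrightarrow>
      dist ((\<lambda>(r, q). P t r q) x') ((\<lambda>(r, q). P t r q) x) < \<epsilon>"
    using assms(2) unfolding uniformly_continuous_on_def by metis
  then show thesis by (intro that[of \<delta>]) (auto simp: dist_real_def)
qed

lemma T_integrable:
  assumes "t > 0" "r \<in> {-1..1}" "bounded_density f"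
  shows "integrable (lebesgue_on {-1..1}) (\<lambda>q. P t r q * f q)"
  by (intro bounded_density_integrable bounded_density_mult[OF bounded_density_continuous assms(3)] P_section assms(1,2))

lemma T_diff:
  assumes "t > 0" "r \<in> {-1..1}" "bounded_density f" "bounded_density g"
  shows "T t (\<lambda>q. f q - g q) r = T t f r - T t g r"
  unfolding kernel_op_def right_diff_distrib
  by (intro Bochner_Integration.integral_diff T_integrable assms)

lemma T_scale: "T t (\<lambda>q. c * f q) r = c * T t f r"
  unfolding kernel_op_def by (simp add: mult.left_commute)

lemma T_const: "t > 0 \<Longrightarrow> r \<in> {-1..1} \<Longrightarrow> T t (\<lambda>_. c) r = c"
  using T_scale[of t c "\<lambda>_. 1" r] T_one by simp

lemma T_bound:
  assumes "t > 0" "r \<in> {-1..1}" "bounded_density f" "\<And>q. q \<in> {-1..1} \<Longrightarrow> \<bar>f q\<bar> \<le> c"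
  shows "\<bar>T t f r\<bar> \<le> c"
proof -
  have "\<bar>T t f r\<bar> \<le> (\<integral>q. \<bar>P t r q * f q\<bar> \<partial>lebesgue_on {-1..1})"
    unfolding kernel_op_def by (rule integral_abs_bound)
  also have "\<dots> \<le> (\<integral>q. P t r q * c \<partial>lebesgue_on {-1..1})"
  proof (rule integral_mono)
    show "integrable (lebesgue_on {-1..1}) (\<lambda>q. P t r q * c)"
      using assms by (intro T_integrable bounded_density_continuous) auto
    fix q assume "q \<in> space (lebesgue_on {-1..1::real})"
    then show "\<bar>P t r q * f q\<bar> \<le> P t r q * c"
      using P_nonneg[OF assms(1,2)] assms(4) by (auto simp: abs_mult intro!: mult_left_mono)
  qed (use T_integrable[OF assms(1-3)] in simp)
  also have "\<dots> = c" using T_const[OF assms(1,2), of c] by (simp add: kernel_op_def)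
  finally show ?thesis .
qed

text \<open>Strong Feller property, from the uniform continuity of the kernel; it will make an
  invariant function continuous.\<close>

lemma T_continuous:
  assumes t: "t > 0" and f: "bounded_density f"
  shows "continuous_on {-1..1} (T t f)"
proof (rule continuous_onI)
  fix r \<epsilon> :: real assume r: "r \<in> {-1..1}" and \<epsilon>: "\<epsilon> > 0"
  obtain c where c: "\<And>q. q \<in> {-1..1} \<Longrightarrow> \<bar>f q\<bar> \<le> c" using f unfolding bounded_density_def by blast
  have c0: "0 \<le> c" using c[of 0] by simp
  define e where "e = \<epsilon> / (4 * (c + 1))"
  have e: "e > 0" using \<epsilon> c0 by (simp add: e_def)
  obtain \<delta> where \<delta>: "\<delta> > 0" "\<And>r q r' q'. r \<in> {-1..1} \<Longrightarrow> q \<in> {-1..1} \<Longrightarrow> r' \<in> {-1..1} \<Longrightarrow> q' \<in> {-1..1} \<Longrightarrow>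
        dist (r, q) (r', q') < \<delta> \<Longrightarrow> \<bar>P t r q - P t r' q'\<bar> < e"
    using P_uniformly_continuous[OF t e] by metis
  show "\<exists>d>0. \<forall>r'\<in>{-1..1}. dist r' r < d \<longrightarrow> dist (T t f r') (T t f r) \<le> \<epsilon>"
  proof (intro exI[of _ \<delta>] conjI ballI impI \<delta>(1))
    fix r' assume r': "r' \<in> {-1..1}" "dist r' r < \<delta>"
    have "T t f r' - T t f r = (\<integral>q. (P t r' q - P t r q) * f q \<partial>lebesgue_on {-1..1})"
      unfolding kernel_op_def left_diff_distrib
      by (intro Bochner_Integration.integral_diff[symmetric] T_integrable t r r' f)
    also have "\<bar>\<dots>\<bar> \<le> (\<integral>q. \<bar>(P t r' q - P t r q) * f q\<bar> \<partial>lebesgue_on {-1..1})"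
      by (rule integral_abs_bound)
    also have "\<dots> \<le> (\<integral>q. e * c \<partial>lebesgue_on {-1..1::real})"
    proof (rule integral_mono)
      show "integrable (lebesgue_on {-1..1}) (\<lambda>q. \<bar>(P t r' q - P t r q) * f q\<bar>)"
        using r r' t by (intro integrable_abs bounded_density_integrable bounded_density_mult[OF _ f]
            bounded_density_diff bounded_density_continuous P_section)
      fix q assume "q \<in> space (lebesgue_on {-1..1::real})"
      then show "\<bar>(P t r' q - P t r q) * f q\<bar> \<le> e * c"
        using \<delta>(2)[OF r'(1) _ r, of q q] r' c e unfolding abs_mult
        by (intro mult_mono) (auto simp: dist_Pair_Pair intro: less_imp_le)
    qed (intro integrable_bounded_lebesgue_on; auto)
    also have "\<dots> = 2 * (e * c)" by (simp add: measure_restrict_space)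
    also have "\<dots> \<le> \<epsilon>" using \<epsilon> c0 by (simp add: e_def field_simps)
    finally show "dist (T t f r') (T t f r) \<le> \<epsilon>" by (simp add: dist_real_def)
  qed
qed

text \<open>Semigroup law and contraction: an increment of length \<open>h\<close> at time
  \<open>s\<close> is no larger than the one at time 0.\<close>

lemma T_time_difference:
  assumes f: "continuous_on {-1..1} f" and s: "s > 0" and h: "h > 0" and r: "r \<in> {-1..1}"
    and c: "\<And>q. q \<in> {-1..1} \<Longrightarrow> \<bar>T h f q - f q\<bar> \<le> c"
  shows "\<bar>T (s + h) f r - T s f r\<bar> \<le> c"
proof -
  have "T (s + h) f r - T s f r = T s (\<lambda>q. T h f q - f q) r"
    using T_semigroup[OF f s h r] s h r f
    by (subst T_diff) (auto intro: bounded_density_continuous T_continuous)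
  also have "\<bar>\<dots>\<bar> \<le> c"
    using f h by (intro T_bound s r c bounded_density_diff bounded_density_continuous T_continuous)
  finally show ?thesis .
qed

lemma T_small_time:
  assumes "continuous_on {-1..1} f" "\<epsilon> > 0"
  obtains \<delta> where "\<delta> > 0" "\<And>h q. 0 < h \<Longrightarrow> h < \<delta> \<Longrightarrow> q \<in> {-1..1} \<Longrightarrow> \<bar>T h f q - f q\<bar> < \<epsilon>"
proof -
  have "\<forall>\<^sub>F t in at_right 0. \<forall>q\<in>{-1..1}. dist (T t f q) (f q) < \<epsilon>"
    using T_strong[OF assms(1)] assms(2) by (simp add: uniform_limit_iff)
  then obtain b where "b > 0" "\<And>y. 0 < y \<Longrightarrow> y < b \<Longrightarrow> \<forall>q\<in>{-1..1}. dist (T y f q) (f q) < \<epsilon>"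
    unfolding eventually_at_right_field by auto
  then show thesis using that by (auto simp: dist_real_def)
qed

lemma T_time_continuous:
  assumes f: "continuous_on {-1..1} f" and r: "r \<in> {-1..1}"
  shows "continuous_on {0<..} (\<lambda>s. T s f r)"
proof (rule continuous_onI)
  fix s \<epsilon> :: real assume s: "s \<in> {0<..}" and \<epsilon>: "\<epsilon> > 0"
  obtain \<delta> where \<delta>: "\<delta> > 0" "\<And>h q. 0 < h \<Longrightarrow> h < \<delta> \<Longrightarrow> q \<in> {-1..1} \<Longrightarrow> \<bar>T h f q - f q\<bar> < \<epsilon>"
    using T_small_time[OF f \<epsilon>] by metis
  show "\<exists>d>0. \<forall>s'\<in>{0<..}. dist s' s < d \<longrightarrow> dist (T s' f r) (T s f r) \<le> \<epsilon>"
  proof (intro exI[of _ \<delta>] conjI ballI impI \<delta>(1))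
    fix s' assume s': "s' \<in> {0<..}" "dist s' s < \<delta>"
    consider "s' = s" | "s' < s" | "s < s'" by linarith
    then show "dist (T s' f r) (T s f r) \<le> \<epsilon>"
    proof cases
      case 2
      have "\<bar>T (s' + (s - s')) f r - T s' f r\<bar> \<le> \<epsilon>"
        using \<delta>(2)[of "s - s'"] s s' 2 by (intro T_time_difference f r) (auto simp: dist_real_def intro: less_imp_le)
      then show ?thesis by (simp add: dist_real_def abs_minus_commute)
    next
      case 3
      have "\<bar>T (s + (s' - s)) f r - T s f r\<bar> \<le> \<epsilon>"
        using \<delta>(2)[of "s' - s"] s s' 3 by (intro T_time_difference f r) (auto simp: dist_real_def intro: less_imp_le)
      then show ?thesis by (simp add: dist_real_def)
    qed (use \<epsilon> in simp)
  qed
qed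

lemma half_neumann_laplacian_continuous:
  "half_neumann_laplacian f g \<Longrightarrow> continuous_on {-1..1} f"
  "half_neumann_laplacian f g \<Longrightarrow> continuous_on {-1..1} g"
proof -
  assume "half_neumann_laplacian f g"
  then obtain f' f'' where *: "\<forall>r\<in>{-1..1}. (f has_real_derivative f' r) (at r within {-1..1})"
    "continuous_on {-1..1} f''" "\<forall>r\<in>{-1..1}. g r = 1 / 2 * f'' r"
    unfolding half_neumann_laplacian_def by blast
  show "continuous_on {-1..1} f" using * by (intro DERIV_continuous_on[of _ f f']) blast
  show "continuous_on {-1..1} g"
    using * by (subst continuous_on_cong[OF refl, of _ g "\<lambda>r. 1 / 2 * f'' r"]) (auto intro: continuous_intros)
qed

text \<open>The generator hypothesis is a right derivative at time 0; an estimate uniform in the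
  base time carries it to any positive time.\<close>

lemma T_derivative:
  assumes fg: "half_neumann_laplacian f g" and s: "s > 0" and r: "r \<in> {-1..1}"
  shows "((\<lambda>s. T s f r) has_real_derivative T s g r) (at s)"
proof -
  note f = half_neumann_laplacian_continuous(1)[OF fg] and g = half_neumann_laplacian_continuous(2)[OF fg]
  have *: "\<bar>(T (u + h) f r - T u f r) / h - T u g r\<bar> \<le> c"
    if u: "u > 0" and h: "h > 0" and c: "\<And>q. q \<in> {-1..1} \<Longrightarrow> \<bar>(T h f q - f q) / h - g q\<bar> \<le> c" for u h c
  proof -
    have bd: "bounded_density (\<lambda>q. T h f q - f q)"
      using f h by (intro bounded_density_diff bounded_density_continuous T_continuous)
    have bd': "bounded_density (\<lambda>q. 1 / h * (T h f q - f q))"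
      by (intro bounded_density_mult bd bounded_density_continuous continuous_intros)
    have "(T (u + h) f r - T u f r) / h - T u g r = 1 / h * T u (\<lambda>q. T h f q - f q) r - T u g r"
      using T_semigroup[OF f u h r] f h by (simp add: T_diff[OF u r] bounded_density_continuous T_continuous)
    also have "\<dots> = T u (\<lambda>q. 1 / h * (T h f q - f q) - g q) r"
      unfolding T_scale[symmetric] by (rule T_diff[OF u r bd' bounded_density_continuous[OF g], symmetric])
    also have "\<bar>\<dots>\<bar> \<le> c"
      using c by (intro T_bound u r bounded_density_diff[OF bd' bounded_density_continuous[OF g]]) auto
    finally show ?thesis .
  qed
  have "((\<lambda>h. (T (s + h) f r - T s f r) / h) \<longlongrightarrow> T s g r) (at 0)"
  proof (rule tendstoI)
    fix \<epsilon> :: real assume \<epsilon>: "\<epsilon> > 0"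
    have u: "uniform_limit {-1..1} (\<lambda>t r. (T t f r - f r) / t) g (at_right 0)"
      using T_generator[OF f g] fg by simp
    have "\<forall>\<^sub>F t in at_right 0. \<forall>q\<in>{-1..1}. dist ((T t f q - f q) / t) (g q) < \<epsilon> / 3"
      using u[unfolded uniform_limit_iff, rule_format, of "\<epsilon> / 3"] \<epsilon> by simp
    then obtain d1 where d1: "d1 > 0" "\<And>h. 0 < h \<Longrightarrow> h < d1 \<Longrightarrow> \<forall>q\<in>{-1..1}. dist ((T h f q - f q) / h) (g q) < \<epsilon> / 3"
      unfolding eventually_at_right_field by auto
    obtain d2 where d2: "d2 > 0" "\<And>h q. 0 < h \<Longrightarrow> h < d2 \<Longrightarrow> q \<in> {-1..1} \<Longrightarrow> \<bar>T h g q - g q\<bar> < \<epsilon> / 3"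
      using T_small_time[OF g, of "\<epsilon> / 3"] \<epsilon> by auto
    have gen: "\<bar>(T h f q - f q) / h - g q\<bar> \<le> \<epsilon> / 3" if "0 < h" "h < d1" "q \<in> {-1..1}" for h q
      using d1(2)[OF that(1,2)] that(3) by (auto simp: dist_real_def intro: less_imp_le)
    define d where "d = min (min d1 d2) s"
    have "d > 0" using d1 d2 s by (simp add: d_def)
    moreover have "dist ((T (s + h) f r - T s f r) / h) (T s g r) < \<epsilon>" if "h \<noteq> 0" "dist h 0 < d" for h
    proof (cases "h > 0")
      case True
      then show ?thesis using *[OF s True gen] that \<epsilon> by (simp add: d_def dist_real_def)
    next
      case False
      \<comment> \<open>A backward increment from \<open>s\<close> is a forward increment from
        \<open>s - k\<close>; the derivative found at \<open>s - k\<close> is then compared with the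
        one at \<open>s\<close>.\<close>
      define k where "k = - h"
      have k: "0 < k" "k < d1" "k < d2" "k < s" using False that by (auto simp: k_def d_def)
      have "\<bar>(T (s - k + k) f r - T (s - k) f r) / k - T (s - k) g r\<bar> \<le> \<epsilon> / 3"
        using k by (intro * gen) auto
      moreover have "\<bar>T (s - k + k) g r - T (s - k) g r\<bar> \<le> \<epsilon> / 3"
        using k d2(2)[OF k(1,3)] by (intro T_time_difference g r) (auto intro: less_imp_le)
      moreover have "(T (s + h) f r - T s f r) / h = (T s f r - T (s - k) f r) / k"
        using k by (simp add: k_def field_simps)
      ultimately show ?thesis using \<epsilon> unfolding dist_real_def by (simp only: diff_add_cancel)
    qed
    ultimately show "\<forall>\<^sub>F h in at 0. dist ((T (s + h) f r - T s f r) / h) (T s g r) < \<epsilon>"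
      unfolding eventually_at by blast
  qed
  then show ?thesis by (simp add: DERIV_def)
qed

end

section \<open>Stationary solutions of the macroscopic equation\<close>

text \<open>Polynomials of mass one on \<open>[-1, 1]\<close> that concentrate at the end point \<open>\<sigma> = \<plusminus>1\<close>. Half the second
  derivative of \<open>bump_potential \<sigma> n\<close> is \<open>1 / 2 - bump \<sigma> n\<close>; the correction to the parabola
  restores the Neumann condition at \<open>\<sigma>\<close>.\<close>
definition bump :: "real \<Rightarrow> nat \<Rightarrow> real \<Rightarrow> real" where
  "bump \<sigma> n q = (real n + 1) / 2 ^ (n + 1) * (1 + \<sigma> * q) ^ n"

definition bump_potential :: "real \<Rightarrow> nat \<Rightarrow> real \<Rightarrow> real" where
  "bump_potential \<sigma> n q = (1 + \<sigma> * q)\<^sup>2 / 2 - 4 / (real n + 2) * ((1 + \<sigma> * q) / 2) ^ (n + 2)"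

lemma bump_continuous: "continuous_on A (bump \<sigma> n)"
  unfolding bump_def by (intro continuous_intros)

lemma bump_potential_continuous: "continuous_on A (bump_potential \<sigma> n)"
  unfolding bump_potential_def by (intro continuous_intros) auto

lemma sign_range:
  fixes \<sigma> :: real
  assumes "\<sigma> = 1 \<or> \<sigma> = - 1" "q \<in> {-1..1}"
  shows "0 \<le> 1 + \<sigma> * q" "1 + \<sigma> * q \<le> 2" "\<sigma> \<in> {-1..1}" "\<sigma> * \<sigma> = 1" "1 - \<sigma> * q = \<bar>q - \<sigma>\<bar>"
  using assms by auto

lemma half_neumann_laplacian_bump_potential:
  assumes \<sigma>: "\<sigma> = 1 \<or> \<sigma> = - 1"
  shows "half_neumann_laplacian (bump_potential \<sigma> n) (\<lambda>q. 1 / 2 - bump \<sigma> n q)"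
  unfolding half_neumann_laplacian_def
proof (intro exI conjI ballI)
  let ?f' = "\<lambda>q. \<sigma> * ((1 + \<sigma> * q) - 2 * ((1 + \<sigma> * q) / 2) ^ (n + 1))"
  let ?f'' = "\<lambda>q. 1 - 2 * bump \<sigma> n q"
  fix r :: real assume "r \<in> {-1..1}"
  have e: "\<sigma> * \<sigma> = 1" using \<sigma> by auto
  have D1: "((\<lambda>q. (1 + \<sigma> * q)\<^sup>2 / 2) has_real_derivative \<sigma> * (1 + \<sigma> * r)) (at r within {-1..1})"
    by (auto intro!: derivative_eq_intros)
  have D2: "((\<lambda>q. ((1 + \<sigma> * q) / 2) ^ Suc (n + 1)) has_real_derivative
      (1 + real (n + 1)) * (\<sigma> / 2 * ((1 + \<sigma> * r) / 2) ^ (n + 1))) (at r within {-1..1})"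
    by (rule DERIV_power_Suc) (auto intro!: derivative_eq_intros)
  have "\<sigma> * u - 4 / (real n + 2) * ((1 + real (n + 1)) * (\<sigma> / 2 * X)) = \<sigma> * (u - 2 * X)" for u X
    by (simp add: field_simps)
  then show "(bump_potential \<sigma> n has_real_derivative ?f' r) (at r within {-1..1})"
    unfolding bump_potential_def[abs_def] using DERIV_diff[OF D1 DERIV_cmult[OF D2, of "4 / (real n + 2)"]]
    by (simp only: Suc_eq_plus1 add.assoc one_add_one)
  have D3: "((\<lambda>q. ((1 + \<sigma> * q) / 2) ^ Suc n) has_real_derivative
      (1 + real n) * (\<sigma> / 2 * ((1 + \<sigma> * r) / 2) ^ n)) (at r within {-1..1})"
    by (rule DERIV_power_Suc) (auto intro!: derivative_eq_intros)
  have D4: "((\<lambda>q. 1 + \<sigma> * q) has_real_derivative \<sigma>) (at r within {-1..1})"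
    by (auto intro!: derivative_eq_intros)
  have "\<sigma> * (\<sigma> - 2 * ((1 + real n) * (\<sigma> / 2 * ((1 + \<sigma> * r) / 2) ^ n))) = \<sigma> * \<sigma> * (1 - (1 + real n) * ((1 + \<sigma> * r) / 2) ^ n)"
    by (simp add: algebra_simps)
  also have "\<dots> = ?f'' r" unfolding e by (simp add: bump_def power_divide add.commute)
  finally show "(?f' has_real_derivative ?f'' r) (at r within {-1..1})"
    using DERIV_cmult[OF DERIV_diff[OF D4 DERIV_cmult[OF D3, of 2]], of \<sigma>] by (simp only: Suc_eq_plus1)
next
  show "continuous_on {-1..1} (\<lambda>q. 1 - 2 * bump \<sigma> n q)" by (intro continuous_intros bump_continuous)
  show "\<sigma> * ((1 + \<sigma> * -1) - 2 * ((1 + \<sigma> * -1) / 2) ^ (n + 1)) = 0"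
    "\<sigma> * ((1 + \<sigma> * 1) - 2 * ((1 + \<sigma> * 1) / 2) ^ (n + 1)) = 0" using \<sigma> by auto
qed simp

lemma bump_integral:
  assumes \<sigma>: "\<sigma> = 1 \<or> \<sigma> = - 1"
  shows "(\<integral>q. bump \<sigma> n q \<partial>lebesgue_on {-1..1}) = 1"
    "(\<integral>q. bump \<sigma> n q * \<bar>q - \<sigma>\<bar> \<partial>lebesgue_on {-1..1}) = 2 / (real n + 2)"
proof -
  have ev: "(\<integral>q. f q \<partial>lebesgue_on {-1..1}) = F 1 - F (-1)"
    if "\<And>q. q \<in> {-1..1} \<Longrightarrow> (F has_real_derivative f q) (at q within {-1..1})" "continuous_on {-1..1} f"
    for f F :: "real \<Rightarrow> real"
  proof -
    have "(f has_integral (F 1 - F (-1))) {-1..1}"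
      using that(1) by (intro fundamental_theorem_of_calculus) (auto simp: has_real_derivative_iff_has_vector_derivative)
    then show ?thesis
      using lebesgue_integral_eq_integral[OF continuous_imp_integrable_real[OF that(2)]] by (simp add: integral_unique)
  qed
  have e: "\<sigma> * \<sigma> = 1" using \<sigma> by auto
  have pow: "((\<lambda>q. \<sigma> * c / 2 ^ m * (1 + \<sigma> * q) ^ (k + 1)) has_real_derivative c / 2 ^ m * (real (k + 1) * (1 + \<sigma> * q) ^ k)) (at q within {-1..1})"
    for c m k q
  proof -
    have "((\<lambda>q. (1 + \<sigma> * q) ^ Suc k) has_real_derivative (1 + real k) * (\<sigma> * (1 + \<sigma> * q) ^ k)) (at q within {-1..1})"
      by (rule DERIV_power_Suc) (auto intro!: derivative_eq_intros)
    from DERIV_cmult[OF this, of "\<sigma> * c / 2 ^ m"]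
    have D: "((\<lambda>q. \<sigma> * c / 2 ^ m * (1 + \<sigma> * q) ^ (k + 1)) has_real_derivative
        \<sigma> * c / 2 ^ m * ((1 + real k) * (\<sigma> * (1 + \<sigma> * q) ^ k))) (at q within {-1..1})"
      by (simp only: Suc_eq_plus1)
    have "\<sigma> * c / 2 ^ m * ((1 + real k) * (\<sigma> * (1 + \<sigma> * q) ^ k)) = (\<sigma> * \<sigma>) * (c / 2 ^ m * (real (k + 1) * (1 + \<sigma> * q) ^ k))"
      by simp
    also have "\<dots> = c / 2 ^ m * (real (k + 1) * (1 + \<sigma> * q) ^ k)" unfolding e by simp
    finally show ?thesis using D by (simp only:)
  qed
  have d1: "((\<lambda>q. \<sigma> * 1 / 2 ^ (n + 1) * (1 + \<sigma> * q) ^ (n + 1)) has_real_derivative bump \<sigma> n q) (at q within {-1..1})" for q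
    using pow[of 1 "n + 1" n q] by (simp add: bump_def mult_ac add.commute)
  show "(\<integral>q. bump \<sigma> n q \<partial>lebesgue_on {-1..1}) = 1"
    unfolding ev[OF d1 bump_continuous] using \<sigma> by auto
  \<comment> \<open>From integrating \<open>(1 + \<sigma> * q) ^ (n + 1)\<close> after writing the
    distance \<open>1 - \<sigma> * q\<close> as \<open>2 - (1 + \<sigma> * q)\<close>.\<close>
  define c where "c = (real n + 1) / (real n + 2)"
  define F where "F = (\<lambda>q. 2 * (\<sigma> * 1 / 2 ^ (n + 1) * (1 + \<sigma> * q) ^ (n + 1)) - \<sigma> * c / 2 ^ (n + 1) * (1 + \<sigma> * q) ^ (n + 1 + 1))"
  have "(\<integral>q. bump \<sigma> n q * \<bar>q - \<sigma>\<bar> \<partial>lebesgue_on {-1..1}) = F 1 - F (-1)"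
  proof (rule ev)
    fix q :: real assume q: "q \<in> {-1..1}"
    have cc: "c * real (n + 1 + 1) = real n + 1" by (simp add: c_def add_ac)
    have "2 * bump \<sigma> n q - c / 2 ^ (n + 1) * (real (n + 1 + 1) * (1 + \<sigma> * q) ^ (n + 1))
       = 2 * bump \<sigma> n q - (c * real (n + 1 + 1)) / 2 ^ (n + 1) * ((1 + \<sigma> * q) ^ n * (1 + \<sigma> * q))"
      by (simp add: mult_ac)
    also have "\<dots> = bump \<sigma> n q * (1 - \<sigma> * q)"
    proof -
      have "2 * (D * W) - D * (W * (1 + x)) = D * W * (1 - x)" for D W x :: real
        by (simp add: algebra_simps)
      then show ?thesis unfolding cc bump_def by blast
    qed
    also have "\<dots> = bump \<sigma> n q * \<bar>q - \<sigma>\<bar>" using sign_range(5)[OF \<sigma> q] by simp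
    finally show "(F has_real_derivative bump \<sigma> n q * \<bar>q - \<sigma>\<bar>) (at q within {-1..1})"
      unfolding F_def using DERIV_diff[OF DERIV_cmult[OF d1, of 2] pow[of c "n + 1" "n + 1" q]] by simp
  qed (intro continuous_intros bump_continuous)
  also have "\<dots> = 2 - 2 * c" using \<sigma> by (auto simp: F_def)
  also have "\<dots> = 2 / (real n + 2)" by (simp add: c_def field_simps)
  finally show "(\<integral>q. bump \<sigma> n q * \<bar>q - \<sigma>\<bar> \<partial>lebesgue_on {-1..1}) = 2 / (real n + 2)" .
qed

lemma bump_nonneg: "\<sigma> = 1 \<or> \<sigma> = - 1 \<Longrightarrow> q \<in> {-1..1} \<Longrightarrow> 0 \<le> bump \<sigma> n q"
  unfolding bump_def using sign_range(1)[of \<sigma> q] by (intro mult_nonneg_nonneg zero_le_power divide_nonneg_nonneg) auto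

lemma bump_potential_near:
  assumes "\<sigma> = 1 \<or> \<sigma> = - 1" "q \<in> {-1..1}"
  shows "\<bar>bump_potential \<sigma> n q - (1 + \<sigma> * q)\<^sup>2 / 2\<bar> \<le> 4 / (real n + 2)"
proof -
  have "0 \<le> ((1 + \<sigma> * q) / 2) ^ (n + 2)" "((1 + \<sigma> * q) / 2) ^ (n + 2) \<le> 1"
    using sign_range(1,2)[OF assms] by (intro zero_le_power power_le_one; simp)+
  then have "4 / (real n + 2) * ((1 + \<sigma> * q) / 2) ^ (n + 2) \<le> 4 / (real n + 2) * 1"
    by (intro mult_left_mono) auto
  moreover have "0 \<le> 4 / (real n + 2) * ((1 + \<sigma> * q) / 2) ^ (n + 2)"
    using \<open>0 \<le> ((1 + \<sigma> * q) / 2) ^ (n + 2)\<close> by simp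
  ultimately show ?thesis by (simp add: bump_potential_def)
qed

section \<open>The kernel at a boundary point\<close>

context neumann_kernel
begin

text \<open>Recovers the kernel at an end point from the action on functions: the bumps concentrate
  there, at the rate of their first moment \<open>2 / (n + 2)\<close>.\<close>

lemma T_bump_uniform:
  assumes \<sigma>: "\<sigma> = 1 \<or> \<sigma> = - 1" and t: "t > 0" and \<epsilon>: "\<epsilon> > 0"
  shows "\<forall>\<^sub>F n in sequentially. \<forall>r\<in>{-1..1}. \<bar>T t (bump \<sigma> n) r - P t r \<sigma>\<bar> < \<epsilon>"
proof -
  obtain \<delta> where \<delta>: "\<delta> > 0" "\<And>r q r' q'. r \<in> {-1..1} \<Longrightarrow> q \<in> {-1..1} \<Longrightarrow> r' \<in> {-1..1} \<Longrightarrow> q' \<in> {-1..1} \<Longrightarrow>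
        dist (r, q) (r', q') < \<delta> \<Longrightarrow> \<bar>P t r q - P t r' q'\<bar> < \<epsilon> / 2"
    using P_uniformly_continuous[OF t, of "\<epsilon> / 2"] \<epsilon> by auto
  obtain B where B: "0 \<le> B" "\<And>r q. r \<in> {-1..1} \<Longrightarrow> q \<in> {-1..1} \<Longrightarrow> \<bar>P t r q\<bar> \<le> B"
    using P_bounded[OF t] by metis
  have \<sigma>I: "\<sigma> \<in> {-1..1}" using \<sigma> by auto
  define C where "C = 2 * B / \<delta>"
  have C0: "0 \<le> C" using B \<delta> by (simp add: C_def)
  \<comment> \<open>A linear majorant of the modulus of continuity, so that the first moment of the
    bump suffices.\<close>
  have pt: "\<bar>P t r q - P t r \<sigma>\<bar> \<le> \<epsilon> / 2 + C * \<bar>q - \<sigma>\<bar>" if r: "r \<in> {-1..1}" and q: "q \<in> {-1..1}" for r q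
  proof (cases "\<bar>q - \<sigma>\<bar> < \<delta>")
    case True
    then have "\<bar>P t r q - P t r \<sigma>\<bar> < \<epsilon> / 2"
      using \<delta>(2)[OF r q r \<sigma>I] by (simp add: dist_Pair_Pair dist_real_def)
    moreover have "0 \<le> C * \<bar>q - \<sigma>\<bar>" using C0 by simp
    ultimately show ?thesis by linarith
  next
    case False
    have "\<bar>P t r q - P t r \<sigma>\<bar> \<le> 2 * B" using B(2)[OF r q] B(2)[OF r \<sigma>I] by linarith
    also have "\<dots> = C * \<delta>" using \<delta> by (simp add: C_def)
    also have "\<dots> \<le> C * \<bar>q - \<sigma>\<bar>" using False C0 by (intro mult_left_mono) auto
    finally show ?thesis using \<epsilon> by linarith
  qed
  have main: "\<bar>T t (bump \<sigma> n) r - P t r \<sigma>\<bar> \<le> \<epsilon> / 2 + C * (2 / (real n + 2))" if r: "r \<in> {-1..1}" for r n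
  proof -
    let ?M = "lebesgue_on {-1..1::real}"
    have ib: "integrable ?M (bump \<sigma> n)" by (intro continuous_imp_integrable_real bump_continuous)
    have ib': "integrable ?M (\<lambda>q. bump \<sigma> n q * \<bar>q - \<sigma>\<bar>)"
      by (intro continuous_imp_integrable_real continuous_intros bump_continuous)
    have cd: "continuous_on {-1..1} (\<lambda>q. (P t r q - P t r \<sigma>) * bump \<sigma> n q)"
      using P_section[OF t r] by (intro continuous_intros bump_continuous) auto
    have "T t (bump \<sigma> n) r - P t r \<sigma> = T t (bump \<sigma> n) r - (\<integral>q. P t r \<sigma> * bump \<sigma> n q \<partial>?M)"
      using bump_integral(1)[OF \<sigma>, of n] by simp
    also have "\<dots> = (\<integral>q. (P t r q - P t r \<sigma>) * bump \<sigma> n q \<partial>?M)"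
      unfolding kernel_op_def left_diff_distrib
      using ib by (intro Bochner_Integration.integral_diff[symmetric] T_integrable t r bounded_density_continuous bump_continuous) auto
    also have "\<bar>\<dots>\<bar> \<le> (\<integral>q. \<bar>(P t r q - P t r \<sigma>) * bump \<sigma> n q\<bar> \<partial>?M)" by (rule integral_abs_bound)
    also have "\<dots> \<le> (\<integral>q. \<epsilon> / 2 * bump \<sigma> n q + C * (bump \<sigma> n q * \<bar>q - \<sigma>\<bar>) \<partial>?M)"
    proof (rule integral_mono)
      show "integrable ?M (\<lambda>q. \<bar>(P t r q - P t r \<sigma>) * bump \<sigma> n q\<bar>)"
        using cd by (intro integrable_abs continuous_imp_integrable_real)
      fix q assume "q \<in> space ?M"
      then have q: "q \<in> {-1..1}" by simp
      have "\<bar>(P t r q - P t r \<sigma>) * bump \<sigma> n q\<bar> \<le> (\<epsilon> / 2 + C * \<bar>q - \<sigma>\<bar>) * bump \<sigma> n q"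
        using pt[OF r q] bump_nonneg[OF \<sigma> q] by (simp add: abs_mult mult_right_mono)
      then show "\<bar>(P t r q - P t r \<sigma>) * bump \<sigma> n q\<bar> \<le> \<epsilon> / 2 * bump \<sigma> n q + C * (bump \<sigma> n q * \<bar>q - \<sigma>\<bar>)"
        by (simp add: algebra_simps)
    qed (use ib ib' in auto)
    also have "\<dots> = \<epsilon> / 2 + C * (2 / (real n + 2))"
      using ib ib' bump_integral[OF \<sigma>, of n] by simp
    finally show ?thesis .
  qed
  have "(\<lambda>n. C * (2 / (real n + 2))) \<longlonglongrightarrow> 0" by real_asymp
  then have "\<forall>\<^sub>F n in sequentially. C * (2 / (real n + 2)) < \<epsilon> / 2"
    using \<epsilon> by (intro order_tendstoD(2)) auto
  then show ?thesis
  proof (eventually_elim, intro ballI)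
    fix n r assume "C * (2 / (real n + 2)) < \<epsilon> / 2" "r \<in> {-1..1::real}"
    then show "\<bar>T t (bump \<sigma> n) r - P t r \<sigma>\<bar> < \<epsilon>" using main[of r n] by linarith
  qed
qed

text \<open>Contraction propagates the convergence at time \<open>u\<close> to all later times at
  once.\<close>

lemma T_bump_uniform_time:
  assumes \<sigma>: "\<sigma> = 1 \<or> \<sigma> = - 1" and u: "u > 0" and r: "r \<in> {-1..1}"
  shows "uniform_limit {u<..} (\<lambda>n s. T s (bump \<sigma> n) r) (\<lambda>s. T (s - u) (\<lambda>z. P u z \<sigma>) r) sequentially"
  unfolding uniform_limit_iff
proof (intro allI impI)
  fix \<epsilon> :: real assume \<epsilon>: "\<epsilon> > 0"
  have \<sigma>I: "\<sigma> \<in> {-1..1}" using \<sigma> by auto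
  have "\<forall>\<^sub>F n in sequentially. \<forall>r\<in>{-1..1}. \<bar>T u (bump \<sigma> n) r - P u r \<sigma>\<bar> < \<epsilon> / 2"
    using T_bump_uniform[OF \<sigma> u, of "\<epsilon> / 2"] \<epsilon> by simp
  then show "\<forall>\<^sub>F n in sequentially. \<forall>s\<in>{u<..}. dist (T s (bump \<sigma> n) r) (T (s - u) (\<lambda>z. P u z \<sigma>) r) < \<epsilon>"
  proof (eventually_elim, intro ballI)
    fix n s assume n: "\<forall>r\<in>{-1..1}. \<bar>T u (bump \<sigma> n) r - P u r \<sigma>\<bar> < \<epsilon> / 2" and s: "s \<in> {u<..}"
    have bd: "bounded_density (T u (bump \<sigma> n))" "bounded_density (\<lambda>z. P u z \<sigma>)"
      using u \<sigma>I by (auto intro!: bounded_density_continuous T_continuous bump_continuous P_section')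
    have "T s (bump \<sigma> n) r - T (s - u) (\<lambda>z. P u z \<sigma>) r = T (s - u) (\<lambda>z. T u (bump \<sigma> n) z - P u z \<sigma>) r"
      using T_semigroup[OF bump_continuous, of "s - u" u r \<sigma> n] s u r T_diff[OF _ r bd, of "s - u"] by simp
    also have "\<bar>\<dots>\<bar> \<le> \<epsilon> / 2"
      using s n by (intro T_bound r bounded_density_diff bd) (auto intro: less_imp_le)
    finally show "dist (T s (bump \<sigma> n) r) (T (s - u) (\<lambda>z. P u z \<sigma>) r) < \<epsilon>" using \<epsilon> by (simp add: dist_real_def)
  qed
qed

text \<open>The hypothesis on \<open>P\<close> states the semigroup law for continuous functions
  only. Applied to bumps it gives, in the limit, the law for the kernel, and with it continuity of
  \<open>P s r \<sigma>\<close> in \<open>s\<close>.\<close>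

lemma Chapman_Kolmogorov:
  assumes \<sigma>: "\<sigma> = 1 \<or> \<sigma> = - 1" and u: "0 < u" "u < s" and r: "r \<in> {-1..1}"
  shows "P s r \<sigma> = T (s - u) (\<lambda>z. P u z \<sigma>) r"
proof (rule LIMSEQ_unique)
  show "(\<lambda>n. T s (bump \<sigma> n) r) \<longlonglongrightarrow> T (s - u) (\<lambda>z. P u z \<sigma>) r"
    using tendsto_uniform_limitI[OF T_bump_uniform_time[OF \<sigma> u(1) r]] u by simp
  show "(\<lambda>n. T s (bump \<sigma> n) r) \<longlonglongrightarrow> P s r \<sigma>"
  proof (rule tendstoI)
    fix \<epsilon> :: real assume "\<epsilon> > 0"
    from T_bump_uniform[OF \<sigma> _ this, of s] u r
    show "\<forall>\<^sub>F n in sequentially. dist (T s (bump \<sigma> n) r) (P s r \<sigma>) < \<epsilon>"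
      by (auto simp: dist_real_def elim!: eventually_mono)
  qed
qed

section \<open>The time integral of the boundary kernel\<close>

definition boundary_potential :: "real \<Rightarrow> real \<Rightarrow> real" where
  "boundary_potential \<sigma> q = (1 + \<sigma> * q)\<^sup>2 / 2"

lemma boundary_potential_continuous: "continuous_on A (boundary_potential \<sigma>)"
  unfolding boundary_potential_def by (intro continuous_intros) auto

text \<open>Formally, half the second derivative of the parabola, with its Neumann defect at
  \<sigma> included, is 1/2 minus a unit point mass at \<sigma>.\<close>

definition boundary_flux :: "real \<Rightarrow> real \<Rightarrow> real \<Rightarrow> real" where
  "boundary_flux \<sigma> r t = t / 2 - (T t (boundary_potential \<sigma>) r - boundary_potential \<sigma> r)"

text \<open>The derivative is computed for \<open>bump_potential\<close>, which lies in the domain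
  of the generator, and passed to the limit under a time integral over \<open>{a..t}\<close>, where
  convergence is uniform because \<open>u < a\<close>.\<close>

lemma boundary_flux_derivative:
  assumes \<sigma>: "\<sigma> = 1 \<or> \<sigma> = - 1" and s: "s > 0" and r: "r \<in> {-1..1}"
  shows "(boundary_flux \<sigma> r has_real_derivative P s r \<sigma>) (at s)"
proof -
  define a b where "a = s / 2" and "b = 2 * s"
  have ab: "0 < a" "a < s" "s < b" using s by (auto simp: a_def b_def)
  define u where "u = a / 2"
  have u: "0 < u" "u < a" using ab by (auto simp: u_def)
  define A where "A n t = t / 2 - (T t (bump_potential \<sigma> n) r - bump_potential \<sigma> n r)" for n t
  have lim: "(\<lambda>n. A n t) \<longlonglongrightarrow> boundary_flux \<sigma> r t" if t: "t > 0" for t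
  proof -
    have near: "\<bar>A n t - boundary_flux \<sigma> r t\<bar> \<le> 8 / (real n + 2)" for n
    proof -
      have d: "\<bar>bump_potential \<sigma> n q - boundary_potential \<sigma> q\<bar> \<le> 4 / (real n + 2)" if "q \<in> {-1..1}" for q
        using bump_potential_near[OF \<sigma> that] by (simp add: boundary_potential_def)
      have "T t (bump_potential \<sigma> n) r - T t (boundary_potential \<sigma>) r
          = T t (\<lambda>q. bump_potential \<sigma> n q - boundary_potential \<sigma> q) r"
        by (intro T_diff[symmetric] t r bounded_density_continuous bump_potential_continuous boundary_potential_continuous)
      also have "\<bar>\<dots>\<bar> \<le> 4 / (real n + 2)"
        by (intro T_bound t r bounded_density_diff bounded_density_continuous bump_potential_continuous boundary_potential_continuous d)
      finally show ?thesis using d[OF r] unfolding A_def boundary_flux_def by (simp add: abs_le_iff)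
    qed
    have "(\<lambda>n. 8 / (real n + 2)) \<longlonglongrightarrow> 0" by real_asymp
    then have "(\<lambda>n. A n t - boundary_flux \<sigma> r t) \<longlonglongrightarrow> 0"
      by (rule Lim_null_comparison[rotated]) (use near in simp)
    then show ?thesis by (rule LIM_zero_cancel)
  qed
  have hi: "((\<lambda>v. T v (bump \<sigma> n) r) has_integral (A n t - A n a)) {a..t}" if t: "a \<le> t" for n t
  proof -
    have "(A n has_real_derivative T v (bump \<sigma> n) r) (at v)" if "v > 0" for v
    proof -
      have "T v (\<lambda>q. 1 / 2 - bump \<sigma> n q) r = 1 / 2 - T v (bump \<sigma> n) r"
        using that r T_const[OF that r] by (subst T_diff) (auto intro!: bounded_density_continuous bump_continuous)
      moreover have "(A n has_real_derivative (1 / 2 - (T v (\<lambda>q. 1 / 2 - bump \<sigma> n q) r - 0))) (at v)"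
        unfolding A_def by (intro DERIV_diff T_derivative half_neumann_laplacian_bump_potential \<sigma> that r DERIV_const)
          (auto intro!: derivative_eq_intros)
      ultimately show ?thesis by simp
    qed
    then show ?thesis using t ab
      by (intro fundamental_theorem_of_calculus)
         (auto simp: has_real_derivative_iff_has_vector_derivative intro: has_vector_derivative_at_within)
  qed
  let ?p = "\<lambda>v. T (v - u) (\<lambda>z. P u z \<sigma>) r"
  have \<sigma>I: "\<sigma> \<in> {-1..1}" using \<sigma> by auto
  have pc: "continuous_on {a..b} ?p"
    using u by (intro continuous_on_compose2[OF T_time_continuous[OF P_section'[OF u(1) \<sigma>I] r]] continuous_intros) auto
  have int: "integral {a..t} ?p = boundary_flux \<sigma> r t - boundary_flux \<sigma> r a" if t: "a \<le> t" for t
  proof -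
    have ul: "uniform_limit {a..t} (\<lambda>n v. T v (bump \<sigma> n) r) ?p sequentially"
      using T_bump_uniform_time[OF \<sigma> u(1) r] by (rule uniform_limit_on_subset) (use u in auto)
    have cn: "continuous_on {a..t} (\<lambda>v. T v (bump \<sigma> n) r)" for n
      using ab by (intro continuous_on_subset[OF T_time_continuous[OF bump_continuous r]]) auto
    obtain I J where IJ: "\<And>n. ((\<lambda>v. T v (bump \<sigma> n) r) has_integral I n) {a..t}" "(?p has_integral J) {a..t}" "I \<longlonglongrightarrow> J"
      using uniform_limit_integral[OF ul cn] by auto
    have "I = (\<lambda>n. A n t - A n a)" using IJ(1) hi[OF t] has_integral_unique by blast
    then have "I \<longlonglongrightarrow> boundary_flux \<sigma> r t - boundary_flux \<sigma> r a"
      using tendsto_diff[OF lim[of t] lim[of a]] ab t by simp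
    then show ?thesis using IJ(2,3) LIMSEQ_unique integral_unique by blast
  qed
  have "((\<lambda>t. integral {a..t} ?p) has_real_derivative ?p s) (at s within {a..b})"
    using ab by (intro integral_has_real_derivative pc) auto
  then have "((\<lambda>t. boundary_flux \<sigma> r t - boundary_flux \<sigma> r a) has_real_derivative ?p s) (at s within {a..b})"
    by (rule has_field_derivative_transform_within[of _ _ _ _ 1]) (use ab int in auto)
  then have "((\<lambda>t. boundary_flux \<sigma> r t - boundary_flux \<sigma> r a) has_real_derivative ?p s) (at s)"
    using ab at_within_interior[of s "{a..b}"] by (simp add: interior_atLeastAtMost_real)
  then have "((\<lambda>t. boundary_flux \<sigma> r t - boundary_flux \<sigma> r a + boundary_flux \<sigma> r a) has_real_derivative ?p s + 0) (at s)"
    by (intro DERIV_add DERIV_const)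
  then show ?thesis using Chapman_Kolmogorov[OF \<sigma> u(1) _ r, of s] u ab by simp
qed

lemma boundary_integral:
  assumes \<sigma>: "\<sigma> = 1 \<or> \<sigma> = - 1" and t: "t > 0" and r: "r \<in> {-1..1}"
  shows "integrable (lebesgue_on {0..t}) (\<lambda>s. P s r \<sigma>)"
    "(\<integral>s. P s r \<sigma> \<partial>lebesgue_on {0..t}) = boundary_flux \<sigma> r t"
proof -
  \<comment> \<open>\<open>P\<close> is unspecified at time 0, so the value there is set by hand;
    strong continuity makes it the limit.\<close>
  define F where "F s = (if s = 0 then 0 else boundary_flux \<sigma> r s)" for s
  have \<sigma>I: "\<sigma> \<in> {-1..1}" using \<sigma> by auto
  have F0: "(F \<longlongrightarrow> 0) (at_right 0)"
  proof -
    have "((\<lambda>s. T s (boundary_potential \<sigma>) r) \<longlongrightarrow> boundary_potential \<sigma> r) (at_right 0)"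
      using tendsto_uniform_limitI[OF T_strong[OF boundary_potential_continuous] r] .
    then have "(boundary_flux \<sigma> r \<longlongrightarrow> 0 / 2 - (boundary_potential \<sigma> r - boundary_potential \<sigma> r)) (at_right 0)"
      unfolding boundary_flux_def[abs_def] by (intro tendsto_intros) auto
    then have "(boundary_flux \<sigma> r \<longlongrightarrow> 0) (at_right 0)" by simp
    then show ?thesis
      by (rule Lim_transform_eventually) (auto simp: F_def eventually_at_right_field intro!: exI[of _ 1])
  qed
  have dF: "(F has_real_derivative P s r \<sigma>) (at s)" if "s > 0" for s
    using boundary_flux_derivative[OF \<sigma> that r]
    by (rule has_field_derivative_transform_within_open[of _ _ _ "{0<..}"]) (use that in \<open>auto simp: F_def\<close>)
  have "continuous_on {0..t} F"
  proof (rule continuous_on_eq_continuous_within[THEN iffD2], intro ballI)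
    fix s assume s: "s \<in> {0..t}"
    show "continuous (at s within {0..t}) F"
    proof (cases "s = 0")
      case True
      have "at 0 within {0..t} = at_right 0" using at_within_Icc_at_right[OF t] by simp
      then show ?thesis using F0 True by (simp add: continuous_within F_def)
    next
      case False
      then have "s > 0" using s by simp
      then show ?thesis using DERIV_isCont[OF dF] continuous_at_imp_continuous_at_within by blast
    qed
  qed
  then have hi: "((\<lambda>s. P s r \<sigma>) has_integral (F t - F 0)) {0..t}"
    using t dF by (intro fundamental_theorem_of_calculus_interior)
      (auto simp: has_real_derivative_iff_has_vector_derivative)
  \<comment> \<open>The unspecified value at time 0 is replaced by 0 before nonnegativity is used to
    get absolute integrability.\<close>
  have "(\<lambda>s. if s = 0 then 0 else P s r \<sigma>) integrable_on {0..t}"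
    using hi by (intro integrable_spike[OF has_integral_integrable[OF hi], of "{0}"]) auto
  then have "(\<lambda>s. if s = 0 then 0 else P s r \<sigma>) absolutely_integrable_on {0..t}"
    using P_nonneg[OF _ r \<sigma>I] by (intro nonnegative_absolutely_integrable_1) auto
  then have "(\<lambda>s. P s r \<sigma>) absolutely_integrable_on {0..t}"
    by (rule absolutely_integrable_spike[of _ _ "{0}"]) auto
  then show i: "integrable (lebesgue_on {0..t}) (\<lambda>s. P s r \<sigma>)"
    by (rule absolutely_integrable_imp_integrable) simp
  show "(\<integral>s. P s r \<sigma> \<partial>lebesgue_on {0..t}) = boundary_flux \<sigma> r t"
    using lebesgue_integral_eq_integral[OF i] hi t by (simp add: integral_unique F_def)
qed

section \<open>Stationary solutions\<close>

lemma stationary_solution_iff: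
  "stationary_solution P j K \<rho> \<longleftrightarrow> \<rho> \<in> borel_measurable (lebesgue_on {-1..1}) \<and> (\<forall>r\<in>{-1..1}. \<rho> r \<in> {0..1}) \<and>
    (\<forall>r\<in>{-1..1}. \<forall>t>0. \<rho> r = T t \<rho> r + j / 2 * (boundary_flux 1 r t * (1 - \<rho> 1 ^ K)
        - boundary_flux (- 1) r t * (1 - (1 - \<rho> (- 1)) ^ K)))"
proof -
  have "(\<integral>s. P s r 1 * c - P s r (- 1) * d \<partial>lebesgue_on {0..t}) = boundary_flux 1 r t * c - boundary_flux (- 1) r t * d"
    if "r \<in> {-1..1}" "t > 0" for r t c d
    using boundary_integral[of 1 t r] boundary_integral[of "- 1" t r] that by simp
  then show ?thesis
    unfolding stationary_solution_def macroscopic_solution_def kernel_op_def by auto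
qed

lemma boundary_potential_diff: "boundary_potential 1 q - boundary_potential (- 1) q = 2 * q"
  by (simp add: boundary_potential_def power2_eq_square field_simps)

text \<open>The difference of the two parabolas is linear, so equal fluxes at the ends are balanced
  by a linear profile; the particle density at 1 and the vacancy density at -1 are both
  \<open>a\<close>.\<close>

lemma linear_stationary_solution:
  assumes a: "0 \<le> a" "a \<le> 1" "a = j * (1 - a ^ K) + 1 / 2" and j: "0 < j"
  shows "stationary_solution P j K (\<lambda>r. j * (1 - a ^ K) * r + 1 / 2)"
proof -
  define J where "J = j * (1 - a ^ K)"
  have aJ: "J * 1 + 1 / 2 = a" "1 - (J * - 1 + 1 / 2) = a" using a(3) by (simp_all add: J_def)
  have J: "0 \<le> J" "J \<le> 1 / 2" using a j by (auto simp: J_def power_le_one)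
  have cont: "continuous_on A (\<lambda>r. J * r + 1 / 2)" for A by (intro continuous_intros)
  show ?thesis unfolding J_def[symmetric] stationary_solution_iff
  proof (intro conjI ballI allI impI)
    show "(\<lambda>r. J * r + 1 / 2) \<in> borel_measurable (lebesgue_on {-1..1})"
      by (intro continuous_borel_measurable_lebesgue_on cont)
    fix r :: real assume r: "r \<in> {-1..1}"
    have "\<bar>J * r\<bar> \<le> 1 / 2 * 1" unfolding abs_mult using J r by (intro mult_mono) auto
    then show "J * r + 1 / 2 \<in> {0..1}" by (auto simp: abs_le_iff)
    fix t :: real assume t: "t > 0"
    have lin: "bounded_density (\<lambda>r. J * r)" by (intro bounded_density_continuous continuous_intros)
    have "T t (\<lambda>r. J * r + 1 / 2) r = T t (\<lambda>r. J * r - - (1 / 2)) r" by simp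
    also have "\<dots> = T t (\<lambda>r. J * r) r + 1 / 2"
      using T_const[OF t r, of "- (1 / 2)"] by (subst T_diff[OF t r lin]) (auto intro: bounded_density_continuous)
    also have "T t (\<lambda>r. J * r) r = J / 2 * T t (\<lambda>q. boundary_potential 1 q - boundary_potential (- 1) q) r"
      unfolding T_scale[symmetric] by (simp add: boundary_potential_diff)
    also have "T t (\<lambda>q. boundary_potential 1 q - boundary_potential (- 1) q) r
        = T t (boundary_potential 1) r - T t (boundary_potential (- 1)) r"
      by (intro T_diff t r bounded_density_continuous boundary_potential_continuous)
    finally have T: "T t (\<lambda>r. J * r + 1 / 2) r = J / 2 * (T t (boundary_potential 1) r - T t (boundary_potential (- 1)) r) + 1 / 2" .
    have "j / 2 * (boundary_flux 1 r t * (1 - a ^ K) - boundary_flux (- 1) r t * (1 - a ^ K))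
       = J / 2 * (boundary_flux 1 r t - boundary_flux (- 1) r t)"
      by (simp add: J_def left_diff_distrib[symmetric])
    also have "boundary_flux 1 r t - boundary_flux (- 1) r t
       = 2 * r - (T t (boundary_potential 1) r - T t (boundary_potential (- 1)) r)"
      unfolding boundary_flux_def boundary_potential_diff[symmetric] by simp
    finally have "j / 2 * (boundary_flux 1 r t * (1 - a ^ K) - boundary_flux (- 1) r t * (1 - a ^ K))
       = J * r - J / 2 * (T t (boundary_potential 1) r - T t (boundary_potential (- 1)) r)"
      by (simp add: algebra_simps)
    then show "J * r + 1 / 2 = T t (\<lambda>r. J * r + 1 / 2) r + j / 2 * (boundary_flux 1 r t * (1 - (J * 1 + 1 / 2) ^ K)
        - boundary_flux (- 1) r t * (1 - (1 - (J * - 1 + 1 / 2)) ^ K))"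
      unfolding T aJ by linarith
  qed
qed

lemma stationary_solution_linear:
  assumes sol: "stationary_solution P j K \<rho>" and j: "0 < j" and K: "K \<ge> 1"
  shows "0 < \<rho> 1" "\<rho> 1 = j * (1 - \<rho> 1 ^ K) + 1 / 2"
    "\<And>r. r \<in> {-1..1} \<Longrightarrow> \<rho> r = j * (1 - \<rho> 1 ^ K) * r + 1 / 2"
proof -
  define C C' where "C = j / 2 * (1 - \<rho> 1 ^ K)" and "C' = j / 2 * (1 - (1 - \<rho> (- 1)) ^ K)"
  have \<rho>01: "0 \<le> \<rho> r \<and> \<rho> r \<le> 1" if "r \<in> {-1..1}" for r using sol that by (auto simp: stationary_solution_iff)
  have eq: "\<rho> r = T t \<rho> r + C * boundary_flux 1 r t - C' * boundary_flux (- 1) r t" if "r \<in> {-1..1}" "t > 0" for r t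
    using sol that by (auto simp: stationary_solution_iff C_def C'_def algebra_simps)
  have b\<rho>: "bounded_density \<rho>"
    unfolding bounded_density_def using sol \<rho>01 by (auto simp: stationary_solution_iff intro!: exI[of _ 1])
  define h where "h q = C * boundary_potential 1 q - C' * boundary_potential (- 1) q" for q
  have ch: "continuous_on A h" for A
    unfolding h_def by (intro continuous_intros boundary_potential_continuous)
  have bh: "bounded_density h" by (intro bounded_density_continuous ch)
  define \<psi> where "\<psi> q = \<rho> q - h q" for q
  have b\<psi>: "bounded_density \<psi>" unfolding \<psi>_def by (intro bounded_density_diff b\<rho> bh)
  have T\<psi>: "\<psi> r = T t \<psi> r + (C - C') * t / 2" if r: "r \<in> {-1..1}" and t: "t > 0" for r t
  proof -
    have "T t h r = T t (\<lambda>q. C * boundary_potential 1 q) r - T t (\<lambda>q. C' * boundary_potential (- 1) q) r"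
      unfolding h_def by (intro T_diff t r bounded_density_continuous continuous_intros boundary_potential_continuous)
    then have "T t h r = C * T t (boundary_potential 1) r - C' * T t (boundary_potential (- 1)) r"
      unfolding T_scale .
    then show ?thesis
      unfolding \<psi>_def T_diff[OF t r b\<rho> bh] using eq[OF r t]
      by (simp add: h_def boundary_flux_def field_simps)
  qed
  obtain B where B: "\<And>q. q \<in> {-1..1} \<Longrightarrow> \<bar>\<psi> q\<bar> \<le> B" using b\<psi> unfolding bounded_density_def by blast
  have CC: "C = C'"
  proof (rule ccontr)
    assume ne: "C \<noteq> C'"
    \<comment> \<open>Makes the drift \<open>2 * \<bar>B\<bar> + 1\<close>, more than two values
      bounded by \<open>B\<close> can differ.\<close>
    define t where "t = (4 * \<bar>B\<bar> + 2) / \<bar>C - C'\<bar>"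
    have t: "t > 0" using ne by (simp add: t_def)
    have "(C - C') * t / 2 = \<psi> 0 - T t \<psi> 0" using T\<psi>[of 0 t] t by simp
    moreover have "\<bar>\<psi> 0\<bar> \<le> B" "\<bar>T t \<psi> 0\<bar> \<le> B" using B t by (auto intro!: T_bound b\<psi>)
    ultimately have "\<bar>(C - C') * t / 2\<bar> \<le> 2 * B" by linarith
    moreover have "\<bar>(C - C') * t / 2\<bar> = 2 * \<bar>B\<bar> + 1"
      using ne t by (simp add: abs_mult t_def)
    ultimately show False by linarith
  qed
  have inv: "T t \<psi> r = \<psi> r" if "r \<in> {-1..1}" "t > 0" for r t using T\<psi>[OF that] CC by simp
  \<comment> \<open>Invariance upgrades \<psi> from measurable to continuous, as the
    characterisation of the generator requires.\<close>
  have c\<psi>: "continuous_on {-1..1} \<psi>"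
    using T_continuous[OF zero_less_one b\<psi>] by (rule continuous_on_eq) (simp add: inv)
  have "uniform_limit {-1..1} (\<lambda>t r. (T t \<psi> r - \<psi> r) / t) (\<lambda>_. 0) (at_right 0)"
    unfolding uniform_limit_iff
    by (auto simp: inv eventually_at_right_field intro!: exI[of _ 1])
  then have "half_neumann_laplacian \<psi> (\<lambda>_. 0)" using T_generator[OF c\<psi>, of "\<lambda>_. 0"] by simp
  then obtain f' f'' where d: "\<And>r. r \<in> {-1..1} \<Longrightarrow> (\<psi> has_real_derivative f' r) (at r within {-1..1})"
    "\<And>r. r \<in> {-1..1} \<Longrightarrow> (f' has_real_derivative 0) (at r within {-1..1})" "f' 1 = 0"
    unfolding half_neumann_laplacian_def by force
  obtain k' where "\<forall>r\<in>{-1..1}. f' r = k'"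
    using has_field_derivative_zero_constant[of "{-1..1}" f'] d(2) by (auto simp: convex_closed_interval)
  then have "\<And>r. r \<in> {-1..1} \<Longrightarrow> f' r = 0" using d(3) by auto
  then obtain k where k: "\<And>r. r \<in> {-1..1} \<Longrightarrow> \<psi> r = k"
    using has_field_derivative_zero_constant[of "{-1..1}" \<psi>] d(1) by (auto simp: convex_closed_interval)
  have lin: "\<rho> r = j * (1 - \<rho> 1 ^ K) * r + k" if "r \<in> {-1..1}" for r
  proof -
    have "h r = C * (boundary_potential 1 r - boundary_potential (- 1) r)" by (simp add: h_def CC algebra_simps)
    then have "h r = j * (1 - \<rho> 1 ^ K) * r" unfolding boundary_potential_diff by (simp add: C_def)
    then show ?thesis using k[OF that] by (simp add: \<psi>_def)
  qed
  \<comment> \<open>Equal fluxes equate \<open>K\<close>-th powers of nonnegative numbers, hence the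
    bases; this fixes the constant \<open>k\<close>.\<close>
  have "\<rho> 1 ^ K = (1 - \<rho> (- 1)) ^ K" using CC j by (simp add: C_def C'_def)
  then have "\<rho> 1 = 1 - \<rho> (- 1)" using power_eq_imp_eq_base[of "\<rho> 1" K "1 - \<rho> (- 1)"] \<rho>01[of 1] \<rho>01[of "- 1"] K by simp
  then have k2: "k = 1 / 2" using lin[of 1] lin[of "- 1"] by simp
  show "\<rho> 1 = j * (1 - \<rho> 1 ^ K) + 1 / 2" using lin[of 1] k2 by simp
  moreover have "0 \<le> j * (1 - \<rho> 1 ^ K)" using j \<rho>01[of 1] by (simp add: power_le_one)
  ultimately show "0 < \<rho> 1" by linarith
  show "\<rho> r = j * (1 - \<rho> 1 ^ K) * r + 1 / 2" if "r \<in> {-1..1}" for r using lin[OF that] k2 by simp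
qed

end

section \<open>Existence, uniqueness and convergence\<close>

text \<open>The left side is strictly increasing and runs from 0 to \<open>1 + j\<close> on
  \<open>[0, 1]\<close>, past \<open>j + 1 / 2\<close>; hence also \<open>\<alpha> \<le> 1\<close>,
  which makes the profile a density.\<close>

lemma corner_density_exists:
  fixes j :: real
  assumes "j > 0" "K \<ge> 1"
  obtains \<alpha> where "0 < \<alpha>" "\<alpha> \<le> 1" "\<alpha> * (1 + j * \<alpha> ^ (K - 1)) = j + 1 / 2"
    "\<And>\<beta>. \<beta> > 0 \<Longrightarrow> \<beta> * (1 + j * \<beta> ^ (K - 1)) = j + 1 / 2 \<Longrightarrow> \<beta> = \<alpha>"
proof -
  let ?f = "\<lambda>x::real. x * (1 + j * x ^ (K - 1))"
  have "\<exists>x\<ge>0. x \<le> 1 \<and> ?f x = j + 1 / 2"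
    using assms by (intro IVT') (auto intro!: continuous_intros)
  then obtain \<alpha> where \<alpha>: "0 \<le> \<alpha>" "\<alpha> \<le> 1" "?f \<alpha> = j + 1 / 2" by blast
  have "\<alpha> \<noteq> 0" using \<alpha>(3) assms(1) by auto
  have mono: "?f x < ?f y" if "0 < x" "x < y" for x y
  proof (rule mult_less_le_imp_less)
    show "0 < 1 + j * x ^ (K - 1)" using that assms(1) by (intro add_pos_nonneg) auto
    have "x ^ (K - 1) \<le> y ^ (K - 1)" using that by (intro power_mono) auto
    then show "1 + j * x ^ (K - 1) \<le> 1 + j * y ^ (K - 1)" using assms(1) by simp
  qed (use that assms in auto)
  show thesis
  proof (rule that[of \<alpha>])
    fix \<beta> :: real assume "\<beta> > 0" "\<beta> * (1 + j * \<beta> ^ (K - 1)) = j + 1 / 2"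
    then show "\<beta> = \<alpha>" using mono[of \<alpha> \<beta>] mono[of \<beta> \<alpha>] \<alpha> \<open>\<alpha> \<noteq> 0\<close> by (cases \<alpha> \<beta> rule: linorder_cases) auto
  qed (use \<alpha> \<open>\<alpha> \<noteq> 0\<close> in auto)
qed

lemma corner_density_iff:
  fixes \<alpha> j :: real
  assumes "K \<ge> 1"
  shows "\<alpha> * (1 + j * \<alpha> ^ (K - 1)) = j + 1 / 2 \<longleftrightarrow> \<alpha> = j * (1 - \<alpha> ^ K) + 1 / 2"
proof -
  have "\<alpha> ^ K = \<alpha> * \<alpha> ^ (K - 1)" using assms by (cases K) auto
  then have "\<alpha> * (1 + j * \<alpha> ^ (K - 1)) = \<alpha> + j * \<alpha> ^ K" by (simp add: distrib_left)
  moreover have "j * (1 - \<alpha> ^ K) + 1 / 2 = j - j * \<alpha> ^ K + 1 / 2" by (simp add: right_diff_distrib)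
  ultimately show ?thesis by linarith
qed

lemma finite_distinct_tuples: "finite (distinct_tuples N k)"
  unfolding distinct_tuples_def by (rule finite_subset[of _ "{1..k} \<rightarrow>\<^sub>E Lam N"]) (auto intro: finite_PiE)

lemma distinct_tuples_nonempty: "k \<le> N \<Longrightarrow> distinct_tuples N k \<noteq> {}"
proof -
  assume "k \<le> N"
  then have "restrict int {1..k} \<in> distinct_tuples N k"
    by (auto simp: distinct_tuples_def Lam_def inj_on_def)
  then show ?thesis by blast
qed

lemma correlations_tend_to_product:
  fixes j a :: real and \<mu> :: "nat \<Rightarrow> config pmf"
  assumes j: "j > 0" and K: "K \<ge> 1"
    and inv: "\<And>N. N \<ge> 1 \<Longrightarrow> I_plus K N \<subseteq> Lam N \<Longrightarrow> I_minus K N \<subseteq> Lam N \<Longrightarrow> invariant_measure j K N (\<mu> N)"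
    and a: "0 < a" "a \<le> 1" "a = j * (1 - a ^ K) + 1 / 2"
  defines "\<rho> \<equiv> \<lambda>r. j * (1 - a ^ K) * r + 1 / 2"
  shows "(\<lambda>N. Max ((\<lambda>x. \<bar>measure_pmf.expectation (\<mu> N) (\<lambda>\<eta>. \<Prod>i\<in>{1..k}. \<eta> (x i))
            - (\<Prod>i\<in>{1..k}. \<rho> (real_of_int (x i) / real N))\<bar>) ` distinct_tuples N k)) \<longlonglongrightarrow> 0"
proof -
  define d where "d N x = \<bar>measure_pmf.expectation (\<mu> N) (\<lambda>\<eta>. \<Prod>i\<in>{1..k}. \<eta> (x i))
            - (\<Prod>i\<in>{1..k}. \<rho> (real_of_int (x i) / real N))\<bar>" for N x
  \<comment> \<open>The constant does not involve \<open>N\<close>, so the final bound decays like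
    \<open>sqrt (e N)\<close>, that is \<open>N powr (- 1 / 16)\<close>.\<close>
  define C where "C = stationary_state.factor_const j K a k"
  define e where "e N = real N powr (- 1 / 8)" for N
  have "(\<lambda>N. 2 * real K * e N ^ 7) \<longlonglongrightarrow> 0" unfolding e_def by real_asymp
  then have "\<forall>\<^sub>F N in sequentially. 2 * real K * e N ^ 7 < 1" by (rule order_tendstoD(2)) simp
  then have bound: "\<forall>\<^sub>F N in sequentially. Max (d N ` distinct_tuples N k) \<in> {0..real k * (C * sqrt (e N))}"
    using eventually_ge_at_top[of "2 * K + k"]
  proof eventually_elim
    case (elim N)
    then have N: "N \<ge> 1" "2 * K \<le> N" "k \<le> N" using K by auto
    interpret stationary_state j K N "\<mu> N"
    proof (rule invariant_measure_stationary_state[OF j K N(2)])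
      show "invariant_measure j K N (\<mu> N)"
        using N K by (intro inv) (auto simp: I_plus_def I_minus_def Lam_def)
    qed
    have e0: "0 < e N" using N by (simp add: e_def)
    have e8: "real N * e N ^ 8 = 1"
    proof -
      have "e N ^ 8 = real N powr (- 1)" using N by (simp add: e_def powr_power)
      then show ?thesis using N by (simp add: powr_minus_divide)
    qed
    have e7: "2 * real K * e N ^ 7 \<le> 1" using elim by simp
    have d: "d N x \<in> {0..real k * (C * sqrt (e N))}" if x: "x \<in> distinct_tuples N k" for x
    proof -
      have x': "inj_on x {1..k}" "x ` {1..k} \<subseteq> Lam N" using x by (auto simp: distinct_tuples_def)
      have "(\<Prod>i\<in>{1..k}. \<rho> (real_of_int (x i) / real N)) = (\<Prod>y\<in>x ` {1..k}. profile a y)"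
        unfolding prod.reindex[OF x'(1)] \<rho>_def profile_def by simp
      moreover have "measure_pmf.expectation (\<mu> N) (\<lambda>\<eta>. \<Prod>i\<in>{1..k}. \<eta> (x i)) = corr (x ` {1..k})"
        unfolding corr_def prod.reindex[OF x'(1)] by simp
      moreover have "card (x ` {1..k}) = k" using card_image[OF x'(1)] by simp
      ultimately show ?thesis
        using factorization[OF a e0 e8 e7 _ x'(2), of k] by (simp add: d_def C_def)
    qed
    \<comment> \<open>The bound \<open>k \<le> N\<close> makes the set of tuples nonempty, so that
      \<open>Max\<close> is attained.\<close>
    have "Max (d N ` distinct_tuples N k) \<in> d N ` distinct_tuples N k"
      using distinct_tuples_nonempty[OF N(3)] by (intro Max_in finite_imageI finite_distinct_tuples) blast
    then obtain x where "Max (d N ` distinct_tuples N k) = d N x" "x \<in> distinct_tuples N k" by (rule imageE)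
    then show ?case using d by (simp only:)
  qed
  have "(\<lambda>N. Max (d N ` distinct_tuples N k)) \<longlonglongrightarrow> 0"
  proof (rule tendsto_sandwich[OF _ _ tendsto_const])
    show "\<forall>\<^sub>F N in sequentially. 0 \<le> Max (d N ` distinct_tuples N k)"
      using bound by eventually_elim simp
    show "\<forall>\<^sub>F N in sequentially. Max (d N ` distinct_tuples N k) \<le> real k * (C * sqrt (e N))"
      using bound by eventually_elim simp
    show "(\<lambda>N. real k * (C * sqrt (e N))) \<longlonglongrightarrow> 0" unfolding e_def by real_asymp
  qed
  then show ?thesis unfolding d_def .
qed

theorem theorem2p2:
  fixes j :: real and K :: nat
    and P :: "real \<Rightarrow> real \<Rightarrow> real \<Rightarrow> real"
    and \<mu> :: "nat \<Rightarrow> config pmf"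
  assumes "j > 0" and "K \<ge> 1"
    and "neumann_transition_density P"
    and "\<And>N. N \<ge> 1 \<Longrightarrow> I_plus K N \<subseteq> Lam N \<Longrightarrow> I_minus K N \<subseteq> Lam N \<Longrightarrow>
           invariant_measure j K N (\<mu> N)"
  shows "\<exists>\<alpha>::real.
           \<alpha> > 0 \<and> \<alpha> * (1 + j * \<alpha> ^ (K - 1)) = j + 1 / 2 \<and>
           (\<forall>\<beta>>0. \<beta> * (1 + j * \<beta> ^ (K - 1)) = j + 1 / 2 \<longrightarrow> \<beta> = \<alpha>) \<and>
           (\<exists>\<rho>. (\<forall>r\<in>{-1..1}. \<rho> r = j * (1 - \<alpha> ^ K) * r + 1 / 2) \<and>
              stationary_solution P j K \<rho> \<and>
              (\<forall>\<sigma>. stationary_solution P j K \<sigma> \<longrightarrow> (\<forall>r\<in>{-1..1}. \<sigma> r = \<rho> r)) \<and>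
              (\<forall>k\<ge>1. (\<lambda>N. Max ((\<lambda>x.
                  \<bar>measure_pmf.expectation (\<mu> N) (\<lambda>\<eta>. \<Prod>i\<in>{1..k}. \<eta> (x i))
                    - (\<Prod>i\<in>{1..k}. \<rho> (real_of_int (x i) / real N))\<bar>) ` distinct_tuples N k))
                \<longlonglongrightarrow> 0))"
proof -
  interpret neumann_kernel P by unfold_locales fact
  obtain \<alpha> where \<alpha>: "0 < \<alpha>" "\<alpha> \<le> 1" "\<alpha> * (1 + j * \<alpha> ^ (K - 1)) = j + 1 / 2"
    and uniq: "\<And>\<beta>. \<beta> > 0 \<Longrightarrow> \<beta> * (1 + j * \<beta> ^ (K - 1)) = j + 1 / 2 \<Longrightarrow> \<beta> = \<alpha>"
    using corner_density_exists[OF assms(1,2)] by metis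
  have \<alpha>': "\<alpha> = j * (1 - \<alpha> ^ K) + 1 / 2" using \<alpha>(3) corner_density_iff[OF assms(2)] by blast
  have unique: "\<sigma> r = j * (1 - \<alpha> ^ K) * r + 1 / 2"
    if "stationary_solution P j K \<sigma>" "r \<in> {-1..1}" for \<sigma> r
  proof -
    note lin = stationary_solution_linear[OF that(1) assms(1,2)]
    have "\<sigma> 1 = \<alpha>" using uniq[OF lin(1)] lin(2) corner_density_iff[OF assms(2)] by blast
    then show ?thesis using lin(3)[OF that(2)] by simp
  qed
  have sol: "stationary_solution P j K (\<lambda>r. j * (1 - \<alpha> ^ K) * r + 1 / 2)"
    using linear_stationary_solution[of \<alpha> j K] \<alpha> \<alpha>' assms(1) by simp
  show ?thesis
  proof (intro exI[of _ \<alpha>] exI[of _ "\<lambda>r. j * (1 - \<alpha> ^ K) * r + 1 / 2"] conjI allI ballI impI)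
    show "\<beta> = \<alpha>" if "\<beta> > 0" "\<beta> * (1 + j * \<beta> ^ (K - 1)) = j + 1 / 2" for \<beta>
      using that by (rule uniq)
  qed (rule refl \<alpha>(1,3) sol unique correlations_tend_to_product[OF assms(1,2,4) \<alpha>(1,2) \<alpha>'] | assumption)+
qed

end
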